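(* Let $R>1$ and $q>R^3$. There exist $\varepsilon_0=\varepsilon_0(q)>0$ and $\varepsilon_1=\varepsilon_1(q)>0$ (for the given $R$) such that the following holds. Let $\Sigma=B_\rho(z_0)$ be a disk with $0\in\Sigma\subset B_1(0)$, $|z_0|<\varepsilon_0$ and $1-\varepsilon_1<\rho<1$, and let $A:\mathbb{R}^2\to\mathbb{R}$ be given by $A=+1$ outside $B_R(0)$, $A=-1$ in $B_R(0)\setminus\Sigma$, $A=+1$ in $\Sigma$. Let $f=F\,\mathcal{H}^1\lfloor\partial B_q(0)$ with $F=\sum_{k\ge1}\alpha_k\cos(k\theta)+\sum_{k\ge1}\beta_k\sin(k\theta)$, where the real Fourier coefficients satisfy $\sum_{k}\{|\alpha_k|+|\beta_k|\}<\infty$. Then the configuration given by $A$ and $f$ is non-resonant, i.e. $\limsup_{\eta\to0}E_\eta(u_\eta)<\infty$.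
   Context: $\mathbb{R}^2$ is identified with $\mathbb{C}$; $\theta$ is the polar angle, $x=r(\cos\theta,\sin\theta)$. $B_r(x_0)$ is the disk of radius $r$ centered at $x_0$; $\mathcal{H}^1\lfloor\Gamma$ is one-dimensional Hausdorff measure restricted to the curve $\Gamma$, so that $f$ acts on test functions by $\langle f,\varphi\rangle=\int_{\partial B_q(0)}F\varphi\,d\mathcal{H}^1$. $\dot H^1(\mathbb{R}^2)=\{U\in L^2_{\mathrm{loc}}(\mathbb{R}^2): \nabla U\in L^2(\mathbb{R}^2)\}$ (real- or complex-valued functions). For $\eta>0$ set $a_\eta(x)=A(x)+i\eta$, and let $u_\eta\in\dot H^1(\mathbb{R}^2)$ be the complex-valued weak solution, unique up to an additive constant, of $\nabla\cdot(a_\eta\nabla u_\eta)=f$ on $\mathbb{R}^2$ (with $\nabla u_\eta\to0$ as $|x|\to\infty$). The energy is $E_\eta(u_\eta)=\frac{\eta}{2}\int_{\mathbb{R}^2}|\nabla u_\eta|^2\,dx$, and a configuration (coefficient $A$ and source $f$) is called resonant if $\limsup_{\eta\to0}E_\eta(u_\eta)=\infty$, and non-resonant otherwise. *)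

theory Defs
  imports "HOL-Analysis.Analysis"
begin

text \<open>
  The plane is identified with \<^typ>\<open>complex\<close>; a complex-valued gradient field is a function into
  \<^typ>\<open>complex \<times> complex\<close>, whose product norm is the Euclidean one.
\<close>

definition partial1 :: "(complex \<Rightarrow> real) \<Rightarrow> complex \<Rightarrow> real"
  where "partial1 \<phi> x = frechet_derivative \<phi> (at x) 1"

definition partial2 :: "(complex \<Rightarrow> real) \<Rightarrow> complex \<Rightarrow> real"
  where "partial2 \<phi> x = frechet_derivative \<phi> (at x) \<i>"

primrec times_cont_diff :: "nat \<Rightarrow> (complex \<Rightarrow> real) \<Rightarrow> bool"
  where
    "times_cont_diff 0 \<phi> \<longleftrightarrow> continuous_on UNIV \<phi>"
  | "times_cont_diff (Suc n) \<phi> \<longleftrightarrow>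
       \<phi> differentiable_on UNIV \<and> times_cont_diff n (partial1 \<phi>) \<and> times_cont_diff n (partial2 \<phi>)"

definition test_function :: "(complex \<Rightarrow> real) \<Rightarrow> bool"
  where "test_function \<phi> \<longleftrightarrow> (\<forall>n. times_cont_diff n \<phi>) \<and> compact (closure {x. \<phi> x \<noteq> 0})"

definition locally_integrable :: "(complex \<Rightarrow> 'b::{banach, second_countable_topology}) \<Rightarrow> bool"
  where "locally_integrable U \<longleftrightarrow> (\<forall>K. compact K \<longrightarrow> set_integrable lebesgue K U)"

definition L2 :: "(complex \<Rightarrow> 'b::{banach, second_countable_topology}) set"
  where "L2 = {U. U \<in> borel_measurable lebesgue \<and> integrable lebesgue (\<lambda>x. (norm (U x))\<^sup>2)}"

definition L2_loc :: "(complex \<Rightarrow> 'b::{banach, second_countable_topology}) set"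
  where "L2_loc = {U. U \<in> borel_measurable lebesgue \<and>
    (\<forall>K. compact K \<longrightarrow> set_integrable lebesgue K (\<lambda>x. (norm (U x))\<^sup>2))}"

definition has_weak_gradient :: "(complex \<Rightarrow> complex) \<Rightarrow> (complex \<Rightarrow> complex \<times> complex) \<Rightarrow> bool"
  where "has_weak_gradient U G \<longleftrightarrow> locally_integrable U \<and> locally_integrable G \<and>
    (\<forall>\<phi>. test_function \<phi> \<longrightarrow>
      (LINT x|lebesgue. partial1 \<phi> x *\<^sub>R U x) = - (LINT x|lebesgue. \<phi> x *\<^sub>R fst (G x)) \<and>
      (LINT x|lebesgue. partial2 \<phi> x *\<^sub>R U x) = - (LINT x|lebesgue. \<phi> x *\<^sub>R snd (G x)))"

text \<open>The weak gradient is unique up to null sets, so the choice of a representative is immaterial.\<close>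

definition weak_grad :: "(complex \<Rightarrow> complex) \<Rightarrow> complex \<Rightarrow> complex \<times> complex"
  where "weak_grad U = (SOME G. has_weak_gradient U G)"

definition H1_dot :: "(complex \<Rightarrow> complex) set"
  where "H1_dot = {U \<in> L2_loc. (\<exists>G. has_weak_gradient U G) \<and> weak_grad U \<in> L2}"

text \<open>
  The normalising constant of the one-dimensional measure is 1.  Boundedness of the covering sets
  is required since \<^const>\<open>diameter\<close> is unspecified on unbounded sets.
\<close>

definition hausdorff1_pre :: "real \<Rightarrow> complex set \<Rightarrow> ennreal"
  where "hausdorff1_pre \<delta> S =
    Inf {(\<Sum>j. ennreal (diameter (C j))) |C :: nat \<Rightarrow> complex set.
           S \<subseteq> (\<Union>j. C j) \<and> (\<forall>j. bounded (C j) \<and> diameter (C j) \<le> \<delta>)}"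

definition hausdorff1_outer :: "complex set \<Rightarrow> ennreal"
  where "hausdorff1_outer S = (SUP \<delta>\<in>{0<..}. hausdorff1_pre \<delta> S)"

text \<open>
  The outer measure is a metric outer measure, hence countably additive on the Borel sets; so
  \<^const>\<open>measure_of\<close> does not fall back to the zero measure here.
\<close>

definition hausdorff1 :: "complex measure"
  where "hausdorff1 = measure_of UNIV (sets borel) hausdorff1_outer"

definition coefficient :: "real \<Rightarrow> complex set \<Rightarrow> complex \<Rightarrow> real"
  where "coefficient R \<Sigma> x = (if x \<notin> ball 0 R then 1 else if x \<in> \<Sigma> then 1 else - 1)"

text \<open>The index shift encodes summation over \<open>k \<ge> 1\<close>; the values \<open>\<alpha> 0\<close> and \<open>\<beta> 0\<close> are not used.\<close>

definition fourier_density :: "(nat \<Rightarrow> real) \<Rightarrow> (nat \<Rightarrow> real) \<Rightarrow> complex \<Rightarrow> real"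
  where "fourier_density \<alpha> \<beta> x =
    (\<Sum>k. \<alpha> (Suc k) * cos (real (Suc k) * Arg x)) + (\<Sum>k. \<beta> (Suc k) * sin (real (Suc k) * Arg x))"

definition circle_source :: "real \<Rightarrow> (complex \<Rightarrow> real) \<Rightarrow> (complex \<Rightarrow> real) \<Rightarrow> real"
  where "circle_source q F \<phi> = (LINT x:sphere 0 q|hausdorff1. F x * \<phi> x)"

definition weak_solution ::
    "(complex \<Rightarrow> real) \<Rightarrow> ((complex \<Rightarrow> real) \<Rightarrow> real) \<Rightarrow> real \<Rightarrow> (complex \<Rightarrow> complex) \<Rightarrow> bool"
  where "weak_solution A f \<eta> u \<longleftrightarrow> u \<in> H1_dot \<and>
    (\<forall>\<phi>. test_function \<phi> \<longrightarrow>
      - (LINT x|lebesgue. (complex_of_real (A x) + \<i> * complex_of_real \<eta>) *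
            (fst (weak_grad u x) * complex_of_real (partial1 \<phi> x) +
             snd (weak_grad u x) * complex_of_real (partial2 \<phi> x))) = complex_of_real (f \<phi>)) \<and>
    (\<forall>\<epsilon>>0. \<exists>M. AE x in lebesgue. norm x \<ge> M \<longrightarrow> norm (weak_grad u x) < \<epsilon>)"

definition energy :: "real \<Rightarrow> (complex \<Rightarrow> complex) \<Rightarrow> real"
  where "energy \<eta> u = \<eta> / 2 * (LINT x|lebesgue. (norm (weak_grad u x))\<^sup>2)"

text \<open>
  For each \<open>\<eta> > 0\<close> the weak solution is unique up to an additive constant, which does not affect the
  energy, so it does not matter which solution \<open>u \<eta>\<close> is chosen.  The negation of \<open>resonant\<close> says
  that the upper limit of the energies is finite for every choice of the solutions.
\<close>

definition resonant :: "(complex \<Rightarrow> real) \<Rightarrow> ((complex \<Rightarrow> real) \<Rightarrow> real) \<Rightarrow> bool"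
  where "resonant A f \<longleftrightarrow>
    (\<exists>u. (\<forall>\<eta>>0. weak_solution A f \<eta> (u \<eta>)) \<and>
         Limsup (at_right 0) (\<lambda>\<eta>. ereal (energy \<eta> (u \<eta>))) = \<infinity>)"

end

theory Submission
  imports Defs "HOL-Complex_Analysis.Complex_Analysis"
begin

text \<open>
  The energies stay bounded, and in fact tend to zero, because the limiting equation
  \<open>\<nabla>\<cdot>(A \<nabla>v) = f\<close> has an exact solution \<open>v\<close> whose gradient \<open>V\<close> is square integrable.

  Existence of \<open>v\<close>: let \<open>U\<close> solve \<open>\<Delta>U = f\<close> in the homogeneous plane.  Put \<open>v = U\<close> outside
  \<open>B_R\<close>, compose \<open>U\<close> with the inversion in \<open>\<partial>B_R\<close> in the shell, and compose once more with the
  inversion in \<open>\<partial>\<Sigma>\<close> inside \<open>\<Sigma>\<close>.  An inversion fixes its circle pointwise and reverses the normal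
  derivative there, which is what the change of sign of \<open>A\<close> asks for.  The composition is a
  Moebius map on \<open>\<Sigma>\<close> and anticonformal on the shell, and it takes values in the disk of radius
  \<open>R\<^sup>2 / (\<rho> - |z\<^sub>0|)\<close>.  This radius is below \<open>q\<close> when \<open>\<Sigma>\<close> is close to the unit disk, because
  \<open>R\<^sup>2 < R\<^sup>3 < q\<close>; there \<open>U\<close> is harmonic and \<open>V\<close> is bounded.  The function \<open>U\<close> is even under the
  inversion in \<open>\<partial>B_q\<close>, which gives the decay of \<open>V\<close>.

  In complex notation the gradient of a harmonic function is the holomorphic function
  \<open>\<xi> = \<partial>\<^sub>1 v - \<i> \<partial>\<^sub>2 v\<close>, and reflection in a circle with center \<open>p\<close> turns into
  \<open>(x - p) \<xi>\<^sub>i = - cnj ((x - p) \<xi>\<^sub>o)\<close> on that circle.  So \<open>v\<close> itself is never needed: real and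
  imaginary part of one Green formula for \<open>\<phi> \<xi>\<close> (\<open>reflection_green\<close>) say that \<open>A V\<close> has
  divergence \<open>f\<close> and that \<open>V\<close> is curl-free.

  Comparison: let \<open>G\<close> be the gradient of a solution for the coefficient \<open>A + \<i> \<eta>\<close>.  Then
  \<open>(A + \<i> \<eta>) G - A V\<close> is divergence-free and \<open>G - V\<close> is curl-free, so they are orthogonal
  (\<open>divergence_free_curl_free_orthogonal\<close>).  Since \<open>A\<close> is real, the imaginary part of this
  orthogonality is \<open>\<parallel>G\<parallel>\<^sup>2 = Re \<langle>G, V\<rangle>\<close>, whence \<open>\<parallel>G\<parallel> \<le> \<parallel>V\<parallel>\<close> and the energy is at most
  \<open>\<eta> \<parallel>V\<parallel>\<^sup>2 / 2\<close>.

  Orthogonality comes from testing with the second derivatives of a radial function whose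
  Laplacian is the difference of two approximate identities at different scales: the average of
  the correlation of the two fields is then the same at all scales.  At small scales it tends to
  their inner product and at large scales to zero.

  About the Hausdorff measure on \<open>\<partial>B_q\<close> only two facts enter: it is finite and invariant under
  rotations.  Hence the source is a constant times the mean over the circle, and the constant
  is absorbed into \<open>U\<close>.
\<close>

section \<open>Smooth functions\<close>

text \<open>
  The one-variable analogue of \<^const>\<open>times_cont_diff\<close>; the derivative is an existential witness so that
  it can be given by a formula.
\<close>

primrec times_diff_real :: "nat \<Rightarrow> (real \<Rightarrow> real) \<Rightarrow> bool"
  where
    "times_diff_real 0 f \<longleftrightarrow> continuous_on UNIV f"
  | "times_diff_real (Suc n) f \<longleftrightarrow>
       (\<exists>f'. (\<forall>x. (f has_real_derivative f' x) (at x)) \<and> times_diff_real n f')"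

definition smooth_real :: "(real \<Rightarrow> real) \<Rightarrow> bool"
  where "smooth_real f \<longleftrightarrow> (\<forall>n. times_diff_real n f)"

lemma times_diff_real_SucD: "times_diff_real (Suc n) f \<Longrightarrow> times_diff_real n f"
proof (induction n arbitrary: f)
  case 0
  then obtain f' where "\<forall>x. (f has_real_derivative f' x) (at x)" by auto
  then show ?case
    by (auto intro!: continuous_at_imp_continuous_on DERIV_isCont)
next
  case (Suc n)
  then obtain f' where "\<forall>x. (f has_real_derivative f' x) (at x)" "times_diff_real (Suc n) f'"
    by (metis times_diff_real.simps(2))
  with Suc.IH show ?case by auto
qed

lemma times_diff_real_const: "times_diff_real n (\<lambda>x. c)"
proof (induction n arbitrary: c)
  case (Suc n)
  have "\<forall>x. ((\<lambda>x. c) has_real_derivative 0) (at x)" by (auto intro!: derivative_eq_intros)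
  with Suc show ?case by (metis times_diff_real.simps(2))
qed auto

lemma times_diff_real_ident: "times_diff_real n (\<lambda>x. x)"
proof (cases n)
  case (Suc m)
  have "\<forall>x. ((\<lambda>x. x) has_real_derivative 1) (at x)" by (auto intro!: derivative_eq_intros)
  with Suc times_diff_real_const[of m 1] show ?thesis by (metis times_diff_real.simps(2))
qed auto

lemma times_diff_real_add:
  "times_diff_real n f \<Longrightarrow> times_diff_real n g \<Longrightarrow> times_diff_real n (\<lambda>x. f x + g x)"
proof (induction n arbitrary: f g)
  case 0
  then show ?case by (auto intro!: continuous_intros)
next
  case (Suc n)
  then obtain f' g' where "\<forall>x. (f has_real_derivative f' x) (at x)" "times_diff_real n f'"
    "\<forall>x. (g has_real_derivative g' x) (at x)" "times_diff_real n g'"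
    by auto
  then show ?case
    by (auto intro!: exI[of _ "\<lambda>x. f' x + g' x"] Suc.IH derivative_eq_intros)
qed

lemma times_diff_real_mult:
  "times_diff_real n f \<Longrightarrow> times_diff_real n g \<Longrightarrow> times_diff_real n (\<lambda>x. f x * g x)"
proof (induction n arbitrary: f g)
  case 0
  then show ?case by (auto intro!: continuous_intros)
next
  case (Suc n)
  then obtain f' g' where d: "\<forall>x. (f has_real_derivative f' x) (at x)" "times_diff_real n f'"
    "\<forall>x. (g has_real_derivative g' x) (at x)" "times_diff_real n g'"
    by auto
  have "times_diff_real n f" "times_diff_real n g"
    using Suc.prems times_diff_real_SucD by blast+
  then have "times_diff_real n (\<lambda>x. f' x * g x + g' x * f x)"
    using d by (intro times_diff_real_add Suc.IH)
  moreover have "\<forall>x. ((\<lambda>x. f x * g x) has_real_derivative f' x * g x + g' x * f x) (at x)"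
    using d by (auto intro!: DERIV_mult)
  ultimately show ?case
    unfolding times_diff_real.simps by (intro exI[of _ "\<lambda>x. f' x * g x + g' x * f x"] conjI)
qed

lemma times_diff_real_affine:
  "times_diff_real n f \<Longrightarrow> times_diff_real n (\<lambda>x. f (a * x + b))"
proof (induction n arbitrary: f)
  case 0
  then have "continuous_on UNIV f" by simp
  then show ?case
    by (auto intro!: continuous_intros intro: continuous_on_compose2[of UNIV f])
next
  case (Suc n)
  then obtain f' where d: "\<forall>x. (f has_real_derivative f' x) (at x)" "times_diff_real n f'"
    by auto
  have "times_diff_real n (\<lambda>x. f' (a * x + b) * a)"
    by (intro times_diff_real_mult times_diff_real_const Suc.IH d)
  moreover have "((\<lambda>x. f (a * x + b)) has_real_derivative f' (a * x + b) * a) (at x)" for x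
    by (rule DERIV_chain2[where f=f]) (auto simp: d intro!: derivative_eq_intros)
  ultimately show ?case
    unfolding times_diff_real.simps by (intro exI[of _ "\<lambda>x. f' (a * x + b) * a"] conjI) auto
qed

lemma times_diff_real_inverse:
  assumes "\<And>x. f x \<noteq> 0"
  shows "times_diff_real n f \<Longrightarrow> times_diff_real n (\<lambda>x. inverse (f x))"
proof (induction n)
  case 0
  then show ?case using assms by (auto intro!: continuous_intros)
next
  case (Suc n)
  then obtain f' where d: "\<forall>x. (f has_real_derivative f' x) (at x)" "times_diff_real n f'"
    by auto
  have i: "times_diff_real n (\<lambda>x. inverse (f x))"
    using Suc times_diff_real_SucD by blast
  have "times_diff_real n (\<lambda>x. (- 1) * (inverse (f x) * f' x * inverse (f x)))"
    by (intro times_diff_real_mult times_diff_real_const i d)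
  moreover have "((\<lambda>x. inverse (f x)) has_real_derivative
      (- 1) * (inverse (f x) * f' x * inverse (f x))) (at x)" for x
    using DERIV_inverse'[of f "f' x" x UNIV] d assms by simp
  ultimately show ?case
    unfolding times_diff_real.simps
    by (intro exI[of _ "\<lambda>x. (- 1) * (inverse (f x) * f' x * inverse (f x))"] conjI) auto
qed

text \<open>
  The functions \<open>p (1 / t) exp (- 1 / t)\<close>, extended by zero to \<open>t \<le> 0\<close>, form a class closed under
  differentiation.  So smoothness of the classical flat function, which is the case \<open>p = 1\<close>,
  follows by induction for all members at once.
\<close>

definition flat_exp :: "real poly \<Rightarrow> real \<Rightarrow> real"
  where "flat_exp p t = (if t > 0 then poly p (1 / t) * exp (- (1 / t)) else 0)"

lemma poly_times_exp_minus_tendsto_0: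
  "((\<lambda>x. poly p x * exp (- x)) \<longlongrightarrow> (0::real)) at_top"
proof -
  have "((\<lambda>x. \<Sum>i\<le>degree p. coeff p i * (x ^ i / exp x)) \<longlongrightarrow> (\<Sum>i\<le>degree p. coeff p i * 0)) at_top"
    by (intro tendsto_intros tendsto_power_div_exp_0)
  then show ?thesis
    by (simp add: poly_altdef exp_minus sum_distrib_right divide_inverse mult.assoc)
qed

text \<open>
  Away from \<open>0\<close> this is the product rule.  At \<open>0\<close> the difference quotient is again of the form
  \<open>p' (1 / h) exp (- 1 / h)\<close>, which vanishes in the limit as the exponential beats every polynomial.
\<close>

lemma flat_exp_derivative:
  "(flat_exp p has_real_derivative flat_exp ([:0, 0, 1:] * (p - pderiv p)) t) (at t)"
proof -
  consider "t > 0" | "t < 0" | "t = 0" by linarith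
  then show ?thesis
  proof cases
    case 1
    have "((\<lambda>t. poly p (1 / t) * exp (- (1 / t))) has_real_derivative
        poly (pderiv p) (1 / t) * (- 1 / t\<^sup>2) * exp (- (1 / t))
        + exp (- (1 / t)) * (1 / t\<^sup>2) * poly p (1 / t)) (at t)"
      using 1 by (auto intro!: derivative_eq_intros simp: power2_eq_square field_simps)
    also have "poly (pderiv p) (1 / t) * (- 1 / t\<^sup>2) * exp (- (1 / t))
        + exp (- (1 / t)) * (1 / t\<^sup>2) * poly p (1 / t) = flat_exp ([:0, 0, 1:] * (p - pderiv p)) t"
      using 1 by (simp add: flat_exp_def power2_eq_square field_simps)
    finally show ?thesis
      by (rule DERIV_cong_ev[THEN iffD1, rotated -1])
        (use 1 in \<open>auto simp: flat_exp_def eventually_nhds intro!: exI[of _ "{0<..}"]\<close>)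
  next
    case 2
    have "((\<lambda>t. 0::real) has_real_derivative 0) (at t)" by simp
    then have "(flat_exp p has_real_derivative 0) (at t)"
      by (rule DERIV_cong_ev[THEN iffD1, rotated -1])
        (use 2 in \<open>auto simp: flat_exp_def eventually_nhds intro!: exI[of _ "{..<0}"]\<close>)
    then show ?thesis using 2 by (simp add: flat_exp_def)
  next
    case 3
    have "((\<lambda>h. flat_exp p h / h) \<longlongrightarrow> 0) (at_right 0)"
    proof -
      have "((\<lambda>h. poly ([:0,1:] * p) (1 / h) * exp (- (1 / h))) \<longlongrightarrow> 0) (at_right 0)"
        by (rule filterlim_compose[OF poly_times_exp_minus_tendsto_0])
          (simp add: filterlim_inverse_at_top_right flip: inverse_eq_divide)
      then show ?thesis
        by (rule Lim_transform_eventually)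
          (auto simp: flat_exp_def eventually_at_right_field intro!: exI[of _ 1])
    qed
    moreover have "((\<lambda>h. flat_exp p h / h) \<longlongrightarrow> 0) (at_left 0)"
      by (rule tendsto_eventually) (auto simp: flat_exp_def eventually_at_left_field intro!: exI[of _ "-1"])
    ultimately have "((\<lambda>h. flat_exp p h / h) \<longlongrightarrow> 0) (at 0)"
      by (simp add: filterlim_at_split)
    then show ?thesis
      using 3 by (simp add: DERIV_def flat_exp_def[of _ 0])
  qed
qed

lemma smooth_flat_exp: "times_diff_real n (flat_exp p)"
proof (induction n arbitrary: p)
  case 0
  show ?case
    using flat_exp_derivative by (auto intro!: continuous_at_imp_continuous_on DERIV_isCont)
next
  case (Suc n)
  then show ?case using flat_exp_derivative by (auto simp: exI)
qed

definition bump_exp :: "real \<Rightarrow> real" where "bump_exp = flat_exp 1"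

lemma bump_exp_simps: "t \<le> 0 \<Longrightarrow> bump_exp t = 0" "t > 0 \<Longrightarrow> bump_exp t > 0" "bump_exp t \<ge> 0"
  by (auto simp: bump_exp_def flat_exp_def)

text \<open>
  A smooth replacement for \<open>1 / s\<close>: it vanishes for \<open>s \<le> 1\<close> and equals \<open>1 / s\<close> for \<open>s \<ge> 2\<close>.  The
  vector field \<open>z cauchy_profile (|z|\<^sup>2)\<close> is thus, up to a smooth change near the origin, the
  gradient of \<open>log |z|\<close>, and its divergence is an approximate identity.
\<close>

definition cauchy_profile :: "real \<Rightarrow> real"
  where "cauchy_profile s = bump_exp (s - 1) * inverse (s * bump_exp (s - 1) + bump_exp (2 - s))"

lemma cauchy_profile_denominator_pos: "s * bump_exp (s - 1) + bump_exp (2 - s) > 0"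
proof (cases "s \<le> 1")
  case True then show ?thesis using bump_exp_simps by auto
next
  case False
  then have "s * bump_exp (s - 1) > 0" using bump_exp_simps by auto
  then show ?thesis using bump_exp_simps(3)[of "2 - s"] by linarith
qed

lemma smooth_cauchy_profile: "smooth_real cauchy_profile"
  unfolding smooth_real_def
proof
  fix n
  have 1: "times_diff_real n (\<lambda>s. bump_exp (1 * s + (-1)))" 
    and 2: "times_diff_real n (\<lambda>s. bump_exp ((- 1) * s + 2))"
    unfolding bump_exp_def by (intro times_diff_real_affine smooth_flat_exp)+
  have "times_diff_real n (\<lambda>s. bump_exp (1 * s + (-1)) *
      inverse (s * bump_exp (1 * s + (-1)) + bump_exp ((- 1) * s + 2)))"
    using cauchy_profile_denominator_pos
    by (intro times_diff_real_mult times_diff_real_inverse times_diff_real_add times_diff_real_ident 1 2)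
      (simp add: less_imp_neq[symmetric])
  then show "times_diff_real n cauchy_profile"
    by (simp add: cauchy_profile_def[abs_def])
qed

lemma cauchy_profile_eq:
  "s \<le> 1 \<Longrightarrow> cauchy_profile s = 0" "s \<ge> 2 \<Longrightarrow> cauchy_profile s = 1 / s"
  using bump_exp_simps(2)[of "s - 1"] by (auto simp: cauchy_profile_def bump_exp_simps(1) field_simps)

definition smooth_step :: "real \<Rightarrow> real" where "smooth_step s = s * cauchy_profile s"

lemma smooth_step_eq: "s \<le> 1 \<Longrightarrow> smooth_step s = 0" "s \<ge> 2 \<Longrightarrow> smooth_step s = 1"
  by (simp_all add: smooth_step_def cauchy_profile_eq)

lemma smooth_step_bounds: "0 \<le> smooth_step s" "smooth_step s \<le> 1"
proof -
  show "0 \<le> smooth_step s"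
  proof (cases "s \<le> 1")
    case False
    then show ?thesis
      unfolding smooth_step_def cauchy_profile_def using cauchy_profile_denominator_pos[of s]
      by (intro mult_nonneg_nonneg) (auto simp: bump_exp_simps)
  qed (simp add: smooth_step_eq)
  show "smooth_step s \<le> 1"
    using cauchy_profile_denominator_pos[of s] bump_exp_simps(3)[of "2 - s"]
    by (simp add: smooth_step_def cauchy_profile_def field_simps)
qed

lemma smooth_real_mult: "smooth_real f \<Longrightarrow> smooth_real g \<Longrightarrow> smooth_real (\<lambda>x. f x * g x)"
  by (simp add: smooth_real_def times_diff_real_mult)

lemma smooth_real_ident: "smooth_real (\<lambda>x. x)"
  by (simp add: smooth_real_def times_diff_real_ident)

lemma smooth_real_const: "smooth_real (\<lambda>x. c)"
  by (simp add: smooth_real_def times_diff_real_const)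

lemma smooth_real_add: "smooth_real f \<Longrightarrow> smooth_real g \<Longrightarrow> smooth_real (\<lambda>x. f x + g x)"
  by (simp add: smooth_real_def times_diff_real_add)

lemma smooth_real_affine: "smooth_real f \<Longrightarrow> smooth_real (\<lambda>x. f (a * x + b))"
  by (simp add: smooth_real_def times_diff_real_affine)

lemma smooth_real_deriv:
  assumes "smooth_real f"
  shows "(f has_real_derivative deriv f x) (at x)" "smooth_real (deriv f)"
proof -
  have *: "\<exists>f'. (\<forall>x. (f has_real_derivative f' x) (at x)) \<and> times_diff_real n f'" for n
    using assms times_diff_real.simps(2) smooth_real_def by blast
  then show "(f has_real_derivative deriv f x) (at x)"
    by (metis DERIV_imp_deriv)
  have "times_diff_real n (deriv f)" for n
  proof -
    obtain f' where f': "\<forall>x. (f has_real_derivative f' x) (at x)" "times_diff_real n f'"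
      using * by blast
    then have "f' = deriv f" by (intro ext sym[OF DERIV_imp_deriv]) blast
    then show ?thesis using f' by simp
  qed
  then show "smooth_real (deriv f)" by (simp add: smooth_real_def)
qed

lemma smooth_real_continuous: "smooth_real f \<Longrightarrow> continuous_on S f"
  using smooth_real_def times_diff_real.simps(1) continuous_on_subset by blast

text \<open>
  Half of the divergence of the field above, as a function of \<open>s = |z|\<^sup>2\<close>; see
  \<open>smooth_bump_cauchy_profile\<close>.
\<close>

definition smooth_bump :: "real \<Rightarrow> real"
  where "smooth_bump = deriv smooth_step"

lemma smooth_step_smooth: "smooth_real smooth_step"
  unfolding smooth_step_def[abs_def]
  by (intro smooth_real_mult smooth_real_ident smooth_cauchy_profile)

lemma smooth_step_derivative: "(smooth_step has_real_derivative smooth_bump s) (at s)"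
  using smooth_real_deriv(1)[OF smooth_step_smooth] by (simp add: smooth_bump_def)

lemma smooth_bump_continuous: "continuous_on S smooth_bump"
  unfolding smooth_bump_def by (intro smooth_real_continuous smooth_real_deriv smooth_step_smooth)

lemma smooth_bump_cauchy_profile:
  "smooth_bump s = cauchy_profile s + s * deriv cauchy_profile s"
proof -
  have "(smooth_step has_real_derivative 1 * cauchy_profile s + deriv cauchy_profile s * s) (at s)"
    unfolding smooth_step_def[abs_def]
    by (intro DERIV_mult DERIV_ident smooth_real_deriv(1) smooth_cauchy_profile)
  from DERIV_unique[OF smooth_step_derivative this] show ?thesis by simp
qed

lemma smooth_bump_outside: assumes "s \<le> 1 \<or> s \<ge> 2" shows "smooth_bump s = 0"
proof -
  have *: "smooth_bump s = 0" if "s < 1 \<or> s > 2" for s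
  proof -
    have "((\<lambda>_. if s < 1 then 0 else 1::real) has_real_derivative 0) (at s)" by simp
    then have "(smooth_step has_real_derivative 0) (at s)"
    proof (rule DERIV_cong_ev[THEN iffD1, rotated -1, OF _ refl _ refl])
      show "\<forall>\<^sub>F x in nhds s. (if s < 1 then 0 else 1::real) = smooth_step x"
        using that
        by (cases "s < 1") (auto simp: eventually_nhds smooth_step_eq intro: exI[of _ "{..<1}"] exI[of _ "{2<..}"])
    qed
    then show ?thesis using smooth_step_derivative DERIV_unique by blast
  qed
  have "closed {s. smooth_bump s = 0}"
    using smooth_bump_continuous by (intro closed_Collect_eq) auto
  moreover have "{..<1} \<union> {2<..} \<subseteq> {s. smooth_bump s = 0}" using * by auto
  ultimately have "closure ({..<1::real} \<union> {2<..}) \<subseteq> {s. smooth_bump s = 0}"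
    by (rule closure_minimal[rotated])
  then show ?thesis using assms by (auto simp: closure_Un)
qed

text \<open>
  Writing \<open>smooth_step = a / (a + b)\<close> with \<open>a\<close> increasing and \<open>b\<close> decreasing makes the monotonicity
  visible.
\<close>

lemma mono_smooth_step: "mono smooth_step"
proof (rule monoI)
  have bmono: "bump_exp a \<le> bump_exp b" if "a \<le> b" for a b
  proof (cases "a > 0")
    case True
    then show ?thesis using that by (auto simp: bump_exp_def flat_exp_def frac_le)
  qed (auto simp: bump_exp_simps)
  fix s t :: real assume st: "s \<le> t"
  show "smooth_step s \<le> smooth_step t"
  proof (cases "s \<le> 1")
    case True then show ?thesis using smooth_step_bounds smooth_step_eq by auto
  next
    case False
    define a b a' b' where "a = s * bump_exp (s - 1)" and "b = bump_exp (2 - s)"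
      and "a' = t * bump_exp (t - 1)" and "b' = bump_exp (2 - t)"
    have "a \<le> a'" "b' \<le> b" "0 < a" "0 \<le> b'"
      using False st bmono bump_exp_simps by (auto simp: a_def a'_def b_def b'_def intro!: mult_mono)
    then have "a * b' \<le> a' * b" "a + b > 0" "a' + b' > 0" 
      by (auto intro!: mult_mono)
    moreover have "smooth_step s = a / (a + b)" "smooth_step t = a' / (a' + b')"
      by (simp_all add: smooth_step_def cauchy_profile_def a_def b_def a'_def b'_def divide_inverse)
    moreover have "a / (a + b) \<le> a' / (a' + b')"
      using calculation(1-3) by (simp add: divide_le_eq le_divide_eq field_simps)
    ultimately show ?thesis by simp
  qed
qed

lemma smooth_bump_nonneg: "smooth_bump s \<ge> 0"
  using mono_on_imp_deriv_nonneg[of UNIV smooth_step "smooth_bump s" s] mono_imp_mono_on[OF mono_smooth_step]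
    smooth_step_derivative by auto

lemma smooth_bump_pos_somewhere: "\<exists>s. smooth_bump s > 0"
proof (rule ccontr)
  assume "\<not> ?thesis"
  then have "smooth_bump s = 0" for s using smooth_bump_nonneg[of s] by (metis order_le_less)
  then have "smooth_step 1 = smooth_step 2"
    using smooth_step_derivative DERIV_isconst_all[of smooth_step 1 2] by metis
  then show False by (simp add: smooth_step_eq)
qed

section \<open>Test functions\<close>

lemma partial_has_derivative:
  assumes "(\<phi> has_derivative D) (at x)"
  shows "partial1 \<phi> x = D 1" "partial2 \<phi> x = D \<i>"
  using frechet_derivative_at[OF assms] by (simp_all add: partial1_def partial2_def)

text \<open>
  The Frechet derivative is real linear, hence determined by its values at \<open>1\<close> and \<open>\<i>\<close>.
\<close>

lemma has_derivative_partials: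
  assumes "\<phi> differentiable (at x)"
  shows "(\<phi> has_derivative (\<lambda>h. Re h * partial1 \<phi> x + Im h * partial2 \<phi> x)) (at x)"
proof -
  have d: "(\<phi> has_derivative frechet_derivative \<phi> (at x)) (at x)"
    using assms frechet_derivative_works by blast
  then interpret linear "frechet_derivative \<phi> (at x)"
    by (rule has_derivative_linear)
  have "frechet_derivative \<phi> (at x) h = Re h * partial1 \<phi> x + Im h * partial2 \<phi> x" for h
  proof -
    have "h = Re h *\<^sub>R 1 + Im h *\<^sub>R \<i>" by (simp add: complex_eq_iff)
    then have "frechet_derivative \<phi> (at x) h = frechet_derivative \<phi> (at x) (Re h *\<^sub>R 1 + Im h *\<^sub>R \<i>)"
      by simp
    then show ?thesis by (simp add: add scale partial1_def partial2_def)
  qed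
  then have "frechet_derivative \<phi> (at x) = (\<lambda>h. Re h * partial1 \<phi> x + Im h * partial2 \<phi> x)"
    by (rule ext)
  with d show ?thesis by simp
qed

lemma times_cont_diff_SucI:
  assumes "\<And>x. (\<phi> has_derivative D x) (at x)"
    and "times_cont_diff n (\<lambda>x. D x 1)" "times_cont_diff n (\<lambda>x. D x \<i>)"
  shows "times_cont_diff (Suc n) \<phi>"
proof -
  have "partial1 \<phi> = (\<lambda>x. D x 1)" "partial2 \<phi> = (\<lambda>x. D x \<i>)"
    using partial_has_derivative[OF assms(1)] by auto
  then show ?thesis
    using assms by (auto simp: differentiable_on_def differentiable_def)
qed

lemma times_cont_diff_has_derivative:
  "times_cont_diff (Suc n) \<phi> \<Longrightarrow>
    (\<phi> has_derivative (\<lambda>h. Re h * partial1 \<phi> x + Im h * partial2 \<phi> x)) (at x)"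
  by (rule has_derivative_partials) (auto simp: differentiable_on_def)

lemma times_cont_diff_SucD: "times_cont_diff (Suc n) \<phi> \<Longrightarrow> times_cont_diff n \<phi>"
proof (induction n arbitrary: \<phi>)
  case 0
  then show ?case
    using differentiable_imp_continuous_on by auto
next
  case (Suc n)
  have "times_cont_diff (Suc n) (partial1 \<phi>)" "times_cont_diff (Suc n) (partial2 \<phi>)"
    "\<phi> differentiable_on UNIV"
    using Suc.prems by (simp_all only: times_cont_diff.simps)
  with Suc.IH show ?case unfolding times_cont_diff.simps(2)[of n] by blast
qed

lemma times_cont_diff_add:
  "times_cont_diff n \<phi> \<Longrightarrow> times_cont_diff n \<psi> \<Longrightarrow> times_cont_diff n (\<lambda>x. \<phi> x + \<psi> x)"
proof (induction n arbitrary: \<phi> \<psi>)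
  case 0
  then show ?case by (auto intro: continuous_on_add)
next
  case (Suc n)
  show ?case
  proof (rule times_cont_diff_SucI)
    show "((\<lambda>x. \<phi> x + \<psi> x) has_derivative (\<lambda>h. (Re h * partial1 \<phi> x + Im h * partial2 \<phi> x)
        + (Re h * partial1 \<psi> x + Im h * partial2 \<psi> x))) (at x)" for x
      by (rule has_derivative_add[OF times_cont_diff_has_derivative times_cont_diff_has_derivative,
            OF Suc.prems])
    show "times_cont_diff n (\<lambda>x. (Re 1 * partial1 \<phi> x + Im 1 * partial2 \<phi> x)
        + (Re 1 * partial1 \<psi> x + Im 1 * partial2 \<psi> x))"
      and "times_cont_diff n (\<lambda>x. (Re \<i> * partial1 \<phi> x + Im \<i> * partial2 \<phi> x)
        + (Re \<i> * partial1 \<psi> x + Im \<i> * partial2 \<psi> x))"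
      using Suc.prems by (simp_all add: Suc.IH)
  qed
qed

lemma times_cont_diff_mult:
  "times_cont_diff n \<phi> \<Longrightarrow> times_cont_diff n \<psi> \<Longrightarrow> times_cont_diff n (\<lambda>x. \<phi> x * \<psi> x)"
proof (induction n arbitrary: \<phi> \<psi>)
  case 0
  then show ?case by (auto intro: continuous_on_mult)
next
  case (Suc n)
  have n: "times_cont_diff n \<phi>" "times_cont_diff n \<psi>"
    using Suc.prems times_cont_diff_SucD by blast+
  show ?case
  proof (rule times_cont_diff_SucI)
    show "((\<lambda>x. \<phi> x * \<psi> x) has_derivative (\<lambda>h. \<phi> x * (Re h * partial1 \<psi> x + Im h * partial2 \<psi> x)
        + (Re h * partial1 \<phi> x + Im h * partial2 \<phi> x) * \<psi> x)) (at x)" for x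
      by (rule has_derivative_mult[OF times_cont_diff_has_derivative times_cont_diff_has_derivative,
            OF Suc.prems])
    show "times_cont_diff n (\<lambda>x. \<phi> x * (Re 1 * partial1 \<psi> x + Im 1 * partial2 \<psi> x)
        + (Re 1 * partial1 \<phi> x + Im 1 * partial2 \<phi> x) * \<psi> x)"
      and "times_cont_diff n (\<lambda>x. \<phi> x * (Re \<i> * partial1 \<psi> x + Im \<i> * partial2 \<psi> x)
        + (Re \<i> * partial1 \<phi> x + Im \<i> * partial2 \<phi> x) * \<psi> x)"
      using Suc.prems n by (simp_all add: times_cont_diff_add Suc.IH)
  qed
qed

lemma times_cont_diff_const: "times_cont_diff n (\<lambda>x. c)"
proof (induction n arbitrary: c)
  case (Suc n)
  show ?case
    by (rule times_cont_diff_SucI[where D="\<lambda>_ _. 0"]) (use Suc in \<open>auto intro: has_derivative_const\<close>)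
qed simp

lemma times_cont_diff_Re: "times_cont_diff n Re"
proof (cases n)
  case (Suc m)
  show ?thesis unfolding Suc
    by (rule times_cont_diff_SucI[where D="\<lambda>_. Re"])
       (simp_all add: times_cont_diff_const bounded_linear_imp_has_derivative bounded_linear_Re)
qed (simp add: continuous_on_Re)

lemma times_cont_diff_Im: "times_cont_diff n Im"
proof (cases n)
  case (Suc m)
  show ?thesis unfolding Suc
    by (rule times_cont_diff_SucI[where D="\<lambda>_. Im"])
       (simp_all add: times_cont_diff_const bounded_linear_imp_has_derivative bounded_linear_Im)
qed (simp add: continuous_on_Im)

lemma times_cont_diff_comp:
  "times_diff_real n f \<Longrightarrow> times_cont_diff n \<phi> \<Longrightarrow> times_cont_diff n (\<lambda>x. f (\<phi> x))"
proof (induction n arbitrary: f)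
  case 0
  then show ?case by (auto intro: continuous_on_compose2)
next
  case (Suc n)
  then obtain f' where f': "\<forall>x. (f has_real_derivative f' x) (at x)" "times_diff_real n f'"
    by auto
  have n: "times_cont_diff n (\<lambda>x. f' (\<phi> x))"
    using Suc.IH Suc.prems f' times_cont_diff_SucD by blast
  show ?case
  proof (rule times_cont_diff_SucI)
    show "((\<lambda>x. f (\<phi> x)) has_derivative
        (\<lambda>h. f' (\<phi> x) * (Re h * partial1 \<phi> x + Im h * partial2 \<phi> x))) (at x)" for x
      using has_derivative_compose[OF times_cont_diff_has_derivative[OF Suc.prems(2)]]
        f'(1) by (auto simp: has_field_derivative_def)
  qed (use Suc n in \<open>simp_all add: times_cont_diff_mult\<close>)
qed

text \<open>
  A derivative vanishes off the closed support, so supports do not grow.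
\<close>

lemma test_function_partial:
  assumes "test_function \<phi>"
  shows "test_function (partial1 \<phi>)" "test_function (partial2 \<phi>)"
proof -
  have zero: "partial1 \<phi> x = 0 \<and> partial2 \<phi> x = 0" if "x \<notin> closure {x. \<phi> x \<noteq> 0}" for x
  proof -
    have "((\<lambda>x. 0) has_derivative (\<lambda>h. 0)) (at x)" by simp
    then have "(\<phi> has_derivative (\<lambda>h. 0)) (at x)"
      by (rule has_derivative_transform_within_open[where s="- closure {x. \<phi> x \<noteq> 0}"])
        (use that closure_subset[of "{x. \<phi> x \<noteq> 0}"] in auto)
    then show ?thesis using partial_has_derivative by blast
  qed
  have sub: "compact (closure {x. g x \<noteq> 0})" if "\<And>x. x \<notin> closure {x. \<phi> x \<noteq> 0} \<Longrightarrow> g x = (0::real)" for g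
  proof -
    have "{x. g x \<noteq> 0} \<subseteq> closure {x. \<phi> x \<noteq> 0}" using that by auto
    then have "closure {x. g x \<noteq> 0} \<subseteq> closure {x. \<phi> x \<noteq> 0}" by (rule closure_minimal) simp
    then show ?thesis
      using assms compact_closure bounded_subset compact_imp_bounded closure_subset
      unfolding test_function_def by metis
  qed
  have "times_cont_diff (Suc n) \<phi>" for n using assms by (auto simp: test_function_def)
  then show "test_function (partial1 \<phi>)" "test_function (partial2 \<phi>)"
    using zero sub by (simp_all add: test_function_def)
qed

lemma test_functionD:
  assumes "test_function \<phi>"
  shows "(\<phi> has_derivative (\<lambda>h. Re h * partial1 \<phi> x + Im h * partial2 \<phi> x)) (at x)"
    and "continuous_on S \<phi>" "continuous_on S (partial1 \<phi>)" "continuous_on S (partial2 \<phi>)"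
    and "\<exists>r>0. \<forall>x. r \<le> norm x \<longrightarrow> \<phi> x = 0 \<and> partial1 \<phi> x = 0 \<and> partial2 \<phi> x = 0"
proof -
  have all: "times_cont_diff n \<phi>" for n using assms by (simp add: test_function_def)
  show "(\<phi> has_derivative (\<lambda>h. Re h * partial1 \<phi> x + Im h * partial2 \<phi> x)) (at x)"
    by (rule times_cont_diff_has_derivative[OF all])
  have "times_cont_diff 0 \<phi>" "times_cont_diff 0 (partial1 \<phi>)" "times_cont_diff 0 (partial2 \<phi>)"
    using all test_function_partial[OF assms] by (auto simp: test_function_def simp del: times_cont_diff.simps)
  then show "continuous_on S \<phi>" "continuous_on S (partial1 \<phi>)" "continuous_on S (partial2 \<phi>)"
    using continuous_on_subset by auto
  have "\<exists>r. \<forall>x. r < norm x \<longrightarrow> g x = 0" if "test_function g" for g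
  proof -
    have "bounded (closure {x. g x \<noteq> 0})"
      using that compact_imp_bounded by (auto simp: test_function_def)
    then obtain r where "\<forall>x\<in>closure {x. g x \<noteq> 0}. norm x \<le> r" using bounded_iff by blast
    then show ?thesis using closure_subset[of "{x. g x \<noteq> 0}"] by (intro exI[of _ r]) force
  qed
  then obtain r1 r2 r3 where "\<forall>x. r1 < norm x \<longrightarrow> \<phi> x = 0"
    "\<forall>x. r2 < norm x \<longrightarrow> partial1 \<phi> x = 0" "\<forall>x. r3 < norm x \<longrightarrow> partial2 \<phi> x = 0"
    using assms test_function_partial by meson
  then show "\<exists>r>0. \<forall>x. r \<le> norm x \<longrightarrow> \<phi> x = 0 \<and> partial1 \<phi> x = 0 \<and> partial2 \<phi> x = 0"
    by (intro exI[of _ "max 1 (max r1 (max r2 r3) + 1)"]) force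
qed

lemma cmod_diff_power2: "(cmod (z - w))\<^sup>2 = (Re z - Re w)\<^sup>2 + (Im z - Im w)\<^sup>2"
  by (simp add: cmod_power2)

lemma has_derivative_cmod_power2:
  "((\<lambda>z. (cmod (z - w))\<^sup>2) has_derivative
     (\<lambda>h. 2 * Re (z - w) * Re h + 2 * Im (z - w) * Im h)) (at z)"
  unfolding cmod_diff_power2 by (auto intro!: derivative_eq_intros ext simp: algebra_simps)

lemma has_derivative_radial:
  assumes "(f has_real_derivative f') (at ((cmod (z - w))\<^sup>2))"
  shows "((\<lambda>z. f ((cmod (z - w))\<^sup>2)) has_derivative
     (\<lambda>h. (2 * Re (z - w) * Re h + 2 * Im (z - w) * Im h) * f')) (at z)"
  using has_derivative_compose[OF has_derivative_cmod_power2, of f "(*) f'" z w] assms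
  by (simp add: has_field_derivative_def mult.commute)

lemma times_cont_diff_radial:
  assumes "smooth_real f"
  shows "times_cont_diff n (\<lambda>z. f ((cmod (z - w))\<^sup>2))"
proof -
  have "times_cont_diff n (\<lambda>z. (Re z + (- Re w)) * (Re z + (- Re w)) + (Im z + (- Im w)) * (Im z + (- Im w)))"
    by (intro times_cont_diff_add times_cont_diff_mult times_cont_diff_const times_cont_diff_Re times_cont_diff_Im)
  then have "times_cont_diff n (\<lambda>z. (cmod (z - w))\<^sup>2)"
    by (simp add: cmod_diff_power2 flip: power2_eq_square)
  from times_cont_diff_comp[OF _ this, of f] assms show ?thesis
    by (simp add: smooth_real_def)
qed

lemma test_function_radial:
  assumes f: "smooth_real f" "\<And>s. s \<ge> M \<Longrightarrow> f s = 0"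
  shows "test_function (\<lambda>z. Re (z - w) * f ((cmod (z - w))\<^sup>2))"
    and "test_function (\<lambda>z. Im (z - w) * f ((cmod (z - w))\<^sup>2))"
proof -
  have "times_cont_diff n (\<lambda>z. (Re z + (- Re w)) * f ((cmod (z - w))\<^sup>2))"
    and "times_cont_diff n (\<lambda>z. (Im z + (- Im w)) * f ((cmod (z - w))\<^sup>2))" for n
    by (intro times_cont_diff_add times_cont_diff_mult times_cont_diff_const times_cont_diff_Re
        times_cont_diff_Im times_cont_diff_radial f)+
  moreover have "compact (closure {z. l (z - w) * f ((cmod (z - w))\<^sup>2) \<noteq> 0})" for l
  proof -
    have "norm (z - w) \<le> 1 + \<bar>M\<bar>" if "f ((cmod (z - w))\<^sup>2) \<noteq> 0" for z
    proof (rule ccontr)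
      assume "\<not> ?thesis"
      then have "1 + \<bar>M\<bar> \<le> norm (z - w)" "1 \<le> norm (z - w)" by auto
      then have "M \<le> (cmod (z - w))\<^sup>2"
        using mult_mono[of 1 "norm (z - w)" "\<bar>M\<bar>" "norm (z - w)"] by (simp add: power2_eq_square)
      then show False using that f(2) by blast
    qed
    then have "{z. l (z - w) * f ((cmod (z - w))\<^sup>2) \<noteq> 0} \<subseteq> cball w (1 + \<bar>M\<bar>)"
      by (auto simp: dist_norm norm_minus_commute)
    then show ?thesis
      using bounded_subset bounded_cball compact_closure by blast
  qed
  from this[of Re] this[of Im] calculation show "test_function (\<lambda>z. Re (z - w) * f ((cmod (z - w))\<^sup>2))"
    and "test_function (\<lambda>z. Im (z - w) * f ((cmod (z - w))\<^sup>2))"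
    by (auto simp: test_function_def)
qed


text \<open>
  For \<open>T\<^sub>1 = Re y f(|y|\<^sup>2)\<close> and \<open>T\<^sub>2 = Im y f(|y|\<^sup>2)\<close> the matrix of the partial derivatives is symmetric and even
  in \<open>y\<close>, being the Hessian of a radial function.
\<close>

lemma partials_radial:
  fixes f :: "real \<Rightarrow> real"
  defines "s \<equiv> \<lambda>y. (cmod y)\<^sup>2"
  assumes f: "smooth_real f"
  shows "partial1 (\<lambda>z. Re (z - w) * f (s (z - w))) z = f (s (z - w)) + 2 * (Re (z - w))\<^sup>2 * deriv f (s (z - w))"
    and "partial2 (\<lambda>z. Re (z - w) * f (s (z - w))) z = 2 * Re (z - w) * Im (z - w) * deriv f (s (z - w))"
    and "partial1 (\<lambda>z. Im (z - w) * f (s (z - w))) z = 2 * Re (z - w) * Im (z - w) * deriv f (s (z - w))"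
    and "partial2 (\<lambda>z. Im (z - w) * f (s (z - w))) z = f (s (z - w)) + 2 * (Im (z - w))\<^sup>2 * deriv f (s (z - w))"
proof -
  note d = has_derivative_radial[OF smooth_real_deriv(1)[OF f]]
  have 1: "((\<lambda>z. Re (z - w) * f ((cmod (z - w))\<^sup>2)) has_derivative
      (\<lambda>h. Re (z - w) * ((2 * Re (z - w) * Re h + 2 * Im (z - w) * Im h) * deriv f ((cmod (z - w))\<^sup>2))
        + Re h * f ((cmod (z - w))\<^sup>2))) (at z)"
    by (intro has_derivative_mult d) (auto intro!: derivative_eq_intros)
  have 2: "((\<lambda>z. Im (z - w) * f ((cmod (z - w))\<^sup>2)) has_derivative
      (\<lambda>h. Im (z - w) * ((2 * Re (z - w) * Re h + 2 * Im (z - w) * Im h) * deriv f ((cmod (z - w))\<^sup>2))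
        + Im h * f ((cmod (z - w))\<^sup>2))) (at z)"
    by (intro has_derivative_mult d) (auto intro!: derivative_eq_intros)
  show "partial1 (\<lambda>z. Re (z - w) * f (s (z - w))) z = f (s (z - w)) + 2 * (Re (z - w))\<^sup>2 * deriv f (s (z - w))"
    and "partial2 (\<lambda>z. Re (z - w) * f (s (z - w))) z = 2 * Re (z - w) * Im (z - w) * deriv f (s (z - w))"
    using partial_has_derivative[OF 1] by (simp_all add: s_def power2_eq_square algebra_simps)
  show "partial1 (\<lambda>z. Im (z - w) * f (s (z - w))) z = 2 * Re (z - w) * Im (z - w) * deriv f (s (z - w))"
    and "partial2 (\<lambda>z. Im (z - w) * f (s (z - w))) z = f (s (z - w)) + 2 * (Im (z - w))\<^sup>2 * deriv f (s (z - w))"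
    using partial_has_derivative[OF 2] by (simp_all add: s_def power2_eq_square algebra_simps)
qed

section \<open>Translations of square integrable functions\<close>

lemma lborel_integral_translate:
  fixes f :: "'a::euclidean_space \<Rightarrow> 'b::{banach, second_countable_topology}"
  assumes [measurable]: "f \<in> borel_measurable borel"
  shows "(\<integral>z. f (z + y) \<partial>lborel) = (\<integral>z. f z \<partial>lborel)"
    and "integrable lborel (\<lambda>z. f (z + y)) \<longleftrightarrow> integrable lborel f"
proof -
  have "integral\<^sup>L (distr lborel borel ((+) y)) f = (\<integral>z. f (y + z) \<partial>lborel)"
    by (rule integral_distr) auto
  moreover have "integrable (distr lborel borel ((+) y)) f \<longleftrightarrow> integrable lborel (\<lambda>z. f (y + z))"
    by (rule integrable_distr_eq) auto
  ultimately show "(\<integral>z. f (z + y) \<partial>lborel) = (\<integral>z. f z \<partial>lborel)"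
    and "integrable lborel (\<lambda>z. f (z + y)) \<longleftrightarrow> integrable lborel f"
    by (simp_all add: lborel_distr_plus add.commute)
qed

lemma lborel_distr_uminus_euclidean:
  "distr lborel borel uminus = (lborel :: 'a::euclidean_space measure)"
  by (subst (2) lborel_affine[of "- 1" 0]) (simp_all add: density_1)

lemma lborel_integral_reflect:
  fixes f :: "'a::euclidean_space \<Rightarrow> 'b::{banach, second_countable_topology}"
  assumes [measurable]: "f \<in> borel_measurable borel"
  shows "(\<integral>z. f (y - z) \<partial>lborel) = (\<integral>z. f z \<partial>lborel)"
    and "integrable lborel (\<lambda>z. f (y - z)) \<longleftrightarrow> integrable lborel f"
proof -
  have [measurable]: "(\<lambda>z. f (z + y)) \<in> borel_measurable borel" by measurable
  have "integral\<^sup>L (distr lborel borel uminus) (\<lambda>z. f (z + y)) = (\<integral>z. f (- z + y) \<partial>lborel)"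
    by (rule integral_distr) auto
  moreover have "integrable (distr lborel borel uminus) (\<lambda>z. f (z + y)) \<longleftrightarrow> integrable lborel (\<lambda>z. f (- z + y))"
    by (rule integrable_distr_eq) auto
  ultimately show "(\<integral>z. f (y - z) \<partial>lborel) = (\<integral>z. f z \<partial>lborel)"
    and "integrable lborel (\<lambda>z. f (y - z)) \<longleftrightarrow> integrable lborel f"
    by (simp_all add: lborel_distr_uminus_euclidean lborel_integral_translate)
qed

definition mean_continuous :: "('a::euclidean_space \<Rightarrow> 'b::{banach, second_countable_topology}) \<Rightarrow> bool"
  where "mean_continuous f \<longleftrightarrow>
    (\<forall>e>0. \<exists>d>0. \<forall>y. norm y < d \<longrightarrow> (\<integral>z. norm (f (z - y) - f z) \<partial>lborel) \<le> e)"

lemma mean_diff_le: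
  fixes f g :: "'a::euclidean_space \<Rightarrow> 'b::{banach, second_countable_topology}"
  assumes f: "integrable lborel f" and g: "integrable lborel g"
  shows "(\<integral>z. norm (f (z - y) - f z) \<partial>lborel) \<le>
    (\<integral>z. norm (g (z - y) - g z) \<partial>lborel) + 2 * (\<integral>z. norm (f z - g z) \<partial>lborel)"
proof -
  have m[measurable]: "f \<in> borel_measurable borel" "g \<in> borel_measurable borel"
    using f g by auto
  have fy: "integrable lborel (\<lambda>z. f (z - y))" and gy: "integrable lborel (\<lambda>z. g (z - y))"
    using f g lborel_integral_translate(2)[of f "- y"] lborel_integral_translate(2)[of g "- y"] by simp_all
  have d: "(\<integral>z. norm (f (z - y) - g (z - y)) \<partial>lborel) = (\<integral>z. norm (f z - g z) \<partial>lborel)"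
    using lborel_integral_translate(1)[of "\<lambda>z. norm (f z - g z)" "- y"] by simp
  have "(\<integral>z. norm (f (z - y) - f z) \<partial>lborel) \<le>
    (\<integral>z. norm (g (z - y) - g z) + (norm (f (z - y) - g (z - y)) + norm (f z - g z)) \<partial>lborel)"
  proof (rule integral_mono)
    show "norm (f (z - y) - f z) \<le> norm (g (z - y) - g z) + (norm (f (z - y) - g (z - y)) + norm (f z - g z))" for z
    proof -
      have "f (z - y) - f z = (g (z - y) - g z) + ((f (z - y) - g (z - y)) - (f z - g z))" by simp
      then show ?thesis by (metis norm_triangle_mono norm_triangle_ineq4 order_refl)
    qed
  qed (use f g fy gy in \<open>auto intro!: Bochner_Integration.integrable_add\<close>)
  also have "\<dots> = (\<integral>z. norm (g (z - y) - g z) \<partial>lborel) + 2 * (\<integral>z. norm (f z - g z) \<partial>lborel)"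
    using f g fy gy d by (subst Bochner_Integration.integral_add, auto intro!: Bochner_Integration.integrable_add)+
  finally show ?thesis .
qed

lemma mean_continuous_approx:
  fixes f :: "'a::euclidean_space \<Rightarrow> 'b::{banach, second_countable_topology}"
  assumes f: "integrable lborel f"
    and g: "\<And>e. e > 0 \<Longrightarrow> \<exists>g. integrable lborel g \<and> mean_continuous g \<and> (\<integral>z. norm (f z - g z) \<partial>lborel) \<le> e"
  shows "mean_continuous f"
  unfolding mean_continuous_def
proof (intro allI impI)
  fix e :: real assume e: "e > 0"
  then obtain g where g: "integrable lborel g" "mean_continuous g" "(\<integral>z. norm (f z - g z) \<partial>lborel) \<le> e / 4"
    using g[of "e / 4"] by auto
  from g(2) e obtain d where d: "d > 0" "\<And>y. norm y < d \<Longrightarrow> (\<integral>z. norm (g (z - y) - g z) \<partial>lborel) \<le> e / 2"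
    unfolding mean_continuous_def by (metis half_gt_zero)
  have "(\<integral>z. norm (f (z - y) - f z) \<partial>lborel) \<le> e" if "norm y < d" for y
    using mean_diff_le[OF f g(1), of y] g(3) d(2)[OF that] by linarith
  then show "\<exists>d>0. \<forall>y. norm y < d \<longrightarrow> (\<integral>z. norm (f (z - y) - f z) \<partial>lborel) \<le> e"
    using d(1) by blast
qed

text \<open>
  If \<open>y\<close> is shorter than the distance from \<open>K\<close> to the complement of an open neighbourhood \<open>U\<close>, then
  \<open>K + y\<close> and \<open>K\<close> both lie in \<open>U\<close> and \<open>U + y\<close>, and differ by at most \<open>U - K\<close> and its translate.
\<close>

lemma mean_continuous_compact:
  fixes K :: "'a::euclidean_space set" and c :: "'b::{banach, second_countable_topology}"
  assumes K: "compact K"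
  shows "mean_continuous (\<lambda>z. indicator K z *\<^sub>R c)"
  unfolding mean_continuous_def
proof (intro allI impI)
  fix e :: real assume e: "e > 0"
  define e' where "e' = e / (2 * (norm c + 1))"
  have e': "e' > 0" using e by (simp add: e'_def add_nonneg_pos)
  have KL: "K \<in> sets lebesgue" using K by (simp add: borel_compact)
  obtain U where U: "open U" "K \<subseteq> U" "U - K \<in> lmeasurable" "emeasure lebesgue (U - K) < ennreal e'"
    using sets_lebesgue_outer_open[OF KL e'] by blast
  obtain d where d: "d > 0" "\<And>x y. x \<in> K \<Longrightarrow> y \<in> - U \<Longrightarrow> d \<le> dist x y"
    using separate_compact_closed[of K "- U"] K U(1,2) by (metis ComplD closed_Compl disjoint_iff subsetD)
  have [measurable]: "K \<in> sets borel" "U \<in> sets borel" using K U by (auto simp: borel_compact)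
  have fin: "emeasure lborel (U - K) < \<infinity>" and mU: "measure lborel (U - K) \<le> e'"
  proof -
    have "emeasure lborel (U - K) < ennreal e'" using U(4) by (simp add: emeasure_completion[symmetric])
    then show "emeasure lborel (U - K) < \<infinity>" "measure lborel (U - K) \<le> e'"
      using e' by (auto simp: measure_def intro: less_trans[OF _ ennreal_less_top] enn2real_leI less_imp_le)
  qed
  have iU: "integrable lborel (indicator (U - K) :: _ \<Rightarrow> real)"
    using fin by simp
  have small: "(\<integral>z. norm (indicator K (z - y) *\<^sub>R c - indicator K z *\<^sub>R c) \<partial>lborel) \<le> e" if y: "norm y < d" for y
  proof -
    have iUy: "integrable lborel (\<lambda>z. indicator (U - K) (z - y) :: real)"
      using iU lborel_integral_translate(2)[of "indicator (U - K) :: _ \<Rightarrow> real" "- y"] by simp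
    have eUy: "(\<integral>z. indicator (U - K) (z - y) \<partial>lborel) = measure lborel (U - K)"
      using lborel_integral_translate(1)[of "indicator (U - K) :: _ \<Rightarrow> real" "- y"] by simp
    have "(\<integral>z. norm (indicator K (z - y) *\<^sub>R c - indicator K z *\<^sub>R c) \<partial>lborel) \<le>
      (\<integral>z. norm c * (indicator (U - K) z + indicator (U - K) (z - y)) \<partial>lborel)"
    proof (rule integral_mono')
      show "norm (indicator K (z - y) *\<^sub>R c - indicator K z *\<^sub>R c)
          \<le> norm c * (indicator (U - K) z + indicator (U - K) (z - y))" for z
      proof -
        have 1: "z - y \<in> K \<Longrightarrow> z \<in> U"
          using d(2)[of "z - y" z] y by (auto simp: dist_norm)
        have 2: "z \<in> K \<Longrightarrow> z - y \<in> U"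
          using d(2)[of z "z - y"] y by (auto simp: dist_norm)
        show ?thesis using 1 2 U(2) by (auto simp: indicator_def)
      qed
    qed (use iU iUy in \<open>auto\<close>)
    also have "\<dots> = norm c * (2 * measure lborel (U - K))"
      using iU iUy eUy by simp
    also have "\<dots> \<le> (norm c + 1) * (2 * e')"
      using mU by (intro mult_mono) auto
    also have "\<dots> = e"
    proof -
      have "norm c + 1 \<noteq> 0" using norm_ge_zero[of c] by linarith
      then show ?thesis unfolding e'_def by (simp add: divide_simps)
    qed
    finally show ?thesis .
  qed
  then show "\<exists>d>0. \<forall>y. norm y < d \<longrightarrow>
      (\<integral>z. norm (indicator K (z - y) *\<^sub>R c - indicator K z *\<^sub>R c) \<partial>lborel) \<le> e"
    using d(1) by blast
qed

text \<open>
  Lebesgue measurable sets are approximated from inside by closed sets; finite measure allows to cut these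
  off at a large radius.
\<close>

lemma lborel_inner_compact:
  fixes A :: "'a::euclidean_space set"
  assumes A: "A \<in> sets borel" "emeasure lborel A < \<infinity>" and e: "e > 0"
  obtains K where "compact K" "K \<subseteq> A" "measure lborel (A - K) \<le> e"
proof -
  have AL: "A \<in> sets lebesgue" using A by simp
  have m[measurable]: "A \<in> sets borel" by fact
  obtain T where T: "closed T" "T \<subseteq> A" "A - T \<in> lmeasurable" "emeasure lebesgue (A - T) < ennreal (e / 2)"
    using sets_lebesgue_inner_closed[OF AL, of "e / 2"] e by auto
  have [measurable]: "T \<in> sets borel" using T by simp
  have iA: "integrable lborel (indicator A :: _ \<Rightarrow> real)" using A by simp
  have "(\<lambda>n. \<integral>z. indicator (T - cball 0 (real n)) z \<partial>lborel) \<longlonglongrightarrow> (\<integral>z. (0::real) \<partial>(lborel :: 'a measure))"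
  proof (rule integral_dominated_convergence[where w="indicator A"])
    show "AE x in lborel. (\<lambda>n. indicator (T - cball 0 (real n)) x :: real) \<longlonglongrightarrow> 0"
    proof (rule AE_I2)
      fix x :: 'a
      obtain N where N: "norm x \<le> real N" using real_arch_simple by blast
      have "\<forall>\<^sub>F n in sequentially. indicator (T - cball 0 (real n)) x = (0::real)"
        using eventually_ge_at_top[of N]
        by eventually_elim (use N in \<open>auto simp: indicator_def\<close>)
      then show "(\<lambda>n. indicator (T - cball 0 (real n)) x :: real) \<longlonglongrightarrow> 0"
        by (rule tendsto_eventually)
    qed
  qed (use T iA in \<open>auto simp: indicator_def\<close>)
  then have "(\<lambda>n. measure lborel (T - cball 0 (real n))) \<longlonglongrightarrow> 0" by simp
  then have "\<forall>\<^sub>F n in sequentially. measure lborel (T - cball 0 (real n)) < e / 2"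
    using e by (intro order_tendstoD) auto
  then obtain n where n: "measure lborel (T - cball 0 (real n)) < e / 2"
    by (auto simp: eventually_sequentially)
  define K where "K = T \<inter> cball 0 (real n)"
  have "compact K" using T by (auto simp: K_def closed_Int_compact)
  moreover have "K \<subseteq> A" using T by (auto simp: K_def)
  moreover have "measure lborel (A - K) \<le> e"
  proof -
    have "emeasure lborel (A - T) < ennreal (e / 2)" using T(4) by (simp add: emeasure_completion[symmetric])
    then have "measure lborel (A - T) \<le> e / 2"
      using e unfolding measure_def by (intro enn2real_leI) (auto intro: less_imp_le)
    moreover have "measure lborel (A - K) \<le> measure lborel (A - T) + measure lborel (T - cball 0 (real n))"
    proof -
      have fmA: "A - T \<in> fmeasurable lborel" "T - cball 0 (real n) \<in> fmeasurable lborel"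
        using A(2) T(2) by (auto intro!: fmeasurableI le_less_trans[OF emeasure_mono A(2)])
      have "A - K = (A - T) \<union> (T - cball 0 (real n))" using T(2) by (auto simp: K_def)
      then show ?thesis using measure_Un_le[of "A - T" lborel "T - cball 0 (real n)"] by simp
    qed
    ultimately show ?thesis using n by simp
  qed
  ultimately show ?thesis using that by blast
qed

text \<open>
  Translation is continuous in \<open>L\<^sup>1\<close>: true for compact sets, hence for sets of finite measure, simple functions
  and their limits.
\<close>

lemma integrable_mean_continuous:
  fixes f :: "'a::euclidean_space \<Rightarrow> 'b::{banach, second_countable_topology}"
  assumes "integrable lborel f"
  shows "mean_continuous f"
  using assms
proof (induction rule: integrable_induct)
  case (base A c)
  then have [measurable]: "A \<in> sets borel" by simp
  have iA: "integrable lborel (\<lambda>x. indicator A x *\<^sub>R c)"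
    using base by (intro integrable_scaleR_left) auto
  show ?case
  proof (rule mean_continuous_approx[OF iA])
    fix e :: real assume e: "e > 0"
    have "e / (norm c + 1) > 0" using e by (simp add: add_nonneg_pos)
    then obtain K where K: "compact K" "K \<subseteq> A" "measure lborel (A - K) \<le> e / (norm c + 1)"
      using lborel_inner_compact[of A] base by auto
    have [measurable]: "K \<in> sets borel" using K by (simp add: borel_compact)
    have iK: "integrable lborel (\<lambda>x. indicator K x *\<^sub>R c)"
      using emeasure_compact_finite[OF K(1)] by (intro integrable_scaleR_left) auto
    have "(\<integral>z. norm (indicator A z *\<^sub>R c - indicator K z *\<^sub>R c) \<partial>lborel)
        = (\<integral>z. norm c * indicator (A - K) z \<partial>lborel)"
      using K(2) by (intro Bochner_Integration.integral_cong) (auto simp: indicator_def)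
    also have "\<dots> = norm c * measure lborel (A - K)" by simp
    also have "\<dots> \<le> (norm c + 1) * (e / (norm c + 1))"
      using K(3) by (intro mult_mono) auto
    also have "\<dots> = e"
      using norm_ge_zero[of c] by (simp add: add_nonneg_eq_0_iff)
    finally show "\<exists>g. integrable lborel g \<and> mean_continuous g \<and>
        (\<integral>z. norm (indicator A z *\<^sub>R c - g z) \<partial>lborel) \<le> e"
      using iK mean_continuous_compact[OF K(1)] by blast
  qed
next
  case (add f g)
  have [measurable]: "f \<in> borel_measurable borel" "g \<in> borel_measurable borel" using add by auto
  show ?case unfolding mean_continuous_def
  proof (intro allI impI)
    fix e :: real assume e: "e > 0"
    then have e2: "e / 2 > 0" by simp
    obtain d1 where d1: "d1 > 0" "\<And>y. norm y < d1 \<Longrightarrow> (\<integral>z. norm (f (z - y) - f z) \<partial>lborel) \<le> e / 2"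
      using add.IH(1) e2 unfolding mean_continuous_def by blast
    obtain d2 where d2: "d2 > 0" "\<And>y. norm y < d2 \<Longrightarrow> (\<integral>z. norm (g (z - y) - g z) \<partial>lborel) \<le> e / 2"
      using add.IH(2) e2 unfolding mean_continuous_def by blast
    note d = d1(1) d2(1) d1(2) d2(2)
    have "(\<integral>z. norm (f (z - y) + g (z - y) - (f z + g z)) \<partial>lborel) \<le> e" if y: "norm y < min d1 d2" for y
    proof -
      have i: "integrable lborel (\<lambda>z. norm (f (z - y) - f z))" "integrable lborel (\<lambda>z. norm (g (z - y) - g z))"
        using add.hyps lborel_integral_translate(2)[of f "- y"] lborel_integral_translate(2)[of g "- y"]
        by (auto intro!: integrable_norm)
      have "(\<integral>z. norm (f (z - y) + g (z - y) - (f z + g z)) \<partial>lborel) \<le>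
          (\<integral>z. norm (f (z - y) - f z) + norm (g (z - y) - g z) \<partial>lborel)"
        using i by (intro integral_mono') (auto simp: add_diff_add norm_triangle_ineq)
      also have "\<dots> \<le> e" using d(3,4)[of y] y i by simp
      finally show ?thesis .
    qed
    then show "\<exists>d>0. \<forall>y. norm y < d \<longrightarrow> (\<integral>z. norm (f (z - y) + g (z - y) - (f z + g z)) \<partial>lborel) \<le> e"
      using d(1,2) by (intro exI[of _ "min d1 d2"]) auto
  qed
next
  case (lim f s)
  show ?case
  proof (rule mean_continuous_approx[OF lim.hyps(4)])
    fix e :: real assume e: "e > 0"
    have [measurable]: "f \<in> borel_measurable borel" "\<And>i. s i \<in> borel_measurable borel" using lim.hyps by auto
    have "(\<lambda>i. \<integral>z. norm (f z - s i z) \<partial>lborel) \<longlonglongrightarrow> (\<integral>z. (0::real) \<partial>(lborel :: 'a measure))"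
    proof (rule integral_dominated_convergence[where w="\<lambda>z. 3 * norm (f z)"])
      show "AE z in lborel. (\<lambda>i. norm (f z - s i z)) \<longlonglongrightarrow> 0"
        using lim.hyps(2) by (intro AE_I2) (auto intro!: tendsto_eq_intros)
      show "AE z in lborel. norm (norm (f z - s i z)) \<le> 3 * norm (f z)" for i
      proof (rule AE_I2)
        fix z
        show "norm (norm (f z - s i z)) \<le> 3 * norm (f z)"
          using lim.hyps(3)[of z i] norm_triangle_ineq4[of "f z" "s i z"] by simp
      qed
    qed (use lim.hyps in auto)
    then have "\<forall>\<^sub>F i in sequentially. (\<integral>z. norm (f z - s i z) \<partial>lborel) < e"
      using e by (intro order_tendstoD) auto
    then obtain i where "(\<integral>z. norm (f z - s i z) \<partial>lborel) < e"
      by (auto simp: eventually_sequentially)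
    then show "\<exists>g. integrable lborel g \<and> mean_continuous g \<and> (\<integral>z. norm (f z - g z) \<partial>lborel) \<le> e"
      using lim.hyps(1) lim.IH less_imp_le by blast
  qed
qed

definition square_integrable :: "(complex \<Rightarrow> complex) \<Rightarrow> bool"
  where "square_integrable f \<longleftrightarrow> f \<in> borel_measurable borel \<and> integrable lborel (\<lambda>z. (cmod (f z))\<^sup>2)"

definition correlation :: "(complex \<Rightarrow> complex) \<Rightarrow> (complex \<Rightarrow> complex) \<Rightarrow> complex \<Rightarrow> complex"
  where "correlation f g y = (\<integral>z. f z * g (z - y) \<partial>lborel)"

lemma square_integrable_measurable [measurable_dest]: "square_integrable f \<Longrightarrow> f \<in> borel_measurable borel"
  by (simp add: square_integrable_def)

lemma weighted_arith_geo_mean: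
  fixes x y a :: real
  assumes "a > 0"
  shows "x * y \<le> (a * x\<^sup>2 + y\<^sup>2 / a) / 2"
proof -
  have "0 \<le> (a * x - y)\<^sup>2 / a" using assms by simp
  also have "\<dots> = a * x\<^sup>2 + y\<^sup>2 / a - 2 * (x * y)"
    using assms by (simp add: power2_eq_square field_simps)
  finally show ?thesis by simp
qed

lemma square_integrable_shift:
  assumes "square_integrable g"
  shows "integrable lborel (\<lambda>z. (cmod (g (z - y)))\<^sup>2)"
    and "(\<integral>z. (cmod (g (z - y)))\<^sup>2 \<partial>lborel) = (\<integral>z. (cmod (g z))\<^sup>2 \<partial>lborel)"
proof -
  have [measurable]: "g \<in> borel_measurable borel" using assms by measurable
  have i: "integrable lborel (\<lambda>z. (cmod (g z))\<^sup>2)"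
    using assms by (simp add: square_integrable_def)
  have m: "(\<lambda>z. (cmod (g z))\<^sup>2) \<in> borel_measurable borel" by measurable
  show "integrable lborel (\<lambda>z. (cmod (g (z - y)))\<^sup>2)"
    using lborel_integral_translate(2)[OF m, of "- y"] i by simp
  show "(\<integral>z. (cmod (g (z - y)))\<^sup>2 \<partial>lborel) = (\<integral>z. (cmod (g z))\<^sup>2 \<partial>lborel)"
    using lborel_integral_translate(1)[OF m, of "- y"] by simp
qed

lemma square_integrable_mult:
  assumes f: "square_integrable f" and g: "square_integrable g"
  shows "integrable lborel (\<lambda>z. f z * g (z - y))"
    and "a > 0 \<Longrightarrow> cmod (correlation f g y) \<le>
      (a * (\<integral>z. (cmod (f z))\<^sup>2 \<partial>lborel) + (\<integral>z. (cmod (g z))\<^sup>2 \<partial>lborel) / a) / 2"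
proof -
  have [measurable]: "f \<in> borel_measurable borel" "g \<in> borel_measurable borel" using f g by measurable
  have fi: "integrable lborel (\<lambda>z. (cmod (f z))\<^sup>2)" using f by (simp add: square_integrable_def)
  note gi = square_integrable_shift[OF g, of y]
  have le: "norm (f z * g (z - y)) \<le> (a * (cmod (f z))\<^sup>2 + (cmod (g (z - y)))\<^sup>2 / a) / 2" if "a > 0" for a z
    using weighted_arith_geo_mean[OF that] by (simp add: norm_mult)
  have ig: "integrable lborel (\<lambda>z. (a * (cmod (f z))\<^sup>2 + (cmod (g (z - y)))\<^sup>2 / a) / 2)" for a
    using fi gi by simp
  show i: "integrable lborel (\<lambda>z. f z * g (z - y))"
    by (rule Bochner_Integration.integrable_bound[OF ig[of 1]])
      (use le[of 1] in \<open>auto intro!: AE_I2 intro: order_trans[OF _ abs_ge_self]\<close>)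
  assume a: "a > 0"
  have "cmod (correlation f g y) \<le> (\<integral>z. norm (f z * g (z - y)) \<partial>lborel)"
    unfolding correlation_def by (rule integral_norm_bound)
  also have "\<dots> \<le> (\<integral>z. (a * (cmod (f z))\<^sup>2 + (cmod (g (z - y)))\<^sup>2 / a) / 2 \<partial>lborel)"
    using i ig le[OF a] by (intro integral_mono) auto
  also have "\<dots> = (a * (\<integral>z. (cmod (f z))\<^sup>2 \<partial>lborel) + (\<integral>z. (cmod (g z))\<^sup>2 \<partial>lborel) / a) / 2"
    using fi gi by simp
  finally show "cmod (correlation f g y) \<le>
      (a * (\<integral>z. (cmod (f z))\<^sup>2 \<partial>lborel) + (\<integral>z. (cmod (g z))\<^sup>2 \<partial>lborel) / a) / 2" .
qed

definition truncation :: "nat \<Rightarrow> (complex \<Rightarrow> complex) \<Rightarrow> complex \<Rightarrow> complex"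
  where "truncation n f z = (if cmod z \<le> real n \<and> cmod (f z) \<le> real n then f z else 0)"

lemma truncation_measurable [measurable]:
  assumes [measurable]: "f \<in> borel_measurable borel"
  shows "truncation n f \<in> borel_measurable borel"
  unfolding truncation_def[abs_def] by measurable

lemma square_integrable_truncation:
  assumes f: "square_integrable f"
  shows "square_integrable (truncation n f)" "square_integrable (\<lambda>z. f z - truncation n f z)"
    and "(\<integral>z. (cmod (truncation n f z))\<^sup>2 \<partial>lborel) \<le> (\<integral>z. (cmod (f z))\<^sup>2 \<partial>lborel)"
    and "(\<lambda>n. \<integral>z. (cmod (f z - truncation n f z))\<^sup>2 \<partial>lborel) \<longlonglongrightarrow> 0"
    and "integrable lborel (truncation n f)"
proof -
  have [measurable]: "f \<in> borel_measurable borel" using f by measurable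
  have fi: "integrable lborel (\<lambda>z. (cmod (f z))\<^sup>2)" using f by (simp add: square_integrable_def)
  have 1: "(cmod (truncation n f z))\<^sup>2 \<le> (cmod (f z))\<^sup>2" for z by (simp add: truncation_def)
  have 2: "(cmod (f z - truncation n f z))\<^sup>2 \<le> (cmod (f z))\<^sup>2" for z n by (simp add: truncation_def)
  have i1: "integrable lborel (\<lambda>z. (cmod (truncation n f z))\<^sup>2)"
    by (rule Bochner_Integration.integrable_bound[OF fi]) (auto simp: 1)
  then show "square_integrable (truncation n f)" by (simp add: square_integrable_def)
  have "integrable lborel (\<lambda>z. (cmod (f z - truncation n f z))\<^sup>2)"
    by (rule Bochner_Integration.integrable_bound[OF fi]) (auto simp: 2)
  then show "square_integrable (\<lambda>z. f z - truncation n f z)" by (simp add: square_integrable_def)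
  show "(\<integral>z. (cmod (truncation n f z))\<^sup>2 \<partial>lborel) \<le> (\<integral>z. (cmod (f z))\<^sup>2 \<partial>lborel)"
    using i1 fi 1 by (rule integral_mono)
  have "(\<lambda>n. \<integral>z. (cmod (f z - truncation n f z))\<^sup>2 \<partial>lborel) \<longlonglongrightarrow> (\<integral>z. (0::real) \<partial>(lborel :: complex measure))"
  proof (rule integral_dominated_convergence[where w="\<lambda>z. (cmod (f z))\<^sup>2"])
    show "AE z in lborel. (\<lambda>n. (cmod (f z - truncation n f z))\<^sup>2) \<longlonglongrightarrow> 0"
    proof (rule AE_I2)
      fix z
      obtain N where N: "max (cmod z) (cmod (f z)) \<le> real N" using real_arch_simple by blast
      have "\<forall>\<^sub>F n in sequentially. (cmod (f z - truncation n f z))\<^sup>2 = 0"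
        using eventually_ge_at_top[of N]
        by eventually_elim (use N in \<open>auto simp: truncation_def\<close>)
      then show "(\<lambda>n. (cmod (f z - truncation n f z))\<^sup>2) \<longlonglongrightarrow> 0" by (rule tendsto_eventually)
    qed
  qed (use fi 2 in auto)
  then show "(\<lambda>n. \<integral>z. (cmod (f z - truncation n f z))\<^sup>2 \<partial>lborel) \<longlonglongrightarrow> 0" by simp
  have "integrable lborel (\<lambda>z. real n * indicator (cball (0::complex) (real n)) z)"
    using emeasure_lborel_cball_finite[of "0::complex" "real n"] by simp
  then show "integrable lborel (truncation n f)"
    by (rule Bochner_Integration.integrable_bound) (auto simp: truncation_def indicator_def)
qed

text \<open>
  The bilinear form \<open>correlation\<close> is bounded in the square norms uniformly in the shift, so truncating
  both arguments changes it by a uniformly small amount.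
\<close>

lemma correlation_approx:
  assumes f: "square_integrable f" and g: "square_integrable g" and e: "e > 0"
  shows "\<exists>n. \<forall>y. cmod (correlation f g y - correlation (truncation n f) (truncation n g) y) \<le> e"
proof -
  define S where "S = (\<integral>z. (cmod (f z))\<^sup>2 \<partial>lborel) + (\<integral>z. (cmod (g z))\<^sup>2 \<partial>lborel) + 1"
  have S1: "S \<ge> 1" "(\<integral>z. (cmod (f z))\<^sup>2 \<partial>lborel) \<le> S" "(\<integral>z. (cmod (g z))\<^sup>2 \<partial>lborel) \<le> S"
    by (simp_all add: S_def integral_nonneg)
  \<comment> \<open>The weight in the arithmetic-geometric mean that makes both error terms equal to \<open>e / 2\<close>.\<close>
  define a where "a = 2 * S / e"
  have a: "a > 0" using S1 e by (simp add: a_def)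
  have "e / (2 * a) > 0" using a e by simp
  then have "\<forall>\<^sub>F n in sequentially. (\<integral>z. (cmod (f z - truncation n f z))\<^sup>2 \<partial>lborel) < e / (2 * a)"
    "\<forall>\<^sub>F n in sequentially. (\<integral>z. (cmod (g z - truncation n g z))\<^sup>2 \<partial>lborel) < e / (2 * a)"
    using square_integrable_truncation(4)[OF f] square_integrable_truncation(4)[OF g] by (auto intro: order_tendstoD)
  then have "\<forall>\<^sub>F n in sequentially. (\<integral>z. (cmod (f z - truncation n f z))\<^sup>2 \<partial>lborel) < e / (2 * a)
    \<and> (\<integral>z. (cmod (g z - truncation n g z))\<^sup>2 \<partial>lborel) < e / (2 * a)"
    by (rule eventually_conj)
  then obtain n where n: "(\<integral>z. (cmod (f z - truncation n f z))\<^sup>2 \<partial>lborel) \<le> e / (2 * a)"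
    "(\<integral>z. (cmod (g z - truncation n g z))\<^sup>2 \<partial>lborel) \<le> e / (2 * a)"
    by (auto simp: eventually_sequentially intro: less_imp_le)
  define f' g' where "f' = truncation n f" and "g' = truncation n g"
  note f' = square_integrable_truncation(1,2,3,5)[OF f, of n, folded f'_def]
  note g' = square_integrable_truncation(1,2,3,5)[OF g, of n, folded g'_def]
  have ea: "a * (e / (2 * a)) = e / 2" "S / a = e / 2"
    using a e S1(1) by (simp_all add: a_def)
  have "cmod (correlation f g y - correlation f' g' y) \<le> e" for y
  proof -
    have "correlation f g y - correlation f' g' y
        = correlation (\<lambda>z. f z - f' z) g y + correlation f' (\<lambda>z. g z - g' z) y"
      unfolding correlation_def
      using square_integrable_mult(1)[OF f g, of y] square_integrable_mult(1)[OF f'(1) g'(1), of y]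
        square_integrable_mult(1)[OF f'(2) g, of y] square_integrable_mult(1)[OF f'(1) g'(2), of y]
      by (subst Bochner_Integration.integral_diff[symmetric], simp, simp,
          subst Bochner_Integration.integral_add[symmetric], simp, simp) (simp add: algebra_simps)
    also have "cmod \<dots> \<le> cmod (correlation (\<lambda>z. f z - f' z) g y) + cmod (correlation f' (\<lambda>z. g z - g' z) y)"
      by (rule norm_triangle_ineq)
    also have "cmod (correlation (\<lambda>z. f z - f' z) g y) \<le>
       (a * (\<integral>z. (cmod (f z - f' z))\<^sup>2 \<partial>lborel) + (\<integral>z. (cmod (g z))\<^sup>2 \<partial>lborel) / a) / 2"
      by (rule square_integrable_mult(2)[OF f'(2) g a])
    also have "\<dots> \<le> (a * (e / (2 * a)) + S / a) / 2"
      using n S1 a unfolding f'_def by (intro divide_right_mono add_mono mult_left_mono) auto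
    also have "cmod (correlation f' (\<lambda>z. g z - g' z) y) \<le>
       (1 / a * (\<integral>z. (cmod (f' z))\<^sup>2 \<partial>lborel) + (\<integral>z. (cmod (g z - g' z))\<^sup>2 \<partial>lborel) / (1 / a)) / 2"
      by (rule square_integrable_mult(2)[OF f'(1) g'(2)]) (use a in simp)
    also have "\<dots> \<le> (1 / a * S + (e / (2 * a)) / (1 / a)) / 2"
      using n S1 a f'(3) unfolding g'_def by (intro divide_right_mono add_mono mult_left_mono) auto
    also have "\<dots> = (a * (e / (2 * a)) + S / a) / 2" by simp
    finally show ?thesis unfolding ea by simp
  qed
  then show ?thesis unfolding f'_def g'_def by blast
qed

text \<open>
  After truncation, continuity at \<open>0\<close> is continuity of translations in \<open>L\<^sup>1\<close>, and for large shifts the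
  supports are disjoint.
\<close>

lemma correlation_tendsto:
  assumes f: "square_integrable f" and g: "square_integrable g"
  shows "(correlation f g \<longlongrightarrow> correlation f g 0) (at 0)"
    and "(correlation f g \<longlongrightarrow> 0) at_infinity"
proof -
  show "(correlation f g \<longlongrightarrow> correlation f g 0) (at 0)"
  proof (rule tendstoI)
    fix e :: real assume e: "e > 0"
    then have "e / 4 > 0" by simp
    from correlation_approx[OF f g this] obtain n where
      n: "\<And>y. cmod (correlation f g y - correlation (truncation n f) (truncation n g) y) \<le> e / 4" by blast
    define f' g' where "f' = truncation n f" and "g' = truncation n g"
    note f' = square_integrable_truncation(1,2,3,5)[OF f, of n, folded f'_def]
    note g' = square_integrable_truncation(1,2,3,5)[OF g, of n, folded g'_def]
    have "e / 4 / (real n + 1) > 0" using e by simp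
    then obtain d where d: "d > 0"
      "\<And>y. norm y < d \<Longrightarrow> (\<integral>z. norm (g' (z - y) - g' z) \<partial>lborel) \<le> e / 4 / (real n + 1)"
      using integrable_mean_continuous[OF g'(4)] unfolding mean_continuous_def by blast
    have g'm[measurable]: "g' \<in> borel_measurable borel" using g'(1) by measurable
    have "dist (correlation f g y) (correlation f g 0) < e" if y: "norm y < d" for y
    proof -
      have ig: "integrable lborel (\<lambda>z. norm (g' (z - y) - g' z))"
        using g'(4) lborel_integral_translate(2)[OF g'm, of "- y"] by simp
      have i: "integrable lborel (\<lambda>z. f' z * g' (z - y))" "integrable lborel (\<lambda>z. f' z * g' z)"
        using square_integrable_mult(1)[OF f'(1) g'(1), of y] square_integrable_mult(1)[OF f'(1) g'(1), of 0] by simp_all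
      have "cmod (correlation f' g' y - correlation f' g' 0) = cmod (\<integral>z. f' z * g' (z - y) - f' z * g' z \<partial>lborel)"
        unfolding correlation_def using i by simp
      also have "\<dots> \<le> (\<integral>z. norm (f' z * g' (z - y) - f' z * g' z) \<partial>lborel)"
        by (rule integral_norm_bound)
      also have "\<dots> \<le> (\<integral>z. real n * norm (g' (z - y) - g' z) \<partial>lborel)"
      proof (rule integral_mono)
        show "norm (f' z * g' (z - y) - f' z * g' z) \<le> real n * norm (g' (z - y) - g' z)" for z
          unfolding right_diff_distrib[symmetric] norm_mult
          by (intro mult_right_mono) (auto simp: f'_def truncation_def)
      qed (use i ig in auto)
      also have "\<dots> = real n * (\<integral>z. norm (g' (z - y) - g' z) \<partial>lborel)" by simp
      also have "\<dots> \<le> (real n + 1) * (e / 4 / (real n + 1))"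
        using d(2)[OF y] by (intro mult_mono) auto
      also have "\<dots> = e / 4" by (rule nonzero_mult_div_cancel_left[of "real n + 1", unfolded times_divide_eq_right[symmetric]]) simp
      finally have m: "cmod (correlation f' g' y - correlation f' g' 0) \<le> e / 4" .
      have "cmod (correlation f g y - correlation f g 0) \<le>
        cmod (correlation f g y - correlation f' g' y) + cmod (correlation f' g' y - correlation f' g' 0)
        + cmod (correlation f g 0 - correlation f' g' 0)"
        using norm_triangle_ineq4[of "(correlation f g y - correlation f' g' y) + (correlation f' g' y - correlation f' g' 0)"
            "correlation f g 0 - correlation f' g' 0"]
          norm_triangle_ineq[of "correlation f g y - correlation f' g' y" "correlation f' g' y - correlation f' g' 0"]
        by simp
      then show ?thesis
        using m n[of y] n[of 0] e unfolding f'_def g'_def dist_norm by linarith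
    qed
    then show "\<forall>\<^sub>F y in at 0. dist (correlation f g y) (correlation f g 0) < e"
      using d(1) by (auto simp: eventually_at intro!: exI[of _ d])
  qed
  show "(correlation f g \<longlongrightarrow> 0) at_infinity"
  proof (rule tendstoI)
    fix e :: real assume e: "e > 0"
    then have "e / 2 > 0" by simp
    from correlation_approx[OF f g this] obtain n where
      n: "\<And>y. cmod (correlation f g y - correlation (truncation n f) (truncation n g) y) \<le> e / 2" by blast
    have "dist (correlation f g y) 0 < e" if y: "norm y \<ge> 2 * real n + 1" for y
    proof -
      have "truncation n f z * truncation n g (z - y) = 0" for z
        using y norm_triangle_ineq4[of z "z - y"] by (auto simp: truncation_def)
      then have "correlation (truncation n f) (truncation n g) y = 0"
        unfolding correlation_def by (simp only: integral_zero)
      then show ?thesis using n[of y] e by simp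
    qed
    then show "\<forall>\<^sub>F y in at_infinity. dist (correlation f g y) 0 < e"
      by (auto simp: eventually_at_infinity)
  qed
qed

lemma correlation_bounded:
  assumes f: "square_integrable f" and g: "square_integrable g"
  shows "\<exists>B. \<forall>y. cmod (correlation f g y) \<le> B"
  using square_integrable_mult(2)[OF f g, of 1] zero_less_one by blast

lemma correlation_measurable [measurable]:
  assumes [measurable]: "f \<in> borel_measurable borel" "g \<in> borel_measurable borel"
  shows "correlation f g \<in> borel_measurable borel"
  unfolding correlation_def[abs_def] by measurable

lemma correlation_flip:
  assumes [measurable]: "f \<in> borel_measurable borel" "g \<in> borel_measurable borel"
  shows "correlation f g (- y) = correlation g f y"
  unfolding correlation_def
  using lborel_integral_translate(1)[of "\<lambda>z. f z * g (z + y)" "- y"] by (simp add: mult.commute)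

lemma correlation_kernel_integrable:
  assumes f: "square_integrable f" and g: "square_integrable g"
    and K: "K \<in> borel_measurable borel" "integrable lborel K"
  shows "integrable lborel (\<lambda>y. complex_of_real (K y) * correlation f g y)"
proof -
  obtain B where B: "\<And>y. cmod (correlation f g y) \<le> B" using correlation_bounded[OF f g] by blast
  have [measurable]: "f \<in> borel_measurable borel" "g \<in> borel_measurable borel" using f g by measurable
  note [measurable] = K(1)
  have "integrable lborel (\<lambda>y. B * norm (K y))" using K by simp
  then show ?thesis
  proof (rule Bochner_Integration.integrable_bound)
    show "AE y in lborel. norm (complex_of_real (K y) * correlation f g y) \<le> norm (B * norm (K y))"
    proof (rule AE_I2)
      fix y
      have "cmod (correlation f g y) * \<bar>K y\<bar> \<le> B * \<bar>K y\<bar>" using B by (rule mult_right_mono) simp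
      then show "norm (complex_of_real (K y) * correlation f g y) \<le> norm (B * norm (K y))"
        by (simp add: norm_mult mult.commute)
    qed
  qed measurable
qed

text \<open>
  Substituting \<open>w = z - y\<close> turns an average of the correlation into a double integral against a convolution kernel,
  whose inner integral can be evaluated by testing a weak equation for \<open>g\<close>.
\<close>

lemma correlation_kernel:
  assumes f: "square_integrable f" and g: "square_integrable g"
    and K: "K \<in> borel_measurable borel" "integrable lborel K"
  shows "(\<integral>y. complex_of_real (K y) * correlation f g y \<partial>lborel)
      = (\<integral>z. f z * (\<integral>w. g w * complex_of_real (K (z - w)) \<partial>lborel) \<partial>lborel)"
proof -
  have [measurable]: "f \<in> borel_measurable borel" "g \<in> borel_measurable borel" using f g by measurable
  note [measurable] = K(1)
  define P where "P = (\<lambda>y z. complex_of_real (K y) * (f z * g (z - y)))"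
  have Pm[measurable]: "case_prod P \<in> borel_measurable (lborel \<Otimes>\<^sub>M lborel)"
    unfolding P_def by measurable
  have iP: "integrable (lborel \<Otimes>\<^sub>M lborel) (case_prod P)"
  proof (rule lborel_pair.Fubini_integrable)
    show "AE y in lborel. integrable lborel (\<lambda>z. case_prod P (y, z))"
      unfolding P_def using square_integrable_mult(1)[OF f g] by simp
    define B where "B = ((\<integral>z. (cmod (f z))\<^sup>2 \<partial>lborel) + (\<integral>z. (cmod (g z))\<^sup>2 \<partial>lborel)) / 2"
    have "integrable lborel (\<lambda>y. B * norm (K y))" using K by simp
    then show "integrable lborel (\<lambda>y. \<integral>z. norm (case_prod P (y, z)) \<partial>lborel)"
    proof (rule Bochner_Integration.integrable_bound)
      show "(\<lambda>y. \<integral>z. norm (case_prod P (y, z)) \<partial>lborel) \<in> borel_measurable lborel" by measurable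
      show "AE y in lborel. norm (\<integral>z. norm (case_prod P (y, z)) \<partial>lborel) \<le> norm (B * norm (K y))"
      proof (rule AE_I2)
        fix y
        have fi: "integrable lborel (\<lambda>z. (cmod (f z))\<^sup>2)" using f by (simp add: square_integrable_def)
        note gi = square_integrable_shift[OF g, of y]
        have "(\<integral>z. norm (f z * g (z - y)) \<partial>lborel) \<le> (\<integral>z. ((cmod (f z))\<^sup>2 + (cmod (g (z - y)))\<^sup>2) / 2 \<partial>lborel)"
          using square_integrable_mult(1)[OF f g, of y] fi gi weighted_arith_geo_mean[of 1]
          by (intro integral_mono integrable_norm) (auto simp: norm_mult)
        also have "\<dots> = B" using fi gi by (simp add: B_def)
        finally have "(\<integral>z. norm (f z * g (z - y)) \<partial>lborel) \<le> B" .
        then have "norm (K y) * (\<integral>z. norm (f z * g (z - y)) \<partial>lborel) \<le> norm (K y) * B"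
          by (rule mult_left_mono) simp
        moreover have "(\<integral>z. norm (case_prod P (y, z)) \<partial>lborel) = norm (K y) * (\<integral>z. norm (f z * g (z - y)) \<partial>lborel)"
          by (simp add: P_def norm_mult)
        moreover have "0 \<le> (\<integral>z. norm (case_prod P (y, z)) \<partial>lborel)" by (simp add: integral_nonneg)
        ultimately show "norm (\<integral>z. norm (case_prod P (y, z)) \<partial>lborel) \<le> norm (B * norm (K y))"
          by (simp add: mult.commute)
      qed
    qed
  qed measurable
  have "(\<integral>y. complex_of_real (K y) * correlation f g y \<partial>lborel) = (\<integral>y. (\<integral>z. P y z \<partial>lborel) \<partial>lborel)"
    by (simp add: P_def correlation_def)
  also have "\<dots> = (\<integral>z. (\<integral>y. P y z \<partial>lborel) \<partial>lborel)"
    by (rule lborel_pair.Fubini_integral[OF iP, symmetric])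
  also have "\<dots> = (\<integral>z. f z * (\<integral>w. g w * complex_of_real (K (z - w)) \<partial>lborel) \<partial>lborel)"
  proof (rule Bochner_Integration.integral_cong)
    fix z
    have "(\<integral>y. P y z \<partial>lborel) = f z * (\<integral>y. complex_of_real (K y) * g (z - y) \<partial>lborel)"
      unfolding P_def integral_mult_right_zero[symmetric] by (simp add: mult_ac)
    also have "(\<integral>y. complex_of_real (K y) * g (z - y) \<partial>lborel) = (\<integral>w. g w * complex_of_real (K (z - w)) \<partial>lborel)"
      using lborel_integral_reflect(1)[of "\<lambda>w. g w * complex_of_real (K (z - w))" z] by (simp add: mult.commute)
    finally show "(\<integral>y. P y z \<partial>lborel) = f z * (\<integral>w. g w * complex_of_real (K (z - w)) \<partial>lborel)" .
  qed simp
  finally show ?thesis .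
qed

text \<open>
  The same double integral with the roles exchanged: the inner integral now tests an equation for \<open>f\<close>.
\<close>

lemma correlation_kernel_flip:
  assumes f: "square_integrable f" and g: "square_integrable g"
    and K: "K \<in> borel_measurable borel" "integrable lborel K"
  shows "(\<integral>y. complex_of_real (K y) * correlation f g y \<partial>lborel)
      = (\<integral>w. g w * (\<integral>z. f z * complex_of_real (K (z - w)) \<partial>lborel) \<partial>lborel)"
proof -
  have [measurable]: "f \<in> borel_measurable borel" "g \<in> borel_measurable borel" using f g by measurable
  note [measurable] = K(1)
  have K': "(\<lambda>y. K (- y)) \<in> borel_measurable borel" "integrable lborel (\<lambda>y. K (- y))"
    using K lborel_integral_reflect(2)[of K 0] by simp_all
  have "(\<integral>y. complex_of_real (K y) * correlation f g y \<partial>lborel)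
      = (\<integral>y. complex_of_real (K (- y)) * correlation g f y \<partial>lborel)"
    using lborel_integral_reflect(1)[of "\<lambda>y. complex_of_real (K y) * correlation f g y" 0]
    by (simp add: correlation_flip)
  also have "\<dots> = (\<integral>w. g w * (\<integral>z. f z * complex_of_real (K (z - w)) \<partial>lborel) \<partial>lborel)"
    using correlation_kernel[OF g f K'] by simp
  finally show ?thesis .
qed

section \<open>Orthogonality of divergence-free and curl-free fields\<close>

lemma lborel_integral_scale:
  fixes f :: "complex \<Rightarrow> 'b::{banach, second_countable_topology}"
  assumes [measurable]: "f \<in> borel_measurable borel" and r: "r > 0"
  shows "(\<integral>z. f z \<partial>lborel) = (r\<^sup>2) *\<^sub>R (\<integral>u. f (r *\<^sub>R u) \<partial>lborel)"
    and "integrable lborel (\<lambda>u. f (r *\<^sub>R u)) \<longleftrightarrow> integrable lborel f"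
proof -
  have *: "lborel = density (distr lborel borel (\<lambda>x::complex. 0 + r *\<^sub>R x)) (\<lambda>_. ennreal (\<bar>r\<bar> ^ DIM(complex)))"
    by (rule lborel_affine) (use r in simp)
  have "(\<integral>z. f z \<partial>lborel) = (\<integral>z. f z \<partial>(density (distr lborel borel (\<lambda>x::complex. 0 + r *\<^sub>R x)) (\<lambda>_. ennreal (\<bar>r\<bar> ^ DIM(complex)))))"
    by (subst *) (rule refl)
  also have "\<dots> = (\<integral>z. (\<bar>r\<bar> ^ DIM(complex)) *\<^sub>R f z \<partial>distr lborel borel (\<lambda>x::complex. 0 + r *\<^sub>R x))"
    by (rule integral_density) auto
  also have "\<dots> = (\<integral>u. (\<bar>r\<bar> ^ DIM(complex)) *\<^sub>R f (0 + r *\<^sub>R u) \<partial>lborel)"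
    by (rule integral_distr) auto
  finally show "(\<integral>z. f z \<partial>lborel) = (r\<^sup>2) *\<^sub>R (\<integral>u. f (r *\<^sub>R u) \<partial>lborel)"
    by simp
  have "integrable lborel f \<longleftrightarrow> integrable (density (distr lborel borel (\<lambda>x::complex. 0 + r *\<^sub>R x)) (\<lambda>_. ennreal (\<bar>r\<bar> ^ DIM(complex)))) f"
    by (subst *) (rule refl)
  also have "\<dots> \<longleftrightarrow> integrable (distr lborel borel (\<lambda>x::complex. 0 + r *\<^sub>R x)) (\<lambda>z. (\<bar>r\<bar> ^ DIM(complex)) *\<^sub>R f z)"
    by (rule integrable_density) auto
  also have "\<dots> \<longleftrightarrow> integrable lborel (\<lambda>u. (\<bar>r\<bar> ^ DIM(complex)) *\<^sub>R f (0 + r *\<^sub>R u))"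
    by (rule integrable_distr_eq) auto
  also have "\<dots> \<longleftrightarrow> integrable lborel (\<lambda>u. f (r *\<^sub>R u))"
    using r integrable_scaleR_right[of "\<bar>r\<bar> ^ DIM(complex)" lborel "\<lambda>u. f (r *\<^sub>R u)"]
      integrable_scaleR_right[of "inverse (\<bar>r\<bar> ^ DIM(complex))" lborel "\<lambda>u. (\<bar>r\<bar> ^ DIM(complex)) *\<^sub>R f (r *\<^sub>R u)"]
    by auto
  finally show "integrable lborel (\<lambda>u. f (r *\<^sub>R u)) \<longleftrightarrow> integrable lborel f" ..
qed

lemma continuous_compact_support_integrable:
  fixes K :: "complex \<Rightarrow> 'b::{banach, second_countable_topology}"
  assumes "continuous_on UNIV K" "\<And>y. r \<le> norm y \<Longrightarrow> K y = 0"
  shows "K \<in> borel_measurable borel" "integrable lborel K"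
    and "integrable lborel (\<lambda>y. (norm (K y))\<^sup>2)" "\<exists>B. \<forall>y. norm (K y) \<le> B"
proof -
  show m[measurable]: "K \<in> borel_measurable borel" using assms(1) by (rule borel_measurable_continuous_onI)
  have "compact (K ` cball 0 r)"
    by (rule compact_continuous_image) (use assms(1) continuous_on_subset in auto)
  then obtain B where B: "\<forall>y\<in>K ` cball 0 r. norm y \<le> B" using compact_imp_bounded bounded_iff by blast
  have le: "norm (K y) \<le> \<bar>B\<bar> * indicator (cball 0 r) y" for y
  proof (cases "norm y \<le> r")
    case True then show ?thesis using B by force
  qed (use assms(2)[of y] in simp)
  then have "norm (K y) \<le> \<bar>B\<bar>" for y
    by (rule order_trans) (auto simp: indicator_def)
  then show "\<exists>B. \<forall>y. norm (K y) \<le> B" by blast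
  have i: "integrable lborel (\<lambda>y. \<bar>B\<bar> ^ n * indicator (cball (0::complex) r) y)" for n
    using emeasure_lborel_cball_finite[of "0::complex" r] by simp
  show "integrable lborel K"
    by (rule Bochner_Integration.integrable_bound[OF i[of 1]]) (use le in auto)
  have le2: "(norm (K y))\<^sup>2 \<le> \<bar>B\<bar> ^ 2 * indicator (cball 0 r) y" for y
    using power_mono[OF le[of y], of 2] by (cases "cmod y \<le> r") (simp_all add: power_mult_distrib)
  show "integrable lborel (\<lambda>y. (norm (K y))\<^sup>2)"
    by (rule Bochner_Integration.integrable_bound[OF i[of 2]]) (use le2 in auto)
qed

text \<open>
  The approximate identity has positive mass since its profile is nonnegative, continuous and not identically zero.
\<close>

lemma smooth_bump_kernel:
  shows "integrable lborel (\<lambda>u. smooth_bump ((cmod u)\<^sup>2))"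
    and "(\<integral>u. smooth_bump ((cmod u)\<^sup>2) \<partial>lborel) > 0"
proof -
  have c: "continuous_on UNIV (\<lambda>u::complex. smooth_bump ((cmod u)\<^sup>2))"
    by (rule continuous_on_compose2[OF smooth_bump_continuous[of UNIV]]) (auto intro!: continuous_intros)
  have z: "smooth_bump ((cmod u)\<^sup>2) = 0" if "2 \<le> norm u" for u
  proof -
    have "2 \<le> (cmod u)\<^sup>2" using mult_mono[of 1 "cmod u" 2 "cmod u"] that by (simp add: power2_eq_square)
    then show ?thesis by (simp add: smooth_bump_outside)
  qed
  show i: "integrable lborel (\<lambda>u. smooth_bump ((cmod u)\<^sup>2))"
    using continuous_compact_support_integrable(2)[OF c z] .
  have "(\<integral>u. smooth_bump ((cmod u)\<^sup>2) \<partial>lborel) \<noteq> 0"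
  proof
    assume 0: "(\<integral>u. smooth_bump ((cmod u)\<^sup>2) \<partial>lborel) = 0"
    then have ae: "AE u in lborel. smooth_bump ((cmod u)\<^sup>2) = 0"
      using integral_nonneg_eq_0_iff_AE[OF i] by (simp add: smooth_bump_nonneg)
    obtain s where s: "smooth_bump s > 0" using smooth_bump_pos_somewhere by blast
    have s1: "s > 1" using smooth_bump_outside[of s] s by force
    define U where "U = {u. smooth_bump ((cmod u)\<^sup>2) > 0}"
    have "open U" unfolding U_def using c by (intro open_Collect_less) auto
    moreover have "of_real (sqrt s) \<in> U" using s s1 by (simp add: U_def)
    ultimately have "U \<notin> null_sets lborel"
      using open_not_negligible negligible_iff_null_sets by (metis empty_iff null_sets_completionI)
    moreover have "U \<in> null_sets lborel"
    proof (rule AE_iff_null_sets[THEN iffD2, rotated])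
      show "U \<in> sets lborel" using \<open>open U\<close> by simp
      show "AE x in lborel. x \<notin> U" using ae by eventually_elim (simp add: U_def)
    qed
    ultimately show False by blast
  qed
  moreover have "(\<integral>u. smooth_bump ((cmod u)\<^sup>2) \<partial>lborel) \<ge> 0"
    by (intro Bochner_Integration.integral_nonneg smooth_bump_nonneg)
  ultimately show "(\<integral>u. smooth_bump ((cmod u)\<^sup>2) \<partial>lborel) > 0" by linarith
qed

text \<open>
  This is the orthogonality in the Helmholtz decomposition.  Let \<open>M\<close> be the Hessian of a radial function with
  compact support.  The double integral of \<open>D\<^sub>i(z) M\<^sub>i\<^sub>j(z - w) C\<^sub>j(w)\<close> vanishes as \<open>D\<close> is divergence-free; as \<open>C\<close> is
  curl-free, \<open>M\<close> may be replaced in it by its trace times the identity.  Taking for the trace the difference of the kernel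
  \<^const>\<open>smooth_bump\<close> at the scales \<open>1 / sqrt t\<close> and \<open>1\<close>, the average of the correlation \<open>\<Psi>\<close> over the kernel does not depend on the
  scale.  It tends to a multiple of \<open>\<Psi>(0)\<close> at small scales and to \<open>0\<close> at large ones, so \<open>\<Psi>(0) = 0\<close>.
\<close>

theorem divergence_free_curl_free_orthogonal:
  fixes D1 D2 C1 C2 :: "complex \<Rightarrow> complex"
  assumes L2: "square_integrable D1" "square_integrable D2" "square_integrable C1" "square_integrable C2"
    and divergence: "\<And>\<phi>. test_function \<phi> \<Longrightarrow>
      (\<integral>z. D1 z * complex_of_real (partial1 \<phi> z) + D2 z * complex_of_real (partial2 \<phi> z) \<partial>lborel) = 0"
    and curl: "\<And>\<phi>. test_function \<phi> \<Longrightarrow>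
      (\<integral>z. C1 z * complex_of_real (partial2 \<phi> z) \<partial>lborel) = (\<integral>z. C2 z * complex_of_real (partial1 \<phi> z) \<partial>lborel)"
  shows "(\<integral>z. D1 z * C1 z + D2 z * C2 z \<partial>lborel) = 0"
proof -
  define \<Psi> where "\<Psi> y = correlation D1 C1 y + correlation D2 C2 y" for y
  have [measurable]: "D1 \<in> borel_measurable borel" "D2 \<in> borel_measurable borel"
    "C1 \<in> borel_measurable borel" "C2 \<in> borel_measurable borel" using L2 by measurable
  have \<Psi>m[measurable]: "\<Psi> \<in> borel_measurable borel" unfolding \<Psi>_def[abs_def] by measurable
  have key: "(\<integral>y. complex_of_real (t * smooth_bump (t * (cmod y)\<^sup>2)) * \<Psi> y \<partial>lborel)
      = (\<integral>y. complex_of_real (smooth_bump ((cmod y)\<^sup>2)) * \<Psi> y \<partial>lborel)" if t: "t > 0" for t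
  proof -
    \<comment> \<open>The tails \<open>1 / s\<close> of the two terms cancel, so the kernels have compact support.\<close>
    define f where "f s = t * cauchy_profile (t * s) - cauchy_profile s" for s
    have f: "smooth_real f"
      unfolding f_def[abs_def]
      using smooth_real_add[OF smooth_real_mult[OF smooth_real_const smooth_real_affine[OF smooth_cauchy_profile, of t 0], of t]
          smooth_real_mult[OF smooth_real_const smooth_cauchy_profile, of "- 1"]] by simp
    have f0: "f s = 0" if "s \<ge> 2 + 2 / t" for s
    proof -
      have "2 / t > 0" using t by simp
      then have "s \<ge> 2" "s \<ge> 2 / t" using that by linarith+
      then have "t * s \<ge> 2" "s \<ge> 2" using t by (simp_all add: field_simps)
      then show ?thesis using t by (simp add: f_def cauchy_profile_eq)
    qed
    have f': "f s + s * deriv f s = t * smooth_bump (t * s) - smooth_bump s" for s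
    proof -
      have "((\<lambda>s. t * cauchy_profile (t * s) - cauchy_profile s) has_real_derivative
          t * (deriv cauchy_profile (t * s) * t) - deriv cauchy_profile s) (at s)"
        by (auto intro!: derivative_eq_intros DERIV_chain2[OF smooth_real_deriv(1)] smooth_real_deriv(1) smooth_cauchy_profile)
      then have "deriv f s = t * (deriv cauchy_profile (t * s) * t) - deriv cauchy_profile s"
        unfolding f_def[abs_def] by (rule DERIV_imp_deriv)
      then have "f s + s * deriv f s = t * cauchy_profile (t * s) - cauchy_profile s
          + s * (t * (deriv cauchy_profile (t * s) * t) - deriv cauchy_profile s)"
        by (simp only: f_def)
      then show ?thesis by (simp add: smooth_bump_cauchy_profile algebra_simps)
    qed
    have fder0: "deriv f s = 0" if "s \<ge> 2 + 2 / t + 1" for s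
    proof -
      have "((\<lambda>_. 0) has_real_derivative 0) (at s)" by simp
      then have "(f has_real_derivative 0) (at s)"
        by (rule has_field_derivative_transform_within_open[where S="{2 + 2 / t<..}"])
          (use that f0 in auto)
      then show ?thesis by (rule DERIV_imp_deriv)
    qed
    define M11 M12 M22 where "M11 y = f ((cmod y)\<^sup>2) + 2 * (Re y)\<^sup>2 * deriv f ((cmod y)\<^sup>2)"
      and "M12 y = 2 * Re y * Im y * deriv f ((cmod y)\<^sup>2)"
      and "M22 y = f ((cmod y)\<^sup>2) + 2 * (Im y)\<^sup>2 * deriv f ((cmod y)\<^sup>2)" for y
    have even: "M11 (w - z) = M11 (z - w)" "M12 (w - z) = M12 (z - w)" "M22 (w - z) = M22 (z - w)" for z w
      by (simp_all add: M11_def M12_def M22_def norm_minus_commute power2_commute algebra_simps)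
    have cf: "continuous_on UNIV (\<lambda>y::complex. f ((cmod y)\<^sup>2))" "continuous_on UNIV (\<lambda>y::complex. deriv f ((cmod y)\<^sup>2))"
      by (rule continuous_on_compose2[OF smooth_real_continuous[of _ UNIV]];
          use f smooth_real_deriv(2)[OF f] in \<open>auto intro!: continuous_intros\<close>)+
    have cont: "continuous_on UNIV M11" "continuous_on UNIV M12" "continuous_on UNIV M22"
      unfolding M11_def[abs_def] M12_def[abs_def] M22_def[abs_def]
      using cf by (auto intro!: continuous_intros)
    have zero: "M11 y = 0 \<and> M12 y = 0 \<and> M22 y = 0" if y: "norm y \<ge> 2 + 2 / t + 1" for y
    proof -
      have "2 / t > 0" using t by simp
      then have "1 \<le> norm y" using y by linarith
      then have "norm y \<le> (norm y)\<^sup>2" using mult_mono[of 1 "norm y" "norm y" "norm y"] by (simp add: power2_eq_square)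
      with y have "(norm y)\<^sup>2 \<ge> 2 + 2 / t + 1" by linarith
      then show ?thesis using f0 fder0 by (simp add: M11_def M12_def M22_def)
    qed
    note K11 = continuous_compact_support_integrable[OF cont(1), of "2 + 2 / t + 1"]
    note K12 = continuous_compact_support_integrable[OF cont(2), of "2 + 2 / t + 1"]
    note K22 = continuous_compact_support_integrable[OF cont(3), of "2 + 2 / t + 1"]
    have K: "M11 \<in> borel_measurable borel" "integrable lborel M11" "M12 \<in> borel_measurable borel" "integrable lborel M12"
      "M22 \<in> borel_measurable borel" "integrable lborel M22"
      using K11 K12 K22 zero by auto
    have sq: "square_integrable (\<lambda>z. complex_of_real (M11 z))" "square_integrable (\<lambda>z. complex_of_real (M12 z))"
      "square_integrable (\<lambda>z. complex_of_real (M22 z))"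
      using K11 K12 K22 zero by (auto simp: square_integrable_def)
    note test = test_function_radial[OF f f0]
    note part = partials_radial[OF f, folded M11_def M12_def M22_def]
    have inner: "integrable lborel (\<lambda>z. g z * complex_of_real (M (z - w)))"
      if "square_integrable g" "square_integrable (\<lambda>z. complex_of_real (M z))" for g M w
      using square_integrable_mult(1)[OF that] by simp
    define I where "I g h M = (\<integral>y. complex_of_real (M y) * correlation g h y \<partial>lborel)" for g h :: "complex \<Rightarrow> complex" and M :: "complex \<Rightarrow> real"
    have div1: "(\<integral>z. D1 z * complex_of_real (M11 (z - w)) \<partial>lborel) = - (\<integral>z. D2 z * complex_of_real (M12 (z - w)) \<partial>lborel)" for w
      using divergence[OF test(1)[where w=w]] inner[OF L2(1) sq(1), where w=w] inner[OF L2(2) sq(2), where w=w]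
      unfolding part by (simp add: eq_neg_iff_add_eq_0)
    have div2: "(\<integral>z. D1 z * complex_of_real (M12 (z - w)) \<partial>lborel) = - (\<integral>z. D2 z * complex_of_real (M22 (z - w)) \<partial>lborel)" for w
      using divergence[OF test(2)[where w=w]] inner[OF L2(1) sq(2), where w=w] inner[OF L2(2) sq(3), where w=w]
      unfolding part by (simp add: eq_neg_iff_add_eq_0)
    have d1: "I D1 C1 M11 = - I D2 C1 M12"
      unfolding I_def correlation_kernel_flip[OF L2(1) L2(3) K(1,2)] correlation_kernel_flip[OF L2(2) L2(3) K(3,4)] div1
      by simp
    have d2: "I D1 C2 M12 = - I D2 C2 M22"
      unfolding I_def correlation_kernel_flip[OF L2(1) L2(4) K(3,4)] correlation_kernel_flip[OF L2(2) L2(4) K(5,6)] div2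
      by simp
    have c1: "(\<integral>w. C1 w * complex_of_real (M12 (z - w)) \<partial>lborel) = (\<integral>w. C2 w * complex_of_real (M11 (z - w)) \<partial>lborel)" for z
      using curl[OF test(1)[where w=z]] unfolding part even[of _ z] .
    have c2: "(\<integral>w. C1 w * complex_of_real (M22 (z - w)) \<partial>lborel) = (\<integral>w. C2 w * complex_of_real (M12 (z - w)) \<partial>lborel)" for z
      using curl[OF test(2)[where w=z]] unfolding part even[of _ z] .
    have e1: "I D2 C1 M12 = I D2 C2 M11"
      unfolding I_def correlation_kernel[OF L2(2) L2(3) K(3,4)] correlation_kernel[OF L2(2) L2(4) K(1,2)] c1 by simp
    have e2: "I D1 C1 M22 = I D1 C2 M12"
      unfolding I_def correlation_kernel[OF L2(1) L2(3) K(5,6)] correlation_kernel[OF L2(1) L2(4) K(3,4)] c2 by simp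
    note ik = correlation_kernel_integrable[OF L2(1) L2(3) K(1,2)] correlation_kernel_integrable[OF L2(1) L2(3) K(5,6)]
      correlation_kernel_integrable[OF L2(2) L2(4) K(1,2)] correlation_kernel_integrable[OF L2(2) L2(4) K(5,6)]
    have "(\<integral>y. complex_of_real (M11 y + M22 y) * \<Psi> y \<partial>lborel)
        = (\<integral>y. (complex_of_real (M11 y) * correlation D1 C1 y + complex_of_real (M22 y) * correlation D1 C1 y)
           + (complex_of_real (M11 y) * correlation D2 C2 y + complex_of_real (M22 y) * correlation D2 C2 y) \<partial>lborel)"
      by (simp add: \<Psi>_def algebra_simps)
    also have "\<dots> = I D1 C1 M11 + I D1 C1 M22 + (I D2 C2 M11 + I D2 C2 M22)"
      unfolding I_def using ik by simp
    also have "\<dots> = 0" using d1 d2 e1 e2 by simp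
    finally have sum0: "(\<integral>y. complex_of_real (M11 y + M22 y) * \<Psi> y \<partial>lborel) = 0" .
    have tr: "M11 y + M22 y = 2 * (t * smooth_bump (t * (cmod y)\<^sup>2) - smooth_bump ((cmod y)\<^sup>2))" for y
    proof -
      have "M11 y + M22 y = 2 * (f ((cmod y)\<^sup>2) + (cmod y)\<^sup>2 * deriv f ((cmod y)\<^sup>2))"
        by (simp add: M11_def M22_def cmod_power2 algebra_simps)
      then show ?thesis using f' by simp
    qed
    have mb: "(\<lambda>y. smooth_bump (t * (cmod y)\<^sup>2)) \<in> borel_measurable borel" for t
      by (intro borel_measurable_continuous_onI continuous_on_compose2[OF smooth_bump_continuous[of UNIV]])
        (auto intro!: continuous_intros)
    have ib: "integrable lborel (\<lambda>y. smooth_bump (t * (cmod y)\<^sup>2))" if "t > 0" for t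
      using lborel_integral_scale(2)[OF mb[of 1], of "sqrt t"] smooth_bump_kernel(1) that
      by (simp add: power_mult_distrib)
    have i\<Psi>: "integrable lborel (\<lambda>y. complex_of_real (smooth_bump (t * (cmod y)\<^sup>2)) * \<Psi> y)" if "t > 0" for t
      using correlation_kernel_integrable[OF L2(1) L2(3) mb ib[OF that]]
        correlation_kernel_integrable[OF L2(2) L2(4) mb ib[OF that]]
      by (simp add: \<Psi>_def distrib_left)
    have "(\<integral>y. complex_of_real (M11 y + M22 y) * \<Psi> y \<partial>lborel) =
       (\<integral>y. 2 * (complex_of_real t * (complex_of_real (smooth_bump (t * (cmod y)\<^sup>2)) * \<Psi> y)) - 2 * (complex_of_real (smooth_bump (1 * (cmod y)\<^sup>2)) * \<Psi> y) \<partial>lborel)"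
      unfolding tr by (simp add: algebra_simps)
    also have "\<dots> = 2 * (complex_of_real t * (\<integral>y. (complex_of_real (smooth_bump (t * (cmod y)\<^sup>2)) * \<Psi> y) \<partial>lborel)) - 2 * (\<integral>y. complex_of_real (smooth_bump (1 * (cmod y)\<^sup>2)) * \<Psi> y \<partial>lborel)"
      using i\<Psi>[OF t] i\<Psi>[of 1]
      by (subst Bochner_Integration.integral_diff) auto
    finally have "complex_of_real t * (\<integral>y. (complex_of_real (smooth_bump (t * (cmod y)\<^sup>2)) * \<Psi> y) \<partial>lborel) = (\<integral>y. complex_of_real (smooth_bump ((cmod y)\<^sup>2)) * \<Psi> y \<partial>lborel)"
      unfolding sum0 by simp
    then show ?thesis
      by (simp add: mult.assoc)
  qed
  \<comment> \<open>The common value of the averages at all scales.\<close>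
  define c where "c = (\<integral>y. complex_of_real (smooth_bump ((cmod y)\<^sup>2)) * \<Psi> y \<partial>lborel)"
  have mb: "(\<lambda>y. smooth_bump (t * (cmod y)\<^sup>2)) \<in> borel_measurable borel" for t
    by (intro borel_measurable_continuous_onI continuous_on_compose2[OF smooth_bump_continuous[of UNIV]])
      (auto intro!: continuous_intros)
  note mb' [measurable] = mb[of 1, simplified]
  have scaled: "(\<integral>u. complex_of_real (smooth_bump ((cmod u)\<^sup>2)) * \<Psi> (r *\<^sub>R u) \<partial>lborel) = c" if r: "r > 0" for r
  proof -
    define t where "t = inverse (r\<^sup>2)"
    have t: "t > 0" "t * r\<^sup>2 = 1" using r by (simp_all add: t_def)
    have meas: "(\<lambda>y. complex_of_real (t * smooth_bump (t * (cmod y)\<^sup>2)) * \<Psi> y) \<in> borel_measurable borel"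
      using mb[of t] by simp
    have bump_eq: "smooth_bump (t * (r\<^sup>2 * s)) = smooth_bump s" for s
      using t(2) by (simp add: mult.assoc[symmetric])
    have "c = (\<integral>y. complex_of_real (t * smooth_bump (t * (cmod y)\<^sup>2)) * \<Psi> y \<partial>lborel)"
      unfolding c_def by (rule key[OF t(1), symmetric])
    also have "\<dots> = (r\<^sup>2) *\<^sub>R (\<integral>u. complex_of_real (t * smooth_bump (t * (cmod (r *\<^sub>R u))\<^sup>2)) * \<Psi> (r *\<^sub>R u) \<partial>lborel)"
      by (rule lborel_integral_scale(1)[OF meas r])
    also have "\<dots> = (r\<^sup>2) *\<^sub>R (\<integral>u. complex_of_real t * (complex_of_real (smooth_bump ((cmod u)\<^sup>2)) * \<Psi> (r *\<^sub>R u)) \<partial>lborel)"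
      by (simp add: power_mult_distrib bump_eq mult.assoc)
    also have "\<dots> = (\<integral>u. complex_of_real (smooth_bump ((cmod u)\<^sup>2)) * \<Psi> (r *\<^sub>R u) \<partial>lborel)"
    proof -
      have "(r\<^sup>2) *\<^sub>R (complex_of_real t * J) = complex_of_real (t * r\<^sup>2) * J" for J
        by (simp add: scaleR_conv_of_real)
      then show ?thesis by (simp add: t(2))
    qed
    finally show ?thesis by simp
  qed
  obtain B1 where B1: "\<And>y. cmod (correlation D1 C1 y) \<le> B1"
    using correlation_bounded[OF L2(1,3)] by blast
  obtain B2 where B2: "\<And>y. cmod (correlation D2 C2 y) \<le> B2"
    using correlation_bounded[OF L2(2,4)] by blast
  have \<Psi>B: "cmod (\<Psi> y) \<le> B1 + B2" for y
    using norm_triangle_mono[OF B1 B2] by (simp add: \<Psi>_def)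
  have \<Psi>lim: "(\<Psi> \<longlongrightarrow> \<Psi> 0) (at 0)" "(\<Psi> \<longlongrightarrow> 0) at_infinity"
  proof -
    show "(\<Psi> \<longlongrightarrow> \<Psi> 0) (at 0)" unfolding \<Psi>_def[abs_def]
      by (intro tendsto_add correlation_tendsto L2)
    have "((\<lambda>y. correlation D1 C1 y + correlation D2 C2 y) \<longlongrightarrow> 0 + 0) at_infinity"
      by (intro tendsto_add correlation_tendsto L2)
    then show "(\<Psi> \<longlongrightarrow> 0) at_infinity" by (simp add: \<Psi>_def[abs_def])
  qed
  have limit: "(\<integral>u. complex_of_real (smooth_bump ((cmod u)\<^sup>2)) * L \<partial>lborel) = c"
    if r: "\<And>n. r n > 0" and lim: "\<And>u. u \<noteq> 0 \<Longrightarrow> (\<lambda>n. \<Psi> (r n *\<^sub>R u)) \<longlonglongrightarrow> L" for r :: "nat \<Rightarrow> real" and L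
  proof -
    have "(\<lambda>n. \<integral>u. complex_of_real (smooth_bump ((cmod u)\<^sup>2)) * \<Psi> (r n *\<^sub>R u) \<partial>lborel)
        \<longlonglongrightarrow> (\<integral>u. complex_of_real (smooth_bump ((cmod u)\<^sup>2)) * L \<partial>lborel)"
    proof (rule integral_dominated_convergence[where w="\<lambda>u. smooth_bump ((cmod u)\<^sup>2) * (B1 + B2)"])
      show "AE u in lborel. (\<lambda>n. complex_of_real (smooth_bump ((cmod u)\<^sup>2)) * \<Psi> (r n *\<^sub>R u))
          \<longlonglongrightarrow> complex_of_real (smooth_bump ((cmod u)\<^sup>2)) * L"
      proof (rule AE_I2)
        fix u :: complex
        show "(\<lambda>n. complex_of_real (smooth_bump ((cmod u)\<^sup>2)) * \<Psi> (r n *\<^sub>R u))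
          \<longlonglongrightarrow> complex_of_real (smooth_bump ((cmod u)\<^sup>2)) * L"
          by (cases "u = 0") (auto intro!: tendsto_intros lim simp: smooth_bump_outside)
      qed
      show "AE u in lborel. norm (complex_of_real (smooth_bump ((cmod u)\<^sup>2)) * \<Psi> (r n *\<^sub>R u)) \<le> smooth_bump ((cmod u)\<^sup>2) * (B1 + B2)" for n
        by (rule AE_I2) (auto simp: norm_mult smooth_bump_nonneg intro!: mult_left_mono \<Psi>B)
    qed (use smooth_bump_kernel(1) in auto)
    then have "(\<lambda>n. c) \<longlonglongrightarrow> (\<integral>u. complex_of_real (smooth_bump ((cmod u)\<^sup>2)) * L \<partial>lborel)"
      by (simp add: scaled r)
    then show ?thesis using LIMSEQ_unique tendsto_const by blast
  qed
  have "(\<integral>u. complex_of_real (smooth_bump ((cmod u)\<^sup>2)) * 0 \<partial>(lborel :: complex measure)) = c"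
  proof (rule limit[of "\<lambda>n. real (Suc n)"])
    fix u :: complex assume u: "u \<noteq> 0"
    have "filterlim (\<lambda>n. norm u * real (Suc n)) at_top sequentially"
      by (rule filterlim_tendsto_pos_mult_at_top[OF tendsto_const])
        (use u in \<open>auto intro: filterlim_compose[OF filterlim_real_sequentially filterlim_Suc] simp del: of_nat_Suc\<close>)
    then have "filterlim (\<lambda>n. norm (real (Suc n) *\<^sub>R u)) at_top sequentially"
      by (simp add: mult.commute del: of_nat_Suc)
    then have "filterlim (\<lambda>n. real (Suc n) *\<^sub>R u) at_infinity sequentially"
      by (rule filterlim_norm_at_top_imp_at_infinity)
    then show "(\<lambda>n. \<Psi> (real (Suc n) *\<^sub>R u)) \<longlonglongrightarrow> 0"
      by (rule filterlim_compose[OF \<Psi>lim(2)])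
  qed simp
  then have c0: "c = 0" by simp
  have "(\<integral>u. complex_of_real (smooth_bump ((cmod u)\<^sup>2)) * \<Psi> 0 \<partial>(lborel :: complex measure)) = c"
  proof (rule limit[of "\<lambda>n. inverse (real (Suc n))"])
    fix u :: complex assume u: "u \<noteq> 0"
    have "(\<lambda>n. inverse (real (Suc n)) *\<^sub>R u) \<longlonglongrightarrow> 0 *\<^sub>R u"
      by (intro tendsto_scaleR LIMSEQ_inverse_real_of_nat tendsto_const)
    moreover have "\<forall>\<^sub>F n in sequentially. inverse (real (Suc n)) *\<^sub>R u \<noteq> 0" using u by simp
    ultimately have "filterlim (\<lambda>n. inverse (real (Suc n)) *\<^sub>R u) (at 0) sequentially"
      by (simp add: filterlim_at)
    then show "(\<lambda>n. \<Psi> (inverse (real (Suc n)) *\<^sub>R u)) \<longlonglongrightarrow> \<Psi> 0"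
      by (rule filterlim_compose[OF \<Psi>lim(1)])
  qed simp
  then have "complex_of_real (\<integral>u. smooth_bump ((cmod u)\<^sup>2) \<partial>(lborel :: complex measure)) * \<Psi> 0 = 0"
    using c0 by simp
  then have "\<Psi> 0 = 0" using smooth_bump_kernel(2) by simp
  then show ?thesis
    using square_integrable_mult(1)[OF L2(1) L2(3), of 0] square_integrable_mult(1)[OF L2(2) L2(4), of 0]
    by (simp add: \<Psi>_def correlation_def)
qed

section \<open>Rotations\<close>

lemma lborel_nn_integral_translate:
  fixes f :: "'a::euclidean_space \<Rightarrow> ennreal"
  assumes [measurable]: "f \<in> borel_measurable borel"
  shows "(\<integral>\<^sup>+z. f (z + y) \<partial>lborel) = (\<integral>\<^sup>+z. f z \<partial>lborel)"
proof -
  have "(\<integral>\<^sup>+z. f z \<partial>distr lborel borel ((+) y)) = (\<integral>\<^sup>+z. f (y + z) \<partial>lborel)"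
    by (rule nn_integral_distr) auto
  then show ?thesis by (simp add: lborel_distr_plus add.commute)
qed

text \<open>
  Uniqueness of Haar measure in a special case.  Exchanging the order of integration in the double integral of
  \<open>f (c x + y) g y\<close> compares the image measure with Lebesgue measure up to the factor of their masses of the unit disk, which
  agree because a rotation preserves the disk.
\<close>

lemma lborel_distr_rotation:
  fixes c :: complex
  assumes c: "cmod c = 1"
  shows "distr lborel borel ((*) c) = lborel"
proof (rule measure_eqI)
  fix A :: "complex set" assume "A \<in> sets (distr lborel borel ((*) c))"
  then have A[measurable]: "A \<in> sets borel" by simp
  define f :: "complex \<Rightarrow> ennreal" where "f = indicator A"
  define g :: "complex \<Rightarrow> ennreal" where "g = indicator (ball 0 1)"
  define v where "v = emeasure lborel (ball (0::complex) 1)"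
  have [measurable]: "f \<in> borel_measurable borel" "g \<in> borel_measurable borel"
    unfolding f_def g_def by (intro borel_measurable_indicator; simp)+
  have c0: "c \<noteq> 0" using c by auto
  have v: "v \<noteq> 0" "v \<noteq> top"
    using open_not_negligible[of "ball (0::complex) 1"] emeasure_lborel_ball_finite[of "0::complex" 1]
    by (auto simp: v_def negligible_iff_emeasure0)
  have gv: "(\<integral>\<^sup>+y. g y \<partial>lborel) = v" by (simp add: g_def v_def)
  have Mf: "(\<integral>\<^sup>+x. f (c * x + y) \<partial>lborel) = (\<integral>\<^sup>+x. f (c * x) \<partial>lborel)" for y
    using lborel_nn_integral_translate[of "\<lambda>x. f (c * x)" "y / c"] c0 by (simp add: distrib_left)
  have Mg: "(\<integral>\<^sup>+x. g (y - c * x) \<partial>lborel) = v" for y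
  proof -
    have "(\<integral>\<^sup>+x. g (y - c * x) \<partial>lborel) = (\<integral>\<^sup>+x. g (- (c * x)) \<partial>lborel)"
      using lborel_nn_integral_translate[of "\<lambda>x. g (- (c * x))" "- y / c"] c0 by (simp add: right_diff_distrib)
    also have "\<dots> = (\<integral>\<^sup>+x. g x \<partial>lborel)"
      by (rule nn_integral_cong) (simp add: g_def indicator_def norm_mult c)
    finally show ?thesis by (simp add: gv)
  qed
  have "v * (\<integral>\<^sup>+x. f (c * x) \<partial>lborel) = (\<integral>\<^sup>+y. g y * (\<integral>\<^sup>+x. f (c * x + y) \<partial>lborel) \<partial>lborel)"
    unfolding Mf gv[symmetric] by (rule nn_integral_multc[symmetric]) simp
  also have "\<dots> = (\<integral>\<^sup>+y. (\<integral>\<^sup>+x. g y * f (c * x + y) \<partial>lborel) \<partial>lborel)"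
    by (intro nn_integral_cong nn_integral_cmult[symmetric]) simp
  also have "\<dots> = (\<integral>\<^sup>+x. (\<integral>\<^sup>+y. g y * f (c * x + y) \<partial>lborel) \<partial>lborel)"
    by (rule lborel_pair.Fubini') measurable
  also have "\<dots> = (\<integral>\<^sup>+x. (\<integral>\<^sup>+y. g (y - c * x) * f y \<partial>lborel) \<partial>lborel)"
  proof (rule nn_integral_cong)
    fix x
    show "(\<integral>\<^sup>+y. g y * f (c * x + y) \<partial>lborel) = (\<integral>\<^sup>+y. g (y - c * x) * f y \<partial>lborel)"
      using lborel_nn_integral_translate[of "\<lambda>y. g (y - c * x) * f y" "c * x"] by (simp add: add.commute)
  qed
  also have "\<dots> = (\<integral>\<^sup>+y. (\<integral>\<^sup>+x. g (y - c * x) * f y \<partial>lborel) \<partial>lborel)"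
    by (rule lborel_pair.Fubini') measurable
  also have "\<dots> = (\<integral>\<^sup>+y. v * f y \<partial>lborel)"
    by (intro nn_integral_cong) (simp add: nn_integral_multc Mg)
  also have "\<dots> = v * (\<integral>\<^sup>+y. f y \<partial>lborel)" by (rule nn_integral_cmult) simp
  finally have "(\<integral>\<^sup>+x. f (c * x) \<partial>lborel) = (\<integral>\<^sup>+y. f y \<partial>lborel)"
    using v by (simp add: ennreal_mult_cancel_left)
  moreover have "emeasure (distr lborel borel ((*) c)) A = (\<integral>\<^sup>+x. f (c * x) \<partial>lborel)"
  proof -
    have "emeasure (distr lborel borel ((*) c)) A = (\<integral>\<^sup>+x. f x \<partial>distr lborel borel ((*) c))"
      by (simp add: f_def)
    also have "\<dots> = (\<integral>\<^sup>+x. f (c * x) \<partial>lborel)" by (rule nn_integral_distr) auto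
    finally show ?thesis .
  qed
  ultimately show "emeasure (distr lborel borel ((*) c)) A = emeasure lborel A"
    by (simp add: f_def)
qed simp

definition circle_mean :: "(complex \<Rightarrow> complex) \<Rightarrow> complex \<Rightarrow> real \<Rightarrow> complex"
  where "circle_mean \<psi> p r = (LBINT t:{0..2 * pi}. \<psi> (p + complex_of_real r * cis t)) / (2 * pi)"

lemma integral_period_shift:
  fixes h :: "real \<Rightarrow> complex"
  assumes [measurable]: "h \<in> borel_measurable borel"
    and B: "\<And>t. norm (h t) \<le> B" and per: "\<And>t. h (t + 2 * pi) = h t" and \<theta>: "0 \<le> \<theta>" "\<theta> \<le> 2 * pi"
  shows "(LBINT t:{0..2 * pi}. h (t + \<theta>)) = (LBINT t:{0..2 * pi}. h t)"
proof -
  have int: "set_integrable lborel {a..b} h" for a b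
  proof -
    have "integrable lborel (\<lambda>t. B * indicator {a..b} t :: real)"
      by (intro integrable_mult_right integrable_real_indicator) (auto simp: emeasure_lborel_Icc_eq)
    then show ?thesis
      unfolding set_integrable_def
      by (rule Bochner_Integration.integrable_bound)
        (use B in \<open>auto simp: indicator_def intro: order_trans[OF B abs_ge_self]\<close>)
  qed
  have shift: "(LBINT t:{a..b}. h (t + s)) = (LBINT t:{a + s..b + s}. h t)" for a b s
  proof -
    have "(LBINT t:{a + s..b + s}. h t) = (\<integral>t. indicator {a + s..b + s} (t + s) *\<^sub>R h (t + s) \<partial>lborel)"
      unfolding set_lebesgue_integral_def
      by (rule lborel_integral_translate(1)[symmetric]) measurable
    also have "\<dots> = (LBINT t:{a..b}. h (t + s))"
      unfolding set_lebesgue_integral_def by (rule Bochner_Integration.integral_cong) (auto simp: indicator_def)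
    finally show ?thesis by simp
  qed
  have join: "(LBINT t:{a..c}. h t) = (LBINT t:{a..b}. h t) + (LBINT t:{b..c}. h t)" if "a \<le> b" "b \<le> c" for a b c
  proof -
    have "(LBINT t:{a..b} \<union> {b..c}. h t) = (LBINT t:{a..b}. h t) + (LBINT t:{b..c}. h t)"
    proof (rule set_integral_Un_AE)
      have "AE t in lborel. t \<noteq> b" by (rule AE_lborel_singleton)
      then show "AE t in lborel. \<not> (t \<in> {a..b} \<and> t \<in> {b..c})"
        by eventually_elim auto
    qed (use int in auto)
    then show ?thesis using that by (simp add: ivl_disj_un_two_touch)
  qed
  have "(LBINT t:{0..2 * pi}. h (t + \<theta>)) = (LBINT t:{\<theta>..2 * pi + \<theta>}. h t)"
    using shift[of 0 "2 * pi" \<theta>] by (simp add: add.commute)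
  also have "\<dots> = (LBINT t:{\<theta>..2 * pi}. h t) + (LBINT t:{2 * pi..2 * pi + \<theta>}. h t)"
    by (rule join) (use \<theta> in auto)
  also have "(LBINT t:{2 * pi..2 * pi + \<theta>}. h t) = (LBINT t:{0..\<theta>}. h t)"
    using shift[of 0 \<theta> "2 * pi"] by (simp add: per add.commute)
  also have "(LBINT t:{\<theta>..2 * pi}. h t) + (LBINT t:{0..\<theta>}. h t) = (LBINT t:{0..2 * pi}. h t)"
    using join[of 0 \<theta> "2 * pi"] \<theta> by simp
  finally show ?thesis .
qed

lemma circle_mean_rotate:
  assumes [measurable]: "\<psi> \<in> borel_measurable borel" and B: "\<And>x. norm (\<psi> x) \<le> B"
  shows "(LBINT t:{0..2 * pi}. \<psi> (cis t * x)) = 2 * pi * circle_mean \<psi> 0 (cmod x)"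
proof -
  have x: "x = complex_of_real (cmod x) * cis (Arg2pi x)"
    using Arg2pi_eq[of x] by (cases "x = 0") (auto simp: cis_conv_exp)
  have "cis t * x = complex_of_real (cmod x) * cis (t + Arg2pi x)" for t
    using arg_cong[OF x, of "\<lambda>y. cis t * y"] by (simp flip: cis_mult)
  then have "(LBINT t:{0..2 * pi}. \<psi> (cis t * x)) = (LBINT t:{0..2 * pi}. \<psi> (complex_of_real (cmod x) * cis (t + Arg2pi x)))"
    by simp
  also have "\<dots> = (LBINT t:{0..2 * pi}. \<psi> (complex_of_real (cmod x) * cis t))"
  proof (rule integral_period_shift[where B=B])
    show "(\<lambda>t. \<psi> (complex_of_real (cmod x) * cis t)) \<in> borel_measurable borel"
      by (rule measurable_compose[OF _ assms(1)])
        (intro borel_measurable_continuous_onI continuous_intros)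
  qed (use B Arg2pi[of x] in \<open>auto simp flip: cis_mult\<close>)
  finally show ?thesis by (simp add: circle_mean_def)
qed

text \<open>
  Average the invariance over all rotations and exchange the integrals.
\<close>

lemma rotation_average:
  fixes M :: "complex measure"
  assumes fin: "finite_measure M" and sets[measurable_cong]: "sets M = sets borel"
    and inv: "\<And>c. cmod c = 1 \<Longrightarrow> distr M borel ((*) c) = M"
    and m[measurable]: "\<psi> \<in> borel_measurable borel" and B: "\<And>x. norm (\<psi> x) \<le> B"
  shows "(\<integral>x. \<psi> x \<partial>M) = (\<integral>x. circle_mean \<psi> 0 (cmod x) \<partial>M)"
proof -
  interpret M: finite_measure M by fact
  let ?T = "restrict_space lborel {0..2 * pi}"
  interpret T: finite_measure ?T
    by (rule finite_measureI) (simp add: emeasure_restrict_space)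
  interpret pair_sigma_finite ?T M ..
  have cm: "(\<lambda>t. cis t) \<in> borel_measurable ?T"
    by (rule measurable_restrict_space1) (simp add: borel_measurable_continuous_onI continuous_on_cis continuous_on_id)
  have pm[measurable]: "(\<lambda>(t, x). \<psi> (cis t * x)) \<in> borel_measurable (?T \<Otimes>\<^sub>M M)"
  proof -
    have [measurable]: "(\<lambda>p. cis (fst p)) \<in> borel_measurable (?T \<Otimes>\<^sub>M M)"
      by (rule measurable_compose[OF measurable_fst cm])
    have [measurable]: "(\<lambda>p. snd p) \<in> borel_measurable (?T \<Otimes>\<^sub>M M)"
      using measurable_snd[of ?T M] by (simp add: measurable_def sets sets_eq_imp_space_eq[OF sets])
    show ?thesis by (simp add: case_prod_beta)
  qed
  have ip: "integrable (?T \<Otimes>\<^sub>M M) (\<lambda>(t, x). \<psi> (cis t * x))"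
  proof -
    interpret P: finite_measure "?T \<Otimes>\<^sub>M M"
      by (rule finite_measure_pair_measure) (use T.finite_measure_axioms fin in auto)
    show ?thesis
      by (rule P.integrable_const_bound[where B=B]) (use B in auto)
  qed
  have TL: "(\<integral>t. h t \<partial>?T) = (LBINT t:{0..2 * pi}. h t)" for h :: "real \<Rightarrow> complex"
    unfolding set_lebesgue_integral_def by (rule integral_restrict_space) simp
  have "2 * pi * (\<integral>x. \<psi> x \<partial>M) = (\<integral>t. (\<integral>x. \<psi> x \<partial>M) \<partial>?T)"
    by (simp add: measure_restrict_space scaleR_conv_of_real)
  also have "\<dots> = (\<integral>t. (\<integral>x. \<psi> (cis t * x) \<partial>M) \<partial>?T)"
  proof (rule Bochner_Integration.integral_cong)
    fix t
    have "(\<integral>x. \<psi> x \<partial>M) = (\<integral>x. \<psi> x \<partial>distr M borel ((*) (cis t)))" by (simp add: inv)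
    also have "\<dots> = (\<integral>x. \<psi> (cis t * x) \<partial>M)"
      by (rule integral_distr) auto
    finally show "(\<integral>x. \<psi> x \<partial>M) = (\<integral>x. \<psi> (cis t * x) \<partial>M)" .
  qed simp
  also have "\<dots> = (\<integral>x. (\<integral>t. \<psi> (cis t * x) \<partial>?T) \<partial>M)"
    using Fubini_integral[OF ip] by simp
  also have "\<dots> = (\<integral>x. 2 * pi * circle_mean \<psi> 0 (cmod x) \<partial>M)"
    unfolding TL circle_mean_rotate[OF m B] ..
  also have "\<dots> = 2 * pi * (\<integral>x. circle_mean \<psi> 0 (cmod x) \<partial>M)" by simp
  finally show ?thesis by simp
qed

section \<open>Integration by parts\<close>

text \<open>
  The integral of the difference quotient vanishes by translation invariance, and the quotients are dominated thanks to the
  Lipschitz bound.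
\<close>

lemma integral_directional_derivative:
  fixes \<Psi> :: "complex \<Rightarrow> complex"
  assumes lip: "\<And>x y. cmod (\<Psi> x - \<Psi> y) \<le> L * cmod (x - y)"
    and d: "\<And>x. (\<Psi> has_derivative D x) (at x)"
    and supp: "\<And>x. r \<le> cmod x \<Longrightarrow> \<Psi> x = 0" and e: "cmod e = 1"
  shows "(\<integral>x. D x e \<partial>lborel) = 0"
proof -
  have c: "continuous_on UNIV \<Psi>"
    using d by (meson continuous_at_imp_continuous_on has_derivative_continuous)
  note i = continuous_compact_support_integrable[OF c supp]
  have m[measurable]: "\<Psi> \<in> borel_measurable borel" by (rule i(1))
  have L: "L \<ge> 0" using order_trans[OF norm_ge_zero lip[of 1 0]] by simp
  define h where "h n = inverse (real (Suc n))" for n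
  have h: "h n > 0" "h n \<le> 1" for n by (auto simp: h_def inverse_eq_divide)
  have hlim: "h \<longlonglongrightarrow> 0" unfolding h_def by (rule LIMSEQ_inverse_real_of_nat)
  define q where "q n x = (\<Psi> (x + h n *\<^sub>R e) - \<Psi> x) /\<^sub>R h n" for n x
  have lim: "(\<lambda>n. q n x) \<longlonglongrightarrow> D x e" for x
  proof -
    interpret D: bounded_linear "D x" using d has_derivative_bounded_linear by blast
    have "((\<lambda>y. (\<Psi> y - \<Psi> x - D x (y - x)) /\<^sub>R cmod (y - x)) \<longlongrightarrow> 0) (at x)"
      using d[of x] by (simp add: has_derivative_at_within)
    moreover have "filterlim (\<lambda>n. x + h n *\<^sub>R e) (at x) sequentially"
    proof -
      have "(\<lambda>n. x + h n *\<^sub>R e) \<longlonglongrightarrow> x + 0 *\<^sub>R e" by (intro tendsto_intros hlim)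
      then show ?thesis
        using h(1) e by (auto simp: filterlim_at less_imp_neq[symmetric] intro!: always_eventually)
    qed
    ultimately have "(\<lambda>n. (\<Psi> (x + h n *\<^sub>R e) - \<Psi> x - D x (h n *\<^sub>R e)) /\<^sub>R h n) \<longlonglongrightarrow> 0"
      using filterlim_compose[of _ "nhds 0" "at x" "\<lambda>n. x + h n *\<^sub>R e" sequentially] h(1) e
      by (fastforce simp: abs_of_pos)
    then have "(\<lambda>n. (\<Psi> (x + h n *\<^sub>R e) - \<Psi> x - D x (h n *\<^sub>R e)) /\<^sub>R h n + D x e) \<longlonglongrightarrow> 0 + D x e"
      by (intro tendsto_intros)
    moreover have "(\<Psi> (x + h n *\<^sub>R e) - \<Psi> x - D x (h n *\<^sub>R e)) /\<^sub>R h n + D x e = q n x" for n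
      using h(1)[of n] by (simp add: q_def D.scaleR scaleR_diff_right)
    ultimately show ?thesis by simp
  qed
  have "(\<lambda>n. \<integral>x. q n x \<partial>lborel) \<longlonglongrightarrow> (\<integral>x. D x e \<partial>lborel)"
  proof (rule integral_dominated_convergence[where w="\<lambda>x. L * indicator (cball 0 (r + 1)) x"])
    show qm[measurable]: "q n \<in> borel_measurable lborel" for n unfolding q_def by measurable
    show "(\<lambda>x. D x e) \<in> borel_measurable lborel"
      by (rule borel_measurable_LIMSEQ_metric[OF qm lim])
    show "AE x in lborel. (\<lambda>n. q n x) \<longlonglongrightarrow> D x e" using lim by simp
    show "AE x in lborel. norm (q n x) \<le> L * indicator (cball 0 (r + 1)) x" for n
    proof (rule AE_I2)
      fix x
      show "norm (q n x) \<le> L * indicator (cball 0 (r + 1)) x"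
      proof (cases "cmod x \<le> r + 1")
        case True
        have "cmod (\<Psi> (x + h n *\<^sub>R e) - \<Psi> x) \<le> L * h n"
          using lip[of "x + h n *\<^sub>R e" x] h(1)[of n] e by simp
        then have "inverse (h n) * cmod (\<Psi> (x + h n *\<^sub>R e) - \<Psi> x) \<le> inverse (h n) * (L * h n)"
          using h(1)[of n] by (intro mult_left_mono) auto
        moreover have "inverse (h n) * (L * h n) = L" using h(1)[of n] by simp
        ultimately show ?thesis using True h(1)[of n] by (simp only: q_def norm_scaleR) simp
      next
        case False
        have "cmod (h n *\<^sub>R e) \<le> 1" using h[of n] e by simp
        then have "cmod (x + h n *\<^sub>R e) \<ge> r"
          using False norm_triangle_ineq4[of "x + h n *\<^sub>R e" "h n *\<^sub>R e"] by simp
        then show ?thesis using False supp by (simp add: q_def)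
      qed
    qed
    show "integrable lborel (\<lambda>x. L * indicator (cball (0::complex) (r + 1)) x)"
      using emeasure_lborel_cball_finite[of "0::complex" "r + 1"] by simp
  qed
  moreover have "(\<integral>x. q n x \<partial>lborel) = 0" for n
  proof -
    have "integrable lborel (\<lambda>x. \<Psi> (x + h n *\<^sub>R e))"
      using i(2) lborel_integral_translate(2)[OF m, of "h n *\<^sub>R e"] by simp
    then show ?thesis
      using i(2) lborel_integral_translate(1)[OF m, of "h n *\<^sub>R e"] by (simp add: q_def)
  qed
  ultimately show ?thesis by (simp add: LIMSEQ_const_iff)
qed

lemma integral_partial_derivatives:
  fixes \<Psi> :: "complex \<Rightarrow> complex"
  assumes d: "\<And>x. (\<Psi> has_derivative D x) (at x)"
    and c: "continuous_on UNIV (\<lambda>x. D x 1)" "continuous_on UNIV (\<lambda>x. D x \<i>)"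
    and supp: "\<And>x. r \<le> cmod x \<Longrightarrow> \<Psi> x = 0"
  shows "(\<integral>x. D x 1 \<partial>lborel) = 0" "(\<integral>x. D x \<i> \<partial>lborel) = 0"
    and "integrable lborel (\<lambda>x. D x 1)" "integrable lborel (\<lambda>x. D x \<i>)"
proof -
  have D0: "D x h = 0" if "r + 1 \<le> cmod x" for x h
  proof -
    have "((\<lambda>_. 0) has_derivative (\<lambda>_. 0)) (at x)" by simp
    then have "(\<Psi> has_derivative (\<lambda>_. 0)) (at x)"
    proof (rule has_derivative_transform_within_open[where s="{y. r < cmod y}"])
      show "open {y::complex. r < cmod y}" by (intro open_Collect_less continuous_intros)
    qed (use that supp in auto)
    then show ?thesis using d has_derivative_unique by metis
  qed
  note i1 = continuous_compact_support_integrable[OF c(1) D0]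
    and i2 = continuous_compact_support_integrable[OF c(2) D0]
  show "integrable lborel (\<lambda>x. D x 1)" "integrable lborel (\<lambda>x. D x \<i>)" using i1(2) i2(2) by auto
  obtain B1 where B1: "\<And>x. cmod (D x 1) \<le> B1" using i1(4) by auto
  obtain B2 where B2: "\<And>x. cmod (D x \<i>) \<le> B2" using i2(4) by auto
  have on: "onorm (D x) \<le> B1 + B2" for x
  proof (rule onorm_le)
    fix h
    interpret bounded_linear "D x" using d has_derivative_bounded_linear by blast
    have "h = Re h *\<^sub>R 1 + Im h *\<^sub>R \<i>" by (simp add: complex_eq_iff)
    then have "D x h = Re h *\<^sub>R D x 1 + Im h *\<^sub>R D x \<i>" by (metis add scaleR)
    then have "cmod (D x h) \<le> \<bar>Re h\<bar> * cmod (D x 1) + \<bar>Im h\<bar> * cmod (D x \<i>)"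
      by (metis norm_triangle_ineq norm_scaleR)
    also have "\<dots> \<le> cmod h * B1 + cmod h * B2"
      by (intro add_mono mult_mono B1 B2 abs_Re_le_cmod abs_Im_le_cmod) auto
    finally show "cmod (D x h) \<le> (B1 + B2) * cmod h" by (simp add: algebra_simps)
  qed
  have lip: "cmod (\<Psi> x - \<Psi> y) \<le> (B1 + B2) * cmod (x - y)" for x y
    by (rule differentiable_bound[of UNIV \<Psi> D]) (use on d in auto)
  show "(\<integral>x. D x 1 \<partial>lborel) = 0" "(\<integral>x. D x \<i> \<partial>lborel) = 0"
    by (rule integral_directional_derivative[OF lip d supp]; simp)+
qed

section \<open>Green's formula\<close>

text \<open>
  The two sides of a circle: \<open>\<sigma> = 1\<close> is the inner one and \<open>\<sigma> = - 1\<close> the outer one.  The sign as a parameter lets one proof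
  serve both versions of Green's formula.
\<close>

definition side :: "real \<Rightarrow> complex \<Rightarrow> real \<Rightarrow> complex set"
  where "side \<sigma> p \<rho> = {x. \<sigma> * (\<rho>\<^sup>2 - (cmod (x - p))\<^sup>2) > 0}"

definition closed_side :: "real \<Rightarrow> complex \<Rightarrow> real \<Rightarrow> complex set"
  where "closed_side \<sigma> p \<rho> = {x. \<sigma> * (\<rho>\<^sup>2 - (cmod (x - p))\<^sup>2) \<ge> 0}"

text \<open>
  A weight concentrated, as \<open>n\<close> grows, on a thin shell on the side \<open>\<sigma>\<close> of the circle of radius \<open>\<rho>\<close>; \<open>s\<close> stands for \<open>|x - p|\<^sup>2\<close>.  It is
  twice the derivative, up to sign, of the cutoff \<open>smooth_step (n \<sigma> (\<rho>\<^sup>2 - s))\<close>.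
\<close>

definition shell_weight :: "real \<Rightarrow> real \<Rightarrow> nat \<Rightarrow> real \<Rightarrow> real"
  where "shell_weight \<sigma> \<rho> n s = 2 * real n * smooth_bump (real n * (\<sigma> * (\<rho>\<^sup>2 - s)))"

definition disk_area :: real where "disk_area = measure lborel (ball (0::complex) 1)"

lemma shell_weight_continuous: "continuous_on S (shell_weight \<sigma> \<rho> n)"
  unfolding shell_weight_def[abs_def]
  by (intro continuous_intros continuous_on_compose2[OF smooth_bump_continuous[of UNIV]]) auto

lemma shell_weight_nonneg: "shell_weight \<sigma> \<rho> n s \<ge> 0"
  by (simp add: shell_weight_def smooth_bump_nonneg)

lemma shell_weight_support:
  assumes "shell_weight \<sigma> \<rho> n s \<noteq> 0" "\<bar>\<sigma>\<bar> = 1"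
  shows "n > 0" "\<sigma> * (\<rho>\<^sup>2 - s) > 0" "\<bar>s - \<rho>\<^sup>2\<bar> \<le> 2 / real n"
proof -
  show n: "n > 0" using assms by (cases n) (auto simp: shell_weight_def)
  have b: "1 < real n * (\<sigma> * (\<rho>\<^sup>2 - s))" "real n * (\<sigma> * (\<rho>\<^sup>2 - s)) < 2"
  proof -
    have "smooth_bump (real n * (\<sigma> * (\<rho>\<^sup>2 - s))) \<noteq> 0" using assms(1) by (simp add: shell_weight_def)
    then have "\<not> (real n * (\<sigma> * (\<rho>\<^sup>2 - s)) \<le> 1 \<or> real n * (\<sigma> * (\<rho>\<^sup>2 - s)) \<ge> 2)"
      using smooth_bump_outside by blast
    then show "1 < real n * (\<sigma> * (\<rho>\<^sup>2 - s))" "real n * (\<sigma> * (\<rho>\<^sup>2 - s)) < 2" by linarith+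
  qed
  then show pos: "\<sigma> * (\<rho>\<^sup>2 - s) > 0" using n by (smt (verit) mult_nonneg_nonpos of_nat_0_le_iff)
  have "\<bar>s - \<rho>\<^sup>2\<bar> = \<sigma> * (\<rho>\<^sup>2 - s)" using pos assms(2) by (auto simp: abs_if split: if_splits)
  with b(2) have "real n * \<bar>s - \<rho>\<^sup>2\<bar> \<le> 2" by simp
  then show "\<bar>s - \<rho>\<^sup>2\<bar> \<le> 2 / real n" using n by (simp add: le_divide_eq mult.commute)
qed

lemma disk_area_pos: "disk_area > 0"
  unfolding disk_area_def using content_ball_pos[of 1 "0::complex"] by simp

text \<open>
  Twice the area of the disk.  With \<open>G\<close> a primitive of minus half the weight that vanishes for large \<open>s\<close>, the function
  \<open>cnj x G(|x|\<^sup>2)\<close> has compact support and its derivative \<open>\<partial>\<^sub>1 + \<i> \<partial>\<^sub>2\<close> is \<open>2 G - s\<close> times the weight; this integrates to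
  zero, and \<open>G\<close> tends to the indicator of the disk.
\<close>

lemma shell_weight_mass:
  assumes \<sigma>: "\<sigma> = 1 \<or> \<sigma> = - 1" and \<rho>: "\<rho> > 0"
  shows "(\<lambda>n. \<integral>x. shell_weight \<sigma> \<rho> n ((cmod x)\<^sup>2) * (cmod x)\<^sup>2 \<partial>(lborel :: complex measure))
      \<longlonglongrightarrow> 2 * disk_area * \<rho>\<^sup>2"
proof -
  define G where "G n s = (1 - \<sigma>) / 2 + \<sigma> * smooth_step (real n * (\<sigma> * (\<rho>\<^sup>2 - s)))" for n s
  define M where "M = \<rho> + 2"
  have bound: "2 + \<rho>\<^sup>2 \<le> s" if "M \<le> t" "s = t\<^sup>2" for s t
  proof -
    have "M\<^sup>2 \<le> t\<^sup>2" using that(1) \<rho> by (intro power_mono) (auto simp: M_def)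
    moreover have "M\<^sup>2 = \<rho>\<^sup>2 + 4 * \<rho> + 4" by (simp add: M_def power2_eq_square algebra_simps)
    ultimately show ?thesis using \<rho> that by simp
  qed
  have G0: "G n s = 0" if "n > 0" "s \<ge> 2 + \<rho>\<^sup>2" for n s
  proof -
    have "real n * (s - \<rho>\<^sup>2) \<ge> 1 * 2" using that by (intro mult_mono) auto
    moreover have "real n * (\<rho>\<^sup>2 - s) \<le> 0" using that by (intro mult_nonneg_nonpos) auto
    ultimately show ?thesis using \<sigma> by (auto simp: G_def smooth_step_eq)
  qed
  have GD: "(G n has_real_derivative - (real n * smooth_bump (real n * (\<sigma> * (\<rho>\<^sup>2 - s))))) (at s)" for n s
    unfolding G_def[abs_def] using \<sigma>
    by (auto intro!: derivative_eq_intros DERIV_chain2[OF smooth_step_derivative])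
  have G1: "0 \<le> G n s" "G n s \<le> 1" for n s
    using \<sigma> smooth_step_bounds[of "real n * (\<sigma> * (\<rho>\<^sup>2 - s))"] by (auto simp: G_def)
  have Gc: "continuous_on UNIV (G n)" for n
    using GD by (meson DERIV_isCont continuous_at_imp_continuous_on)
  have cc: "continuous_on UNIV (\<lambda>x::complex. G n ((cmod x)\<^sup>2))"
    "continuous_on UNIV (\<lambda>x::complex. shell_weight \<sigma> \<rho> n ((cmod x)\<^sup>2))" for n
    by (rule continuous_on_compose2[OF Gc] continuous_on_compose2[OF shell_weight_continuous[of UNIV]];
        auto intro!: continuous_intros)+
  have eq: "(\<integral>x. shell_weight \<sigma> \<rho> n ((cmod x)\<^sup>2) * (cmod x)\<^sup>2 \<partial>(lborel :: complex measure))
      = (\<integral>x. 2 * G n ((cmod x)\<^sup>2) \<partial>(lborel :: complex measure))" if n: "n > 0" for n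
  proof -
    define w where "w x = shell_weight \<sigma> \<rho> n ((cmod x)\<^sup>2) / 2" for x :: complex
    define D where "D x h = cnj x * complex_of_real ((2 * Re x * Re h + 2 * Im x * Im h) * (- w x))
        + cnj h * complex_of_real (G n ((cmod x)\<^sup>2))" for x h
    have d: "((\<lambda>x. cnj x * complex_of_real (G n ((cmod x)\<^sup>2))) has_derivative D x) (at x)" for x
    proof -
      have "((\<lambda>z. G n ((cmod (z - 0))\<^sup>2)) has_derivative
          (\<lambda>h. (2 * Re (x - 0) * Re h + 2 * Im (x - 0) * Im h) * - (real n * smooth_bump (real n * (\<sigma> * (\<rho>\<^sup>2 - (cmod (x - 0))\<^sup>2)))))) (at x)"
        by (rule has_derivative_radial) (rule GD)
      then have "((\<lambda>z. G n ((cmod z)\<^sup>2)) has_derivative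
          (\<lambda>h. (2 * Re x * Re h + 2 * Im x * Im h) * (- w x))) (at x)"
        by (simp add: w_def shell_weight_def)
      then have "((\<lambda>x. cnj x * complex_of_real (G n ((cmod x)\<^sup>2))) has_derivative
         (\<lambda>h. cnj x * complex_of_real ((2 * Re x * Re h + 2 * Im x * Im h) * (- w x))
          + cnj h * complex_of_real (G n ((cmod x)\<^sup>2)))) (at x)"
        by (intro has_derivative_mult has_derivative_of_real has_derivative_cnj has_derivative_ident)
      then show ?thesis by (simp add: D_def[abs_def])
    qed
    have wc: "continuous_on UNIV w" unfolding w_def using cc by (intro continuous_intros) auto
    have D1: "continuous_on UNIV (\<lambda>x. D x 1)" "continuous_on UNIV (\<lambda>x. D x \<i>)"
      unfolding D_def using wc cc by (auto intro!: continuous_intros)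
    note I = integral_partial_derivatives[OF d D1, of M]
    have supp: "cnj x * complex_of_real (G n ((cmod x)\<^sup>2)) = 0" if "M \<le> cmod x" for x
      using G0[OF n] bound[OF that] by simp
    have "D x 1 + \<i> * D x \<i> = complex_of_real (2 * G n ((cmod x)\<^sup>2) - shell_weight \<sigma> \<rho> n ((cmod x)\<^sup>2) * (cmod x)\<^sup>2)" for x
      unfolding cmod_power2 D_def w_def by (simp add: complex_eq_iff power2_eq_square field_simps)
    then have "(\<integral>x. complex_of_real (2 * G n ((cmod x)\<^sup>2) - shell_weight \<sigma> \<rho> n ((cmod x)\<^sup>2) * (cmod x)\<^sup>2) \<partial>lborel)
        = (\<integral>x. D x 1 + \<i> * D x \<i> \<partial>lborel)" by simp
    also have "\<dots> = 0" using I supp by simp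
    finally have z: "(\<integral>x. 2 * G n ((cmod x)\<^sup>2) - shell_weight \<sigma> \<rho> n ((cmod x)\<^sup>2) * (cmod x)\<^sup>2 \<partial>(lborel :: complex measure)) = 0"
      by (simp only: integral_complex_of_real of_real_eq_0_iff)
    have iG: "integrable lborel (\<lambda>x::complex. G n ((cmod x)\<^sup>2))"
      by (rule continuous_compact_support_integrable(2)[OF cc(1), of M]) (use G0[OF n] bound in auto)
    have iw: "integrable lborel (\<lambda>x::complex. shell_weight \<sigma> \<rho> n ((cmod x)\<^sup>2) * (cmod x)\<^sup>2)"
    proof (rule continuous_compact_support_integrable(2)[of _ M])
      show "continuous_on UNIV (\<lambda>x::complex. shell_weight \<sigma> \<rho> n ((cmod x)\<^sup>2) * (cmod x)\<^sup>2)"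
        using cc(2) by (intro continuous_intros)
      fix x :: complex assume x: "M \<le> cmod x"
      have "shell_weight \<sigma> \<rho> n ((cmod x)\<^sup>2) = 0"
      proof (rule ccontr)
        assume a: "shell_weight \<sigma> \<rho> n ((cmod x)\<^sup>2) \<noteq> 0"
        have "real n * ((cmod x)\<^sup>2 - \<rho>\<^sup>2) \<ge> 1 * 2" "real n * (\<rho>\<^sup>2 - (cmod x)\<^sup>2) \<le> 0"
          using bound[OF x refl] n by (intro mult_mono mult_nonneg_nonpos; simp)+
        then have "smooth_bump (real n * (\<sigma> * (\<rho>\<^sup>2 - (cmod x)\<^sup>2))) = 0"
          using \<sigma> by (auto intro!: smooth_bump_outside)
        then show False using a by (simp add: shell_weight_def)
      qed
      then show "shell_weight \<sigma> \<rho> n ((cmod x)\<^sup>2) * (cmod x)\<^sup>2 = 0" by simp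
    qed
    show ?thesis using z iG iw by simp
  qed
  have "(\<lambda>n. \<integral>x. 2 * G (Suc n) ((cmod x)\<^sup>2) \<partial>(lborel :: complex measure)) \<longlonglongrightarrow> (\<integral>x. 2 * indicator (ball 0 \<rho>) x \<partial>(lborel :: complex measure))"
  proof (rule integral_dominated_convergence[where w="\<lambda>x. 2 * indicator (cball 0 M) x"])
    show "(\<lambda>x::complex. 2 * G (Suc n) ((cmod x)\<^sup>2)) \<in> borel_measurable lborel" for n
      using borel_measurable_continuous_onI[OF cc(1)] by simp
    show "integrable lborel (\<lambda>x. 2 * indicator (cball (0::complex) M) x :: real)"
      using emeasure_lborel_cball_finite[of "0::complex" M] by simp
    show "AE x in lborel. (\<lambda>n. 2 * G (Suc n) ((cmod x)\<^sup>2)) \<longlonglongrightarrow> 2 * indicator (ball 0 \<rho>) (x::complex)"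
    proof -
      have "sphere (0::complex) \<rho> \<in> null_sets lborel"
        using negligible_sphere[of "0::complex" \<rho>] by (simp add: negligible_iff_null_sets null_sets_completion_iff)
      then have "AE x in lborel. x \<notin> sphere (0::complex) \<rho>" by (rule AE_not_in)
      then show ?thesis
      proof eventually_elim
        fix x :: complex assume x: "x \<notin> sphere 0 \<rho>"
        have big: "filterlim (\<lambda>n. real n * c) at_top sequentially" if "c > 0" for c
          using filterlim_at_top_mult_tendsto_pos[OF tendsto_const that filterlim_real_sequentially] .
        have ev: "\<forall>\<^sub>F n in sequentially. smooth_step (real n * c) = 1" if "c > 0" for c
          using filterlim_at_top[THEN iffD1, OF big[OF that], rule_format, of 2]
          by eventually_elim (simp add: smooth_step_eq)
        have neg: "smooth_step (real n * c) = 0" if "c \<le> 0" for c n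
          using that by (intro smooth_step_eq(1)) (smt (verit) mult_nonneg_nonpos of_nat_0_le_iff)
        have "\<forall>\<^sub>F n in sequentially. 2 * G n ((cmod x)\<^sup>2) = 2 * indicator (ball 0 \<rho>) x"
        proof (cases "cmod x < \<rho>")
          case True
          then have "\<rho>\<^sup>2 - (cmod x)\<^sup>2 > 0" using power_strict_mono[of "cmod x" \<rho> 2] by simp
          then show ?thesis using \<sigma> ev[of "\<rho>\<^sup>2 - (cmod x)\<^sup>2"] neg[of "- (\<rho>\<^sup>2 - (cmod x)\<^sup>2)"] True
            by (auto simp: G_def elim!: eventually_mono)
        next
          case False
          then have "cmod x > \<rho>" using x by simp
          then have "(cmod x)\<^sup>2 - \<rho>\<^sup>2 > 0" using power_strict_mono[of \<rho> "cmod x" 2] \<rho> by simp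
          then show ?thesis using \<sigma> ev[of "(cmod x)\<^sup>2 - \<rho>\<^sup>2"] neg[of "\<rho>\<^sup>2 - (cmod x)\<^sup>2"] False
            by (auto simp: G_def elim!: eventually_mono)
        qed
        then show "(\<lambda>n. 2 * G (Suc n) ((cmod x)\<^sup>2)) \<longlonglongrightarrow> 2 * indicator (ball 0 \<rho>) x"
          by (intro tendsto_eventually) (rule eventually_sequentially_Suc[THEN iffD2])
      qed
    qed
    show "AE x in lborel. norm (2 * G (Suc n) ((cmod (x::complex))\<^sup>2)) \<le> 2 * indicator (cball 0 M) x" for n
    proof (rule AE_I2)
      fix x :: complex
      show "norm (2 * G (Suc n) ((cmod x)\<^sup>2)) \<le> 2 * indicator (cball 0 M) x"
      proof (cases "cmod x \<le> M")
        case True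
        then show ?thesis using G1[of "Suc n" "(cmod x)\<^sup>2"] by simp
      next
        case False
        then show ?thesis using G0[of "Suc n" "(cmod x)\<^sup>2"] bound[of "cmod x"] by simp
      qed
    qed
    show "(\<lambda>x::complex. 2 * indicator (ball 0 \<rho>) x :: real) \<in> borel_measurable lborel"
      by (intro borel_measurable_times borel_measurable_indicator) auto
  qed
  moreover have "(\<integral>x. 2 * indicator (ball 0 \<rho>) x \<partial>(lborel :: complex measure)) = 2 * disk_area * \<rho>\<^sup>2"
    using content_ball_conv_unit_ball[of \<rho> "0::complex"] \<rho> by (simp add: disk_area_def)
  ultimately have "(\<lambda>n. \<integral>x. 2 * G (Suc n) ((cmod x)\<^sup>2) \<partial>(lborel :: complex measure)) \<longlonglongrightarrow> 2 * disk_area * \<rho>\<^sup>2"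
    by (simp only:)
  then have "(\<lambda>n. \<integral>x. shell_weight \<sigma> \<rho> (Suc n) ((cmod x)\<^sup>2) * (cmod x)\<^sup>2 \<partial>(lborel :: complex measure)) \<longlonglongrightarrow> 2 * disk_area * \<rho>\<^sup>2"
    by (simp only: eq[OF zero_less_Suc])
  then show ?thesis by (rule LIMSEQ_imp_Suc)
qed

lemma cis_borel_measurable [measurable]: "cis \<in> borel_measurable borel"
  by (simp add: borel_measurable_continuous_onI continuous_on_cis continuous_on_id)

lemma circle_mean_measurable [measurable]:
  assumes [measurable]: "\<psi> \<in> borel_measurable borel"
  shows "circle_mean \<psi> p \<in> borel_measurable borel"
  unfolding circle_mean_def[abs_def] set_lebesgue_integral_def by measurable

lemma circle_integrable:
  fixes \<psi> :: "complex \<Rightarrow> complex"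
  assumes [measurable]: "\<psi> \<in> borel_measurable borel" and B: "\<And>x. norm (\<psi> x) \<le> B"
  shows "set_integrable lborel {0..2 * pi} (\<lambda>t. \<psi> (p + complex_of_real r * cis t))"
proof -
  have "integrable lborel (\<lambda>t. B * indicator {0..2 * pi} t :: real)"
    by (intro integrable_mult_right integrable_real_indicator) (auto simp: emeasure_lborel_Icc_eq)
  note i = this
  show ?thesis
    unfolding set_integrable_def
  proof (rule Bochner_Integration.integrable_bound[OF i])
    show "(\<lambda>t. indicat_real {0..2 * pi} t *\<^sub>R \<psi> (p + complex_of_real r * cis t)) \<in> borel_measurable lborel"
      by measurable
  qed (use B in \<open>auto simp: indicator_def intro: order_trans[OF B abs_ge_self]\<close>)
qed

lemma circle_mean_diff_le:
  assumes m: "\<psi> \<in> borel_measurable borel" and B: "\<And>x. norm (\<psi> x) \<le> B"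
    and le: "\<And>t. norm (\<psi> (p + complex_of_real a * cis t) - \<psi> (p + complex_of_real b * cis t)) \<le> e"
  shows "norm (circle_mean \<psi> p a - circle_mean \<psi> p b) \<le> e"
proof -
  note i = circle_integrable[OF m B]
  have "circle_mean \<psi> p a - circle_mean \<psi> p b =
      (LBINT t:{0..2 * pi}. \<psi> (p + complex_of_real a * cis t) - \<psi> (p + complex_of_real b * cis t)) / (2 * pi)"
    unfolding circle_mean_def by (subst set_integral_diff(2)[OF i i]) (simp add: diff_divide_distrib)
  also have "norm \<dots> = norm (LBINT t:{0..2 * pi}. \<psi> (p + complex_of_real a * cis t) - \<psi> (p + complex_of_real b * cis t)) / (2 * pi)"
    by (simp add: norm_divide norm_mult)
  also have "norm (LBINT t:{0..2 * pi}. \<psi> (p + complex_of_real a * cis t) - \<psi> (p + complex_of_real b * cis t))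
      \<le> (LBINT t:{0..2 * pi}. norm (\<psi> (p + complex_of_real a * cis t) - \<psi> (p + complex_of_real b * cis t)))"
    by (rule set_integral_norm_bound) (rule set_integral_diff(1)[OF i i])
  also have "\<dots> \<le> (LBINT t:{0..2 * pi}. e)"
  proof (rule set_integral_mono)
    show "set_integrable lborel {0..2 * pi} (\<lambda>t. norm (\<psi> (p + complex_of_real a * cis t) - \<psi> (p + complex_of_real b * cis t)))"
      by (rule set_integrable_norm) (rule set_integral_diff(1)[OF i i])
    show "set_integrable lborel {0..2 * pi} (\<lambda>t. e)"
      by (simp add: set_integrable_def emeasure_lborel_Icc_eq)
  qed (rule le)
  also have "\<dots> = 2 * pi * e"
    by (simp add: set_lebesgue_integral_def)
  finally show ?thesis by (simp add: divide_right_mono)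
qed

text \<open>
  The weight is radial, so \<open>Q\<close> may be replaced by its means over concentric circles; these converge uniformly to the mean over the
  limiting circle as the shell shrinks.
\<close>

lemma shell_average_tendsto:
  fixes Q :: "complex \<Rightarrow> complex"
  assumes \<sigma>: "\<sigma> = 1 \<or> \<sigma> = - 1" and \<rho>: "\<rho> > 0"
    and m[measurable]: "Q \<in> borel_measurable borel"
    and c: "continuous_on (closed_side \<sigma> 0 \<rho>) Q"
  shows "(\<lambda>n. \<integral>y. shell_weight \<sigma> \<rho> n ((cmod y)\<^sup>2) *\<^sub>R Q y \<partial>lborel)
      \<longlonglongrightarrow> 2 * disk_area * circle_mean Q 0 \<rho>"
proof -
  have \<sigma>1: "\<bar>\<sigma>\<bar> = 1" using \<sigma> by auto
  define K where "K = closed_side \<sigma> 0 \<rho> \<inter> {y. \<rho> / 2 \<le> cmod y} \<inter> cball 0 (2 * \<rho>)"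
  have "closed (closed_side \<sigma> 0 \<rho>)"
    unfolding closed_side_def by (intro closed_Collect_le continuous_intros)
  moreover have "closed {y::complex. \<rho> / 2 \<le> cmod y}" by (intro closed_Collect_le continuous_intros)
  ultimately have K: "compact K" unfolding K_def by (intro closed_Int_compact closed_Int compact_cball)
  have Km[measurable]: "K \<in> sets borel" using K by (simp add: borel_compact)
  \<comment> \<open>Restricted to a compact half-shell and divided by \<open>|y|\<^sup>2\<close>, as the mass is known for the weight times \<open>|y|\<^sup>2\<close>.\<close>
  define Q' where "Q' y = indicator K y *\<^sub>R (Q y / complex_of_real ((cmod y)\<^sup>2))" for y
  have Q'm[measurable]: "Q' \<in> borel_measurable borel" unfolding Q'_def[abs_def] by measurable
  have Q'c: "continuous_on K Q'"
  proof -
    have "continuous_on K (\<lambda>y. Q y / complex_of_real ((cmod y)\<^sup>2))"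
      using c \<rho> by (intro continuous_intros continuous_on_subset[OF c]) (auto simp: K_def)
    then show ?thesis by (rule continuous_on_eq) (simp add: Q'_def)
  qed
  obtain B where B: "\<And>y. norm (Q' y) \<le> B" "B \<ge> 0"
  proof -
    obtain B where "\<forall>y\<in>Q' ` K. norm y \<le> B"
      using compact_imp_bounded[OF compact_continuous_image[OF Q'c K]] bounded_iff by blast
    then have "norm (Q' y) \<le> \<bar>B\<bar>" for y
      by (cases "y \<in> K") (force simp: Q'_def)+
    then show ?thesis using that[of "\<bar>B\<bar>"] by auto
  qed
  define \<Omega> where "\<Omega> n y = shell_weight \<sigma> \<rho> n ((cmod y)\<^sup>2) * (cmod y)\<^sup>2" for n and y :: complex
  have \<Omega>0: "\<Omega> n y \<ge> 0" for n y by (simp add: \<Omega>_def shell_weight_nonneg)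
  have \<Omega>m[measurable]: "\<Omega> n \<in> borel_measurable borel" for n
    unfolding \<Omega>_def[abs_def]
    by (intro borel_measurable_continuous_onI continuous_intros continuous_on_compose2[OF shell_weight_continuous[of UNIV]]) auto
  have mass: "(\<lambda>n. \<integral>y. \<Omega> n y \<partial>lborel) \<longlonglongrightarrow> 2 * disk_area * \<rho>\<^sup>2"
    unfolding \<Omega>_def by (rule shell_weight_mass[OF \<sigma> \<rho>])
  have supp: "y \<in> K \<and> \<bar>cmod y - \<rho>\<bar> \<le> 2 / (real n * \<rho>) \<and> y \<noteq> 0"
    if y: "shell_weight \<sigma> \<rho> n ((cmod y)\<^sup>2) \<noteq> 0" and n: "2 / real n \<le> \<rho>\<^sup>2 / 2" for n y
  proof -
    note s = shell_weight_support[OF y \<sigma>1]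
    have l: "(cmod y)\<^sup>2 \<ge> (\<rho> / 2)\<^sup>2" "(cmod y)\<^sup>2 \<le> (2 * \<rho>)\<^sup>2"
      using s(3) n \<rho> by (simp_all add: power_divide power_mult_distrib abs_le_iff)
    then have "\<rho> / 2 \<le> cmod y" "cmod y \<le> 2 * \<rho>"
      using \<rho> by (meson norm_ge_zero power2_le_imp_le zero_le_mult_iff less_imp_le zero_le_numeral)+
    moreover have "\<bar>cmod y - \<rho>\<bar> \<le> 2 / (real n * \<rho>)"
    proof -
      have "\<bar>cmod y - \<rho>\<bar> * \<rho> \<le> \<bar>cmod y - \<rho>\<bar> * (cmod y + \<rho>)" by (intro mult_left_mono) auto
      also have "\<dots> = \<bar>(cmod y)\<^sup>2 - \<rho>\<^sup>2\<bar>"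
        using \<rho> by (simp add: power2_eq_square square_diff_square_factored abs_mult mult.commute)
      finally have "\<bar>cmod y - \<rho>\<bar> * \<rho> \<le> 2 / real n" using s(3) by linarith
      then show ?thesis using s(1) \<rho> by (simp add: field_simps)
    qed
    ultimately show ?thesis using s(2) \<rho> by (auto simp: K_def closed_side_def)
  qed
  have evn: "\<forall>\<^sub>F n in sequentially. 2 / real n \<le> e" if "e > 0" for e
  proof -
    have "(\<lambda>n. 2 / real n) \<longlonglongrightarrow> 0" by (rule lim_const_over_n)
    then have "\<forall>\<^sub>F n in sequentially. 2 / real n < e" using that by (rule order_tendstoD)
    then show ?thesis by eventually_elim simp
  qed
  have i\<Omega>: "integrable lborel (\<Omega> n)" if n: "2 / real n \<le> \<rho>\<^sup>2 / 2" for n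
  proof (rule continuous_compact_support_integrable(2)[of _ "2 * \<rho> + 1"])
    show "continuous_on UNIV (\<Omega> n)" unfolding \<Omega>_def[abs_def]
      by (intro continuous_intros continuous_on_compose2[OF shell_weight_continuous[of UNIV]]) auto
    show "\<Omega> n y = 0" if "2 * \<rho> + 1 \<le> cmod y" for y
      using supp[OF _ n, of y] that by (auto simp: \<Omega>_def K_def)
  qed
  define L where "L = circle_mean Q' 0 \<rho>"
  have cmb: "norm (circle_mean Q' 0 r) \<le> B" for r
  proof -
    have "norm (LBINT t:{0..2 * pi}. Q' (0 + complex_of_real r * cis t)) \<le> (LBINT t:{0..2 * pi}. norm (Q' (0 + complex_of_real r * cis t)))"
      by (rule set_integral_norm_bound) (rule circle_integrable[OF Q'm B(1)])
    also have "\<dots> \<le> (LBINT t:{0..2 * pi}. B)"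
    proof (rule set_integral_mono)
      show "set_integrable lborel {0..2 * pi} (\<lambda>t. norm (Q' (0 + complex_of_real r * cis t)))"
        by (rule set_integrable_norm) (rule circle_integrable[OF Q'm B(1)])
      show "set_integrable lborel {0..2 * pi} (\<lambda>t. B)"
        by (simp add: set_integrable_def emeasure_lborel_Icc_eq)
    qed (rule B(1))
    also have "\<dots> = 2 * pi * B" by (simp add: set_lebesgue_integral_def)
    finally show ?thesis by (simp add: circle_mean_def norm_divide norm_mult divide_le_eq mult.commute)
  qed
  have avg: "(\<integral>y. shell_weight \<sigma> \<rho> n ((cmod y)\<^sup>2) *\<^sub>R Q y \<partial>lborel) = (\<integral>y. \<Omega> n y *\<^sub>R circle_mean Q' 0 (cmod y) \<partial>lborel)"
    if n: "2 / real n \<le> \<rho>\<^sup>2 / 2" for n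
  proof -
    define M where "M = density lborel (\<lambda>y. ennreal (\<Omega> n y))"
    have "(\<integral>y. shell_weight \<sigma> \<rho> n ((cmod y)\<^sup>2) *\<^sub>R Q y \<partial>lborel) = (\<integral>y. \<Omega> n y *\<^sub>R Q' y \<partial>lborel)"
    proof (rule Bochner_Integration.integral_cong)
      fix y
      show "shell_weight \<sigma> \<rho> n ((cmod y)\<^sup>2) *\<^sub>R Q y = \<Omega> n y *\<^sub>R Q' y"
        using supp[OF _ n, of y]
        by (cases "shell_weight \<sigma> \<rho> n ((cmod y)\<^sup>2) = 0") (auto simp: \<Omega>_def Q'_def scaleR_conv_of_real)
    qed simp
    also have "\<dots> = (\<integral>y. Q' y \<partial>M)"
      unfolding M_def by (rule integral_density[symmetric]) (use \<Omega>0 in auto)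
    also have "\<dots> = (\<integral>y. circle_mean Q' 0 (cmod y) \<partial>M)"
    proof (rule rotation_average[OF _ _ _ Q'm B(1)])
      show "finite_measure M"
      proof (rule finite_measureI)
        have "emeasure M (space M) = (\<integral>\<^sup>+y. ennreal (\<Omega> n y) \<partial>lborel)"
          by (simp add: M_def emeasure_density)
        also have "\<dots> = ennreal (\<integral>y. \<Omega> n y \<partial>lborel)"
          by (rule nn_integral_eq_integral[OF i\<Omega>[OF n]]) (simp add: \<Omega>0)
        finally show "emeasure M (space M) \<noteq> \<infinity>" by simp
      qed
      show "sets M = sets borel" by (simp add: M_def)
      fix c :: complex assume c: "cmod c = 1"
      have inv: "\<Omega> n y = \<Omega> n (c * y)" for y by (simp add: \<Omega>_def norm_mult c)
      have "distr M borel ((*) c) = distr (density lborel (\<lambda>y. ennreal (\<Omega> n (c * y)))) borel ((*) c)"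
        unfolding M_def using inv by simp
      also have "\<dots> = density (distr lborel borel ((*) c)) (\<lambda>y. ennreal (\<Omega> n y))"
        by (rule density_distr[symmetric]) auto
      also have "\<dots> = M" by (simp add: lborel_distr_rotation c M_def)
      finally show "distr M borel ((*) c) = M" .
    qed
    also have "\<dots> = (\<integral>y. \<Omega> n y *\<^sub>R circle_mean Q' 0 (cmod y) \<partial>lborel)"
      unfolding M_def by (rule integral_density) (use \<Omega>0 in auto)
    finally show ?thesis .
  qed
  have icm: "integrable lborel (\<lambda>y. \<Omega> n y *\<^sub>R circle_mean Q' 0 (cmod y))" if n: "2 / real n \<le> \<rho>\<^sup>2 / 2" for n
  proof (rule Bochner_Integration.integrable_bound[OF integrable_mult_right[OF i\<Omega>[OF n], of B]])
    show "AE y in lborel. norm (\<Omega> n y *\<^sub>R circle_mean Q' 0 (cmod y)) \<le> norm (B * \<Omega> n y)"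
      using cmb \<Omega>0 B(2) by (auto simp: abs_mult mult.commute[of B] intro!: mult_left_mono)
  qed measurable
  have diff0: "(\<lambda>n. (\<integral>y. \<Omega> n y *\<^sub>R circle_mean Q' 0 (cmod y) \<partial>lborel) - (\<integral>y. \<Omega> n y \<partial>lborel) *\<^sub>R L) \<longlonglongrightarrow> 0"
  proof (rule tendstoI)
    fix e :: real assume e: "e > 0"
    define C where "C = 2 * disk_area * \<rho>\<^sup>2 + 1"
    have C: "C > 0" using disk_area_pos by (simp add: C_def add_nonneg_pos)
    have ev1: "\<forall>\<^sub>F n in sequentially. (\<integral>y. \<Omega> n y \<partial>lborel) < C"
      using order_tendstoD(2)[OF mass, of C] by (simp add: C_def)
    define e' where "e' = e / (2 * C)"
    have e': "e' > 0" using e C by (simp add: e'_def)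
    obtain d where d: "d > 0" "\<And>x y. x \<in> K \<Longrightarrow> y \<in> K \<Longrightarrow> dist y x < d \<Longrightarrow> dist (Q' y) (Q' x) < e'"
      using compact_uniformly_continuous[OF Q'c K] e' unfolding uniformly_continuous_on_def by metis
    have ev2: "\<forall>\<^sub>F n in sequentially. 2 / real n \<le> \<rho>\<^sup>2 / 2" using \<rho> by (intro evn) simp
    have ev3: "\<forall>\<^sub>F n in sequentially. 2 / real n \<le> \<rho> * d / 2" using \<rho> d by (intro evn) simp
    show "\<forall>\<^sub>F n in sequentially. dist ((\<integral>y. \<Omega> n y *\<^sub>R circle_mean Q' 0 (cmod y) \<partial>lborel) - (\<integral>y. \<Omega> n y \<partial>lborel) *\<^sub>R L) 0 < e"
      using ev1 ev2 ev3
    proof eventually_elim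
      fix n assume n: "(\<integral>y. \<Omega> n y \<partial>lborel) < C" "2 / real n \<le> \<rho>\<^sup>2 / 2" "2 / real n \<le> \<rho> * d / 2"
      have pt: "norm (\<Omega> n y *\<^sub>R circle_mean Q' 0 (cmod y) - \<Omega> n y *\<^sub>R L) \<le> \<Omega> n y * e'" for y
      proof (cases "shell_weight \<sigma> \<rho> n ((cmod y)\<^sup>2) = 0")
        case False
        note s = supp[OF False n(2)]
        have "2 / (real n * \<rho>) \<le> d / 2"
          using divide_right_mono[OF n(3), of \<rho>] \<rho> by simp
        then have close: "\<bar>cmod y - \<rho>\<bar> < d" using s d(1) by linarith
        have "norm (circle_mean Q' 0 (cmod y) - L) \<le> e'"
          unfolding L_def
        proof (rule circle_mean_diff_le[OF Q'm B(1)])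
          fix t
          have "0 + complex_of_real (cmod y) * cis t \<in> K" "0 + complex_of_real \<rho> * cis t \<in> K"
            using s \<rho> by (auto simp: K_def closed_side_def norm_mult)
          moreover have "dist (0 + complex_of_real (cmod y) * cis t) (0 + complex_of_real \<rho> * cis t) < d"
            using close by (simp add: dist_norm norm_mult flip: left_diff_distrib of_real_diff)
          ultimately show "norm (Q' (0 + complex_of_real (cmod y) * cis t) - Q' (0 + complex_of_real \<rho> * cis t)) \<le> e'"
            using d(2) by (simp add: dist_norm less_imp_le)
        qed
        then show ?thesis
          using \<Omega>0[of n y] by (simp add: mult_left_mono flip: scaleR_diff_right)
      qed (simp add: \<Omega>_def)
      have "norm ((\<integral>y. \<Omega> n y *\<^sub>R circle_mean Q' 0 (cmod y) \<partial>lborel) - (\<integral>y. \<Omega> n y \<partial>lborel) *\<^sub>R L)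
          = norm (\<integral>y. \<Omega> n y *\<^sub>R circle_mean Q' 0 (cmod y) - \<Omega> n y *\<^sub>R L \<partial>lborel)"
        using icm[OF n(2)] i\<Omega>[OF n(2)] by simp
      also have "\<dots> \<le> (\<integral>y. norm (\<Omega> n y *\<^sub>R circle_mean Q' 0 (cmod y) - \<Omega> n y *\<^sub>R L) \<partial>lborel)"
        by (rule integral_norm_bound)
      also have "\<dots> \<le> (\<integral>y. \<Omega> n y * e' \<partial>lborel)"
        using icm[OF n(2)] i\<Omega>[OF n(2)] pt by (intro integral_mono) auto
      also have "\<dots> = (\<integral>y. \<Omega> n y \<partial>lborel) * e'" by simp
      also have "\<dots> \<le> C * e'" using n(1) e' by (intro mult_right_mono) auto
      also have "\<dots> < e" using e C by (simp add: e'_def)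
      finally show "dist ((\<integral>y. \<Omega> n y *\<^sub>R circle_mean Q' 0 (cmod y) \<partial>lborel) - (\<integral>y. \<Omega> n y \<partial>lborel) *\<^sub>R L) 0 < e"
        by simp
    qed
  qed
  have "(\<lambda>n. ((\<integral>y. \<Omega> n y *\<^sub>R circle_mean Q' 0 (cmod y) \<partial>lborel) - (\<integral>y. \<Omega> n y \<partial>lborel) *\<^sub>R L) + (\<integral>y. \<Omega> n y \<partial>lborel) *\<^sub>R L)
     \<longlonglongrightarrow> 0 + (2 * disk_area * \<rho>\<^sup>2) *\<^sub>R L"
    by (intro tendsto_add diff0 tendsto_scaleR mass tendsto_const)
  then have "(\<lambda>n. \<integral>y. \<Omega> n y *\<^sub>R circle_mean Q' 0 (cmod y) \<partial>lborel) \<longlonglongrightarrow> (2 * disk_area * \<rho>\<^sup>2) *\<^sub>R L" by simp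
  moreover have "\<forall>\<^sub>F n in sequentially. (\<integral>y. \<Omega> n y *\<^sub>R circle_mean Q' 0 (cmod y) \<partial>lborel) =
      (\<integral>y. shell_weight \<sigma> \<rho> n ((cmod y)\<^sup>2) *\<^sub>R Q y \<partial>lborel)"
    using evn[of "\<rho>\<^sup>2 / 2"] \<rho> by (auto elim!: eventually_mono simp: avg)
  ultimately have "(\<lambda>n. \<integral>y. shell_weight \<sigma> \<rho> n ((cmod y)\<^sup>2) *\<^sub>R Q y \<partial>lborel) \<longlonglongrightarrow> (2 * disk_area * \<rho>\<^sup>2) *\<^sub>R L"
    by (rule Lim_transform_eventually)
  moreover have "(2 * disk_area * \<rho>\<^sup>2) *\<^sub>R L = 2 * disk_area * circle_mean Q 0 \<rho>"
  proof -
    have "Q' (0 + complex_of_real \<rho> * cis t) = Q (0 + complex_of_real \<rho> * cis t) / complex_of_real (\<rho>\<^sup>2)" for t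
      using \<rho> by (auto simp: Q'_def K_def closed_side_def norm_mult indicator_def)
    then have "L = circle_mean Q 0 \<rho> / complex_of_real (\<rho>\<^sup>2)"
      by (simp add: L_def circle_mean_def)
    then show ?thesis using \<rho> by (simp add: scaleR_conv_of_real)
  qed
  ultimately show ?thesis by simp
qed

text \<open>
  Green's formula on the inside or outside of a disk for functions that are only continuous up to the circle.  Multiply \<open>\<Psi>\<close>
  by a smooth cutoff \<open>g n\<close> vanishing near the circle: the integral of \<open>\<partial>\<^sub>1 + \<i> \<partial>\<^sub>2\<close> of the product is zero, and the term in
  which the derivative falls on the cutoff is an average over a thin shell.  The constant \<open>2 disk_area\<close> is \<open>2 \<pi>\<close>, in terms of which
  the right hand side is the usual contour integral.
\<close>

theorem green_formula:
  fixes \<Psi> :: "complex \<Rightarrow> complex"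
  assumes \<sigma>: "\<sigma> = 1 \<or> \<sigma> = - 1" and \<rho>: "\<rho> > 0"
    and c: "continuous_on (closed_side \<sigma> p \<rho>) \<Psi>"
    and supp: "\<And>x. x \<in> closed_side \<sigma> p \<rho> \<Longrightarrow> M \<le> cmod (x - p) \<Longrightarrow> \<Psi> x = 0"
    and d: "\<And>x. x \<in> side \<sigma> p \<rho> \<Longrightarrow> (\<Psi> has_derivative D x) (at x)"
    and cD: "continuous_on (side \<sigma> p \<rho>) (\<lambda>x. D x 1)" "continuous_on (side \<sigma> p \<rho>) (\<lambda>x. D x \<i>)"
    and B: "\<And>x. x \<in> side \<sigma> p \<rho> \<Longrightarrow> cmod (D x 1 + \<i> * D x \<i>) \<le> B"
  shows "(\<integral>x. indicator (side \<sigma> p \<rho>) x *\<^sub>R (D x 1 + \<i> * D x \<i>) \<partial>lborel)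
      = \<sigma> * (2 * disk_area * circle_mean (\<lambda>x. \<Psi> x * (x - p)) p \<rho>)"
    and "integrable lborel (\<lambda>x. indicator (side \<sigma> p \<rho>) x *\<^sub>R (D x 1 + \<i> * D x \<i>))"
proof -
  have \<sigma>1: "\<sigma> * \<sigma> = 1" "\<bar>\<sigma>\<bar> = 1" using \<sigma> by auto
  let ?S = "side \<sigma> p \<rho>" and ?C = "closed_side \<sigma> p \<rho>"
  have S: "open ?S" unfolding side_def by (intro open_Collect_less continuous_intros)
  have C: "closed ?C" unfolding closed_side_def by (intro closed_Collect_le continuous_intros)
  have SC: "?S \<subseteq> ?C" by (auto simp: side_def closed_side_def)
  have Sm[measurable]: "?S \<in> sets borel" "?C \<in> sets borel" using S C by auto
  define df where "df x = D x 1 + \<i> * D x \<i>" for x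
  have D0: "D x h = 0" if x: "x \<in> ?S" "M < cmod (x - p)" for x h
  proof -
    have "((\<lambda>_. 0) has_derivative (\<lambda>_. 0)) (at x)" by simp
    then have "(\<Psi> has_derivative (\<lambda>_. 0)) (at x)"
    proof (rule has_derivative_transform_within_open[where s="?S \<inter> {y. M < cmod (y - p)}"])
      show "open (?S \<inter> {y. M < cmod (y - p)})" by (intro open_Int S open_Collect_less continuous_intros)
    qed (use x supp SC in auto)
    then show ?thesis using d[OF x(1)] has_derivative_unique by metis
  qed
  have dfm[measurable]: "(\<lambda>x. indicator ?S x *\<^sub>R df x) \<in> borel_measurable borel"
  proof (rule borel_measurable_continuous_on_indicator)
    show "continuous_on ?S df" unfolding df_def by (intro continuous_intros cD)
  qed simp
  have iB: "integrable lborel (\<lambda>x. \<bar>B\<bar> * indicator (cball p M) x)"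
    using emeasure_lborel_cball_finite[of p M] by simp
  have dB: "norm (indicator ?S x *\<^sub>R df x) \<le> \<bar>B\<bar> * indicator (cball p M) x" for x
  proof (cases "x \<in> ?S")
    case True
    show ?thesis
    proof (cases "cmod (x - p) \<le> M")
      case True
      have "cmod (df x) \<le> \<bar>B\<bar>" using B[OF \<open>x \<in> ?S\<close>] by (simp add: df_def)
      then show ?thesis using True \<open>x \<in> ?S\<close> by (simp add: dist_norm norm_minus_commute)
    next
      case False
      then show ?thesis using D0[of x] True by (simp add: df_def)
    qed
  qed simp
  show idf: "integrable lborel (\<lambda>x. indicator ?S x *\<^sub>R (D x 1 + \<i> * D x \<i>))"
    unfolding df_def[symmetric]
    by (rule Bochner_Integration.integrable_bound[OF iB]) (use dB in \<open>auto intro: order_trans[OF _ abs_ge_self]\<close>)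
  define arg where "arg n x = real n * (\<sigma> * (\<rho>\<^sup>2 - (cmod (x - p))\<^sup>2))" for n x
  define g where "g n x = smooth_step (arg n x)" for n x
  define b where "b n x = - (real n * \<sigma>) * smooth_bump (arg n x)" for n x
  have argc: "continuous_on A (arg n)" for A n unfolding arg_def[abs_def] by (intro continuous_intros)
  have gc: "continuous_on A (g n)" for A n unfolding g_def[abs_def]
    by (rule continuous_on_compose2[OF smooth_real_continuous[OF smooth_step_smooth, of UNIV] argc]) simp
  have bc: "continuous_on A (b n)" for A n unfolding b_def[abs_def]
    by (intro continuous_intros continuous_on_compose2[OF smooth_bump_continuous[of UNIV] argc]) simp
  have gd: "(g n has_derivative (\<lambda>h. (2 * Re (x - p) * Re h + 2 * Im (x - p) * Im h) * b n x)) (at x)" for n x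
    unfolding g_def[abs_def] arg_def[abs_def] b_def
  proof (rule has_derivative_radial)
    show "((\<lambda>s. smooth_step (real n * (\<sigma> * (\<rho>\<^sup>2 - s)))) has_real_derivative
        - (real n * \<sigma>) * smooth_bump (real n * (\<sigma> * (\<rho>\<^sup>2 - s)))) (at s)" for s
      unfolding mult.commute[of "- (real n * \<sigma>)"]
      by (rule DERIV_chain2[OF smooth_step_derivative]) (auto intro!: derivative_eq_intros)
  qed
  have gS: "g n x = 0 \<and> b n x = 0" if "arg n x < 1" for n x
    using that by (simp add: g_def b_def smooth_step_eq smooth_bump_outside)
  have notS: "arg n x < 1" if "x \<notin> ?S" for n x
  proof -
    have "\<sigma> * (\<rho>\<^sup>2 - (cmod (x - p))\<^sup>2) \<le> 0" using that by (simp add: side_def)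
    then have "arg n x \<le> 0" unfolding arg_def by (rule mult_nonneg_nonpos[rotated]) simp
    then show ?thesis by simp
  qed
  have gdfm: "(\<lambda>x. g n x *\<^sub>R (indicator ?S x *\<^sub>R df x)) \<in> borel_measurable borel" for n
    by (rule borel_measurable_scaleR[OF borel_measurable_continuous_onI[OF gc] dfm])
  have gle: "norm (g n x *\<^sub>R v) \<le> norm v" for n x and v :: complex
    using smooth_step_bounds[of "arg n x"] by (simp add: g_def mult_left_le_one_le)
  define w where "w n x = shell_weight \<sigma> \<rho> n ((cmod (x - p))\<^sup>2)" for n x
  have wb: "w n x = - 2 * \<sigma> * b n x" for n x
    using \<sigma> by (auto simp: w_def shell_weight_def b_def arg_def)
  have wS: "x \<in> ?S" if "w n x \<noteq> 0" for n x
    using shell_weight_support(2)[OF that[unfolded w_def] \<sigma>1(2)] by (simp add: side_def)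
  define Q where "Q y = indicator (closed_side \<sigma> 0 \<rho>) y *\<^sub>R (\<Psi> (y + p) * y)" for y
  have Cshift: "y + p \<in> ?C \<longleftrightarrow> y \<in> closed_side \<sigma> 0 \<rho>" for y by (simp add: closed_side_def)
  have Qc: "continuous_on (closed_side \<sigma> 0 \<rho>) (\<lambda>y. \<Psi> (y + p) * y)"
    by (intro continuous_intros continuous_on_compose2[OF c]) (auto simp: Cshift)
  have Qm: "Q \<in> borel_measurable borel"
    unfolding Q_def[abs_def]
    by (rule borel_measurable_continuous_on_indicator[OF _ Qc])
      (auto simp: closed_side_def intro!: borel_closed closed_Collect_le continuous_intros)
  have Qc': "continuous_on (closed_side \<sigma> 0 \<rho>) Q"
    using Qc by (rule continuous_on_eq) (simp add: Q_def)
  have wm: "(\<lambda>y. shell_weight \<sigma> \<rho> n ((cmod y)\<^sup>2) *\<^sub>R Q y) \<in> borel_measurable borel" for n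
    by (intro borel_measurable_scaleR Qm borel_measurable_continuous_onI
        continuous_on_compose2[OF shell_weight_continuous[of UNIV]]) (auto intro!: continuous_intros)
  have identity: "(\<integral>x. g n x *\<^sub>R (indicator ?S x *\<^sub>R df x) \<partial>lborel)
      = \<sigma> * (\<integral>y. shell_weight \<sigma> \<rho> n ((cmod y)\<^sup>2) *\<^sub>R Q y \<partial>lborel)" if n: "n > 0" for n
  proof -
    \<comment> \<open>The derivative of \<open>g n \<Psi>\<close>, extended by zero.\<close>
    define E where "E x h = (if x \<in> ?S then complex_of_real (g n x) * D x h
        + complex_of_real ((2 * Re (x - p) * Re h + 2 * Im (x - p) * Im h) * b n x) * \<Psi> x else 0)" for x h
    define \<Phi> where "\<Phi> x = (if x \<in> ?S then complex_of_real (g n x) * \<Psi> x else 0)" for x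
    define U where "U = {x. arg n x < 1}"
    have U: "open U" unfolding U_def by (intro open_Collect_less argc continuous_intros)
    have US: "UNIV = ?S \<union> U" using notS by (auto simp: U_def)
    have \<Phi>d: "(\<Phi> has_derivative E x) (at x)" for x
    proof (cases "x \<in> ?S")
      case True
      have "((\<lambda>x. complex_of_real (g n x) * \<Psi> x) has_derivative
          (\<lambda>h. complex_of_real (g n x) * D x h + complex_of_real ((2 * Re (x - p) * Re h + 2 * Im (x - p) * Im h) * b n x) * \<Psi> x)) (at x)"
        by (rule has_derivative_mult[OF has_derivative_of_real[OF gd] d[OF True]])
      then have "(\<Phi> has_derivative
          (\<lambda>h. complex_of_real (g n x) * D x h + complex_of_real ((2 * Re (x - p) * Re h + 2 * Im (x - p) * Im h) * b n x) * \<Psi> x)) (at x)"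
        by (rule has_derivative_transform_within_open[OF _ S True]) (simp add: \<Phi>_def)
      then show ?thesis using True by (simp add: E_def[abs_def])
    next
      case False
      then have "x \<in> U" using notS by (simp add: U_def)
      have "((\<lambda>_. 0) has_derivative (\<lambda>_. 0)) (at x)" by simp
      then have "(\<Phi> has_derivative (\<lambda>_. 0)) (at x)"
        by (rule has_derivative_transform_within_open[OF _ U \<open>x \<in> U\<close>]) (auto simp: \<Phi>_def U_def gS)
      then show ?thesis using False by (simp add: E_def[abs_def])
    qed
    have Ec: "continuous_on UNIV (\<lambda>x. E x h)" if h: "continuous_on ?S (\<lambda>x. D x h)" for h
      unfolding US
    proof (rule continuous_on_open_Un[OF S U])
      have "continuous_on ?S (\<lambda>x. complex_of_real (g n x) * D x h
        + complex_of_real ((2 * Re (x - p) * Re h + 2 * Im (x - p) * Im h) * b n x) * \<Psi> x)"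
        by (intro continuous_intros gc bc h continuous_on_subset[OF c SC])
      then show "continuous_on ?S (\<lambda>x. E x h)" by (rule continuous_on_eq) (simp add: E_def)
      have "continuous_on U (\<lambda>x. 0 :: complex)" by simp
      then show "continuous_on U (\<lambda>x. E x h)" by (rule continuous_on_eq) (auto simp: E_def U_def gS)
    qed
    define r where "r = \<bar>M\<bar> + \<rho> + 2 + cmod p"
    have \<Phi>0: "\<Phi> x = 0" if "r \<le> cmod x" for x
    proof (cases "x \<in> ?S")
      case True
      have "M \<le> cmod (x - p)" using that norm_triangle_ineq2[of x p] \<rho> by (simp add: r_def)
      then show ?thesis using supp True SC by (auto simp: \<Phi>_def)
    qed (simp add: \<Phi>_def)
    note I = integral_partial_derivatives[OF \<Phi>d Ec[OF cD(1)] Ec[OF cD(2)] \<Phi>0]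
    have E: "E x 1 + \<i> * E x \<i> = g n x *\<^sub>R (indicator ?S x *\<^sub>R df x) - \<sigma> * (w n x *\<^sub>R Q (x - p))" for x
    proof (cases "x \<in> ?S")
      case True
      then have Q: "Q (x - p) = \<Psi> x * (x - p)" using SC Cshift[of "x - p"] by (auto simp: Q_def)
      have xp: "x - p = complex_of_real (Re (x - p)) + \<i> * complex_of_real (Im (x - p))"
        by (simp add: complex_eq_iff)
      have "\<sigma> * (w n x *\<^sub>R Q (x - p)) = - (complex_of_real (2 * b n x) * (x - p)) * \<Psi> x"
        using \<sigma> by (auto simp: Q wb scaleR_conv_of_real)
      also have "\<dots> = - (complex_of_real (2 * b n x) * (complex_of_real (Re (x - p)) + \<i> * complex_of_real (Im (x - p)))) * \<Psi> x"
        using xp by simp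
      finally have "\<sigma> * (w n x *\<^sub>R Q (x - p)) = - (complex_of_real (2 * b n x) * (complex_of_real (Re (x - p)) + \<i> * complex_of_real (Im (x - p)))) * \<Psi> x" .
      then show ?thesis
        using True by (simp add: E_def df_def scaleR_conv_of_real algebra_simps)
    next
      case False
      then have "w n x = 0" using wS by blast
      then show ?thesis using False by (simp add: E_def)
    qed
    have i1: "integrable lborel (\<lambda>x. g n x *\<^sub>R (indicator ?S x *\<^sub>R df x))"
    proof (rule Bochner_Integration.integrable_bound[OF iB])
      show "(\<lambda>x. g n x *\<^sub>R (indicator ?S x *\<^sub>R df x)) \<in> borel_measurable lborel"
        using gdfm[of n] by simp
      show "AE x in lborel. norm (g n x *\<^sub>R (indicator ?S x *\<^sub>R df x)) \<le> norm (\<bar>B\<bar> * indicator (cball p M) x)"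
      proof (rule AE_I2)
        fix x
        have "norm (g n x *\<^sub>R (indicator ?S x *\<^sub>R df x)) \<le> norm (indicator ?S x *\<^sub>R df x)"
          by (rule gle)
        then show "norm (g n x *\<^sub>R (indicator ?S x *\<^sub>R df x)) \<le> norm (\<bar>B\<bar> * indicator (cball p M) x)"
          using dB[of x] by simp
      qed
    qed
    have "integrable lborel (\<lambda>x. E x 1 + \<i> * E x \<i>)" using I by simp
    then have i2: "integrable lborel (\<lambda>x. complex_of_real \<sigma> * (w n x *\<^sub>R Q (x - p)))"
      unfolding E using Bochner_Integration.integrable_diff[OF i1] by fastforce
    have "0 = (\<integral>x. E x 1 + \<i> * E x \<i> \<partial>lborel)" using I by simp
    also have "\<dots> = (\<integral>x. g n x *\<^sub>R (indicator ?S x *\<^sub>R df x) \<partial>lborel) - (\<integral>x. \<sigma> * (w n x *\<^sub>R Q (x - p)) \<partial>lborel)"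
      unfolding E by (rule Bochner_Integration.integral_diff[OF i1 i2])
    finally have "(\<integral>x. g n x *\<^sub>R (indicator ?S x *\<^sub>R df x) \<partial>lborel) = (\<integral>x. \<sigma> * (w n x *\<^sub>R Q (x - p)) \<partial>lborel)"
      by (simp only: eq_commute[of 0] right_minus_eq)
    also have "\<dots> = \<sigma> * (\<integral>x. w n x *\<^sub>R Q (x - p) \<partial>lborel)"
      by (rule integral_mult_right_zero)
    also have "(\<integral>x. w n x *\<^sub>R Q (x - p) \<partial>lborel) = (\<integral>y. shell_weight \<sigma> \<rho> n ((cmod y)\<^sup>2) *\<^sub>R Q y \<partial>lborel)"
      using lborel_integral_translate(1)[OF wm[of n], of "- p"] by (simp add: w_def)
    finally show ?thesis .
  qed
  have lim1: "(\<lambda>n. \<integral>x. g n x *\<^sub>R (indicator ?S x *\<^sub>R df x) \<partial>lborel) \<longlonglongrightarrow> (\<integral>x. indicator ?S x *\<^sub>R df x \<partial>lborel)"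
  proof (rule integral_dominated_convergence[OF _ _ iB])
    show "(\<lambda>x. g n x *\<^sub>R (indicator ?S x *\<^sub>R df x)) \<in> borel_measurable lborel" for n
      using gdfm[of n] by simp
    show "AE x in lborel. (\<lambda>n. g n x *\<^sub>R (indicator ?S x *\<^sub>R df x)) \<longlonglongrightarrow> indicator ?S x *\<^sub>R df x"
    proof (rule AE_I2)
      fix x
      show "(\<lambda>n. g n x *\<^sub>R (indicator ?S x *\<^sub>R df x)) \<longlonglongrightarrow> indicator ?S x *\<^sub>R df x"
      proof (cases "x \<in> ?S")
        case True
        then have "\<sigma> * (\<rho>\<^sup>2 - (cmod (x - p))\<^sup>2) > 0" by (simp add: side_def)
        then have "filterlim (\<lambda>n. arg n x) at_top sequentially"
          unfolding arg_def by (rule filterlim_at_top_mult_tendsto_pos[OF tendsto_const _ filterlim_real_sequentially])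
        then have "\<forall>\<^sub>F n in sequentially. arg n x \<ge> 2" by (auto simp: filterlim_at_top)
        then have "\<forall>\<^sub>F n in sequentially. g n x *\<^sub>R (indicator ?S x *\<^sub>R df x) = indicator ?S x *\<^sub>R df x"
          by eventually_elim (simp add: g_def smooth_step_eq)
        then show ?thesis by (rule tendsto_eventually)
      qed simp
    qed
    show "AE x in lborel. norm (g n x *\<^sub>R (indicator ?S x *\<^sub>R df x)) \<le> \<bar>B\<bar> * indicator (cball p M) x" for n
    proof (rule AE_I2)
      fix x
      have "norm (g n x *\<^sub>R (indicator ?S x *\<^sub>R df x)) \<le> norm (indicator ?S x *\<^sub>R df x)"
        by (rule gle)
      then show "norm (g n x *\<^sub>R (indicator ?S x *\<^sub>R df x)) \<le> \<bar>B\<bar> * indicator (cball p M) x"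
        using dB[of x] by linarith
    qed
  qed (use dfm in simp)
  have "(\<lambda>n. \<sigma> * (\<integral>y. shell_weight \<sigma> \<rho> n ((cmod y)\<^sup>2) *\<^sub>R Q y \<partial>lborel)) \<longlonglongrightarrow> \<sigma> * (2 * disk_area * circle_mean Q 0 \<rho>)"
    by (intro tendsto_mult_left shell_average_tendsto \<sigma> \<rho> Qm Qc')
  moreover have "\<forall>\<^sub>F n in sequentially. \<sigma> * (\<integral>y. shell_weight \<sigma> \<rho> n ((cmod y)\<^sup>2) *\<^sub>R Q y \<partial>lborel)
      = (\<integral>x. g n x *\<^sub>R (indicator ?S x *\<^sub>R df x) \<partial>lborel)"
    using eventually_gt_at_top[of 0] by eventually_elim (rule identity[symmetric])
  ultimately have "(\<lambda>n. \<integral>x. g n x *\<^sub>R (indicator ?S x *\<^sub>R df x) \<partial>lborel) \<longlonglongrightarrow> \<sigma> * (2 * disk_area * circle_mean Q 0 \<rho>)"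
    by (rule Lim_transform_eventually)
  from LIMSEQ_unique[OF lim1 this] have "(\<integral>x. indicator ?S x *\<^sub>R df x \<partial>lborel) = \<sigma> * (2 * disk_area * circle_mean Q 0 \<rho>)" .
  moreover have "circle_mean Q 0 \<rho> = circle_mean (\<lambda>x. \<Psi> x * (x - p)) p \<rho>"
  proof -
    have "Q (0 + complex_of_real \<rho> * cis t) = \<Psi> (p + complex_of_real \<rho> * cis t) * (p + complex_of_real \<rho> * cis t - p)" for t
      using \<rho> by (simp add: Q_def closed_side_def norm_mult add.commute)
    then show ?thesis by (simp add: circle_mean_def)
  qed
  ultimately show "(\<integral>x. indicator ?S x *\<^sub>R (D x 1 + \<i> * D x \<i>) \<partial>lborel)
      = \<sigma> * (2 * disk_area * circle_mean (\<lambda>x. \<Psi> x * (x - p)) p \<rho>)"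
    by (simp add: df_def)
qed

section \<open>One-dimensional Hausdorff measure of a circle\<close>

lemma diameter_rotation:
  assumes c: "cmod c = 1"
  shows "diameter ((*) c ` S) = diameter S"
proof -
  have *: "(\<lambda>(x, y). dist x y) ` ((*) c ` S \<times> (*) c ` S) = (\<lambda>(x, y). dist x y) ` (S \<times> S)"
  proof -
    have "dist (c * x) (c * y) = dist x y" for x y
      using c by (simp add: dist_norm norm_mult flip: right_diff_distrib)
    then show ?thesis by (force simp: image_iff)
  qed
  show ?thesis unfolding diameter_def by (simp only: * image_is_empty)
qed

text \<open>
  Rotating a covering keeps its diameters.
\<close>

lemma hausdorff1_outer_rotation_le:
  assumes c: "cmod c = 1"
  shows "hausdorff1_outer ((*) c ` S) \<le> hausdorff1_outer S"
proof -
  have "hausdorff1_pre \<delta> ((*) c ` S) \<le> hausdorff1_pre \<delta> S" for \<delta>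
    unfolding hausdorff1_pre_def
  proof (rule Inf_superset_mono, safe)
    fix C :: "nat \<Rightarrow> complex set"
    assume C: "S \<subseteq> (\<Union>j. C j)" "\<forall>j. bounded (C j) \<and> diameter (C j) \<le> \<delta>"
    show "\<exists>C'. (\<Sum>j. ennreal (diameter (C j))) = (\<Sum>j. ennreal (diameter (C' j))) \<and>
        (*) c ` S \<subseteq> (\<Union>j. C' j) \<and> (\<forall>j. bounded (C' j) \<and> diameter (C' j) \<le> \<delta>)"
    proof (intro exI[of _ "\<lambda>j. (*) c ` C j"] conjI allI)
      show "(*) c ` S \<subseteq> (\<Union>j. (*) c ` C j)" using C(1) by blast
      show "bounded ((*) c ` C j)" for j
        using C(2) bounded_linear_image[OF _ bounded_linear_mult_right] by blast
    qed (use C(2) in \<open>simp_all add: diameter_rotation[OF c]\<close>)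
  qed
  then show ?thesis unfolding hausdorff1_outer_def by (intro SUP_mono) auto
qed

lemma hausdorff1_outer_rotation:
  assumes c: "cmod c = 1"
  shows "hausdorff1_outer ((*) c ` S) = hausdorff1_outer S"
proof (rule antisym)
  have c0: "c \<noteq> 0" using c by auto
  have "hausdorff1_outer ((*) (inverse c) ` ((*) c ` S)) \<le> hausdorff1_outer ((*) c ` S)"
    by (rule hausdorff1_outer_rotation_le) (simp add: norm_inverse c)
  also have "(*) (inverse c) ` ((*) c ` S) = S"
    using c0 by (simp add: image_image mult.assoc[symmetric])
  finally show "hausdorff1_outer S \<le> hausdorff1_outer ((*) c ` S)" .
qed (rule hausdorff1_outer_rotation_le[OF c])

lemma cmod_cis_diff_le: "cmod (cis a - cis b) \<le> \<bar>a - b\<bar>"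
proof -
  have "cis a - cis b = cis b * (exp (\<i> * of_real (a - b)) - 1)"
    unfolding cis_conv_exp[symmetric] by (simp add: right_diff_distrib cis_mult)
  then have "cmod (cis a - cis b) = 2 * \<bar>sin ((a - b) / 2)\<bar>"
    by (simp add: norm_mult dist_exp_i_1 del: of_real_diff)
  also have "\<dots> \<le> 2 * \<bar>(a - b) / 2\<bar>" by (intro mult_left_mono abs_sin_x_le_abs_x) simp
  finally show ?thesis by simp
qed

text \<open>
  Cover the circle by \<open>n\<close> equal arcs; each has diameter at most its length.
\<close>

lemma hausdorff1_outer_circle_finite:
  assumes q: "q > 0"
  shows "hausdorff1_outer (sphere 0 q) \<le> ennreal (2 * pi * q)"
  unfolding hausdorff1_outer_def
proof (rule SUP_least)
  fix \<delta> :: real assume "\<delta> \<in> {0<..}"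
  then have \<delta>: "\<delta> > 0" by simp
  obtain n :: nat where n: "2 * pi * q / \<delta> < real n" using reals_Archimedean2 by blast
  have "2 * pi * q / \<delta> > 0" using q \<delta> by simp
  then have "real n > 0" using n by linarith
  then have n0: "real n > 0" "n > 0" by simp_all
  have step: "2 * pi * q / real n \<le> \<delta>" using n \<delta> n0 by (simp add: field_simps)
  define a where "a j = 2 * pi * real j / real n" for j
  have aS: "a (Suc j) = a j + 2 * pi / real n" for j by (simp add: a_def field_simps add_divide_distrib)
  define C where "C j = (if j < n then (\<lambda>t. complex_of_real q * cis t) ` {a j..a (Suc j)} else {})" for j
  have pair: "dist x y \<le> 2 * pi * q / real n" if "x \<in> C j" "y \<in> C j" for x y j
  proof -
    have "x \<in> (\<lambda>t. complex_of_real q * cis t) ` {a j..a (Suc j)}"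
      using that(1) by (simp add: C_def split: if_splits)
    then obtain s where s: "s \<in> {a j..a (Suc j)}" "x = complex_of_real q * cis s" by blast
    have "y \<in> (\<lambda>t. complex_of_real q * cis t) ` {a j..a (Suc j)}"
      using that(2) by (simp add: C_def split: if_splits)
    then obtain t where t: "t \<in> {a j..a (Suc j)}" "y = complex_of_real q * cis t" by blast
    note st = s t
    have "dist x y = q * cmod (cis s - cis t)"
      using q by (simp add: st dist_norm norm_mult flip: right_diff_distrib)
    also have "\<dots> \<le> q * \<bar>s - t\<bar>" using q by (intro mult_left_mono cmod_cis_diff_le) auto
    also have "\<dots> \<le> q * (2 * pi / real n)" using st q by (intro mult_left_mono) (auto simp: aS)
    finally show ?thesis by (simp add: mult_ac)
  qed
  have diam: "diameter (C j) \<le> 2 * pi * q / real n" for j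
    by (rule diameter_le) (use pair q in \<open>auto simp: dist_norm\<close>)
  have bdd: "bounded (C j)" for j
    unfolding C_def by (auto intro!: compact_imp_bounded compact_continuous_image continuous_intros)
  have cover: "sphere 0 q \<subseteq> (\<Union>j. C j)"
  proof
    fix x :: complex assume "x \<in> sphere 0 q"
    then have xq: "cmod x = q" by simp
    define t where "t = Arg2pi x"
    have t: "0 \<le> t" "t < 2 * pi" and x: "x = complex_of_real q * cis t"
      using Arg2pi[of x] xq by (auto simp: t_def is_Arg_def cis_conv_exp)
    define j where "j = nat \<lfloor>t * real n / (2 * pi)\<rfloor>"
    have "0 \<le> t * real n / (2 * pi)" using t by simp
    then have j: "real j \<le> t * real n / (2 * pi)" "t * real n / (2 * pi) < real j + 1"
      by (auto simp: j_def)
    have "t * real n / (2 * pi) < real n" using t n0 by (simp add: field_simps)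
    then have "j < n" using j by linarith
    moreover have "a j \<le> t" "t \<le> a (Suc j)" using j n0 by (auto simp: a_def field_simps)
    ultimately have "x \<in> C j" by (auto simp: C_def x)
    then show "x \<in> (\<Union>j. C j)" by blast
  qed
  have "hausdorff1_pre \<delta> (sphere 0 q) \<le> (\<Sum>j. ennreal (diameter (C j)))"
    unfolding hausdorff1_pre_def
  proof (rule Inf_lower, rule CollectI, intro exI conjI)
    show "\<forall>j. bounded (C j) \<and> diameter (C j) \<le> \<delta>" using bdd diam step order_trans by blast
  qed (use cover in auto)
  also have "\<dots> = (\<Sum>j<n. ennreal (diameter (C j)))"
    by (rule suminf_finite) (auto simp: C_def)
  also have "\<dots> \<le> (\<Sum>j<n. ennreal (2 * pi * q / real n))"
    by (intro sum_mono ennreal_leI diam)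
  also have "\<dots> = ennreal (\<Sum>j<n. 2 * pi * q / real n)"
    by (rule sum_ennreal) (use q in simp)
  also have "(\<Sum>j<n. 2 * pi * q / real n) = 2 * pi * q" using n0 by simp
  finally show "hausdorff1_pre \<delta> (sphere 0 q) \<le> ennreal (2 * pi * q)" .
qed

lemma sets_hausdorff1 [measurable_cong, simp]: "sets hausdorff1 = sets borel"
  unfolding hausdorff1_def using sets.sigma_sets_eq[of "borel :: complex measure"] by simp

text \<open>
  \<^const>\<open>measure_of\<close> yields the zero measure unless the given set function is a measure.  Both alternatives are invariant under rotations
  and finite on circles, so the distinction never has to be decided.
\<close>

lemma emeasure_hausdorff1:
  obtains "\<And>A. A \<in> sets borel \<Longrightarrow> emeasure hausdorff1 A = 0"
  | "\<And>A. A \<in> sets borel \<Longrightarrow> emeasure hausdorff1 A = hausdorff1_outer A"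
proof (cases "measure_space UNIV (sets (borel :: complex measure)) hausdorff1_outer")
  case True
  have "emeasure hausdorff1 A = hausdorff1_outer A" if "A \<in> sets borel" for A
    using that True sets.sigma_sets_eq[of "borel :: complex measure"]
    unfolding hausdorff1_def emeasure_measure_of_conv by simp
  then show ?thesis by (rule that(2))
next
  case False
  have "emeasure hausdorff1 A = 0" if "A \<in> sets borel" for A
    using that False sets.sigma_sets_eq[of "borel :: complex measure"]
    unfolding hausdorff1_def emeasure_measure_of_conv by simp
  then show ?thesis by (rule that(1))
qed

text \<open>
  A finite rotation invariant measure on a circle integrates a function to its mean times the total mass \<open>\<kappa>\<close>.
\<close>

lemma hausdorff1_circle_integral:
  assumes q: "q > 0"
  obtains \<kappa> where "\<And>g. continuous_on (sphere 0 q) g \<Longrightarrow>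
    complex_of_real (LINT x:sphere 0 q|hausdorff1. g x) = complex_of_real \<kappa> * circle_mean (\<lambda>x. complex_of_real (g x)) 0 q"
proof -
  define S where "S = sphere (0::complex) q"
  have Sm[measurable]: "S \<in> sets borel" by (simp add: S_def)
  define M where "M = density hausdorff1 (indicator S)"
  have Mset[measurable_cong]: "sets M = sets borel" by (simp add: M_def)
  have em: "emeasure M A = emeasure hausdorff1 (S \<inter> A)" if "A \<in> sets borel" for A
    using that unfolding M_def by (subst emeasure_density) (auto simp: indicator_inter_arith[symmetric] simp flip: nn_integral_indicator intro!: nn_integral_cong split: split_indicator)
  have inv: "emeasure hausdorff1 ((*) c -` A) = emeasure hausdorff1 A" if c: "cmod c = 1" and A: "A \<in> sets borel" for c A
  proof -
    have c0: "c \<noteq> 0" using c by auto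
    have eq: "(*) c -` A = (*) (inverse c) ` A"
      using c0 by (auto simp: image_iff field_simps intro!: bexI[rotated])
    have m: "(*) c -` A \<in> sets borel"
      using measurable_sets[of "(*) c" borel borel A] A by simp
    show ?thesis
    proof (cases rule: emeasure_hausdorff1)
      case 1 then show ?thesis using A m by simp
    next
      case 2
      then show ?thesis using A m hausdorff1_outer_rotation[of "inverse c" A] c by (simp add: eq norm_inverse)
    qed
  qed
  have fin: "finite_measure M"
  proof (rule finite_measureI)
    have "emeasure hausdorff1 S \<le> ennreal (2 * pi * q)"
      using hausdorff1_outer_circle_finite[OF q] by (cases rule: emeasure_hausdorff1) (auto simp: S_def)
    then have "emeasure M (space M) \<le> ennreal (2 * pi * q)"
      using em[of UNIV] by (simp add: sets_eq_imp_space_eq[OF Mset])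
    then show "emeasure M (space M) \<noteq> \<infinity>" by (auto simp: top_unique)
  qed
  interpret finite_measure M by fact
  have rot: "distr M borel ((*) c) = M" if c: "cmod c = 1" for c
  proof (rule measure_eqI)
    fix A assume "A \<in> sets (distr M borel ((*) c))"
    then have A: "A \<in> sets borel" by simp
    have c0: "c \<noteq> 0" using c by auto
    have m: "(*) c -` A \<in> sets borel" "(*) c -` (S \<inter> A) \<in> sets borel"
      using measurable_sets[of "(*) c" borel borel A] measurable_sets[of "(*) c" borel borel "S \<inter> A"] A by simp_all
    have "emeasure (distr M borel ((*) c)) A = emeasure M ((*) c -` A)"
      using A by (subst emeasure_distr) (auto simp: sets_eq_imp_space_eq[OF Mset])
    also have "\<dots> = emeasure hausdorff1 (S \<inter> ((*) c -` A))" by (rule em[OF m(1)])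
    also have "S \<inter> ((*) c -` A) = (*) c -` (S \<inter> A)" by (auto simp: S_def norm_mult c)
    also have "emeasure hausdorff1 \<dots> = emeasure hausdorff1 (S \<inter> A)" by (rule inv[OF c]) (use A in simp)
    also have "\<dots> = emeasure M A" by (rule em[OF A, symmetric])
    finally show "emeasure (distr M borel ((*) c)) A = emeasure M A" .
  qed (simp add: Mset)
  show ?thesis
  proof (rule that)
    fix g :: "complex \<Rightarrow> real" assume g: "continuous_on (sphere 0 q) g"
    define \<psi> where "\<psi> x = indicator S x *\<^sub>R complex_of_real (g x)" for x
    have \<psi>m[measurable]: "\<psi> \<in> borel_measurable borel"
      unfolding \<psi>_def[abs_def] S_def
      by (rule borel_measurable_continuous_on_indicator) (use g in \<open>auto intro!: continuous_intros\<close>)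
    have "bounded (g ` sphere 0 q)"
      by (intro compact_imp_bounded compact_continuous_image g compact_sphere)
    then obtain B where B: "\<forall>y\<in>g ` sphere 0 q. norm y \<le> B"
      unfolding bounded_iff by blast
    have \<psi>B: "norm (\<psi> x) \<le> \<bar>B\<bar>" for x
    proof (cases "x \<in> S")
      case True
      then have "\<bar>g x\<bar> \<le> B" using B by (auto simp: S_def)
      then show ?thesis using True by (simp add: \<psi>_def)
    qed (simp add: \<psi>_def)
    have "complex_of_real (LINT x:S|hausdorff1. g x) = (\<integral>x. indicator S x *\<^sub>R \<psi> x \<partial>hausdorff1)"
      unfolding set_lebesgue_integral_def integral_complex_of_real[symmetric]
      by (rule Bochner_Integration.integral_cong) (auto simp: \<psi>_def indicator_def)
    also have "\<dots> = (\<integral>x. \<psi> x \<partial>M)"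
    proof -
      have "M = density hausdorff1 (\<lambda>x. ennreal (indicator S x))" by (simp add: M_def ennreal_indicator)
      then show ?thesis by (simp add: integral_density)
    qed
    also have "\<dots> = (\<integral>x. circle_mean \<psi> 0 (cmod x) \<partial>M)"
      by (rule rotation_average[OF fin Mset rot \<psi>m \<psi>B])
    also have "\<dots> = (\<integral>x. circle_mean \<psi> 0 q \<partial>M)"
    proof (rule integral_cong_AE)
      have "emeasure M (- S) = 0" using em[of "- S"] by simp
      then have "AE x in M. x \<notin> - S" by (intro AE_not_in) (auto simp: null_sets_def Mset)
      then show "AE x in M. circle_mean \<psi> 0 (cmod x) = circle_mean \<psi> 0 q"
        by eventually_elim (simp add: S_def)
      have "circle_mean \<psi> 0 \<in> borel_measurable borel"
        unfolding circle_mean_def[abs_def] set_lebesgue_integral_def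
        using borel_measurable_continuous_onI[OF continuous_on_cis[OF continuous_on_id]] by measurable
      then show "(\<lambda>x. circle_mean \<psi> 0 (cmod x)) \<in> borel_measurable M" by measurable
    qed simp
    also have "\<dots> = complex_of_real (measure M (space M)) * circle_mean \<psi> 0 q"
      by (simp add: scaleR_conv_of_real)
    also have "circle_mean \<psi> 0 q = circle_mean (\<lambda>x. complex_of_real (g x)) 0 q"
      using q by (simp add: circle_mean_def \<psi>_def S_def norm_mult)
    finally show "complex_of_real (LINT x:sphere 0 q|hausdorff1. g x)
        = complex_of_real (measure M (space M)) * circle_mean (\<lambda>x. complex_of_real (g x)) 0 q"
      by (simp add: S_def)
  qed
qed

section \<open>Piecewise holomorphic fields\<close>

lemma test_function_mult_radial:
  assumes \<phi>: "test_function \<phi>" and f: "smooth_real f"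
  shows "test_function (\<lambda>x. \<phi> x * f ((cmod x)\<^sup>2))"
proof -
  have "times_cont_diff n (\<lambda>x. \<phi> x * f ((cmod (x - 0))\<^sup>2))" for n
    by (intro times_cont_diff_mult times_cont_diff_radial f) (use \<phi> in \<open>simp add: test_function_def\<close>)
  moreover have "compact (closure {x. \<phi> x * f ((cmod x)\<^sup>2) \<noteq> 0})"
  proof -
    have "bounded {x. \<phi> x * f ((cmod x)\<^sup>2) \<noteq> 0}"
    proof (rule bounded_subset)
      show "bounded (closure {x. \<phi> x \<noteq> 0})"
        using \<phi> by (simp add: test_function_def compact_imp_bounded)
      show "{x. \<phi> x * f ((cmod x)\<^sup>2) \<noteq> 0} \<subseteq> closure {x. \<phi> x \<noteq> 0}"
        using closure_subset[of "{x. \<phi> x \<noteq> 0}"] by auto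
    qed
    then show ?thesis by simp
  qed
  ultimately show ?thesis by (simp add: test_function_def)
qed

text \<open>
  The real gradient as a complex number.  For \<open>\<xi> = V\<^sub>1 - \<i> V\<^sub>2\<close> the product \<open>\<xi> cgrad \<phi>\<close> has real part \<open>V\<cdot>\<nabla>\<phi>\<close> and
  imaginary part \<open>V\<^sub>1 \<partial>\<^sub>2\<phi> - V\<^sub>2 \<partial>\<^sub>1\<phi>\<close>, so that it carries the divergence and the curl at once.
\<close>

definition cgrad :: "(complex \<Rightarrow> real) \<Rightarrow> complex \<Rightarrow> complex"
  where "cgrad \<phi> x = Complex (partial1 \<phi> x) (partial2 \<phi> x)"

lemma cgrad_zero_outside:
  assumes \<phi>: "test_function \<phi>" and L: "closed L" and z: "\<And>x. x \<notin> L \<Longrightarrow> \<phi> x = 0" and x: "x \<notin> L"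
  shows "partial1 \<phi> x = 0" "partial2 \<phi> x = 0"
proof -
  have "((\<lambda>_. 0) has_derivative (\<lambda>_. 0)) (at x)" by simp
  then have "(\<phi> has_derivative (\<lambda>_. 0)) (at x)"
    by (rule has_derivative_transform_within_open[where s="- L"]) (use L x z in auto)
  from partial_has_derivative[OF this] show "partial1 \<phi> x = 0" "partial2 \<phi> x = 0" by simp_all
qed

text \<open>
  For holomorphic \<open>\<xi>\<close> the derivative \<open>\<partial>\<^sub>1 + \<i> \<partial>\<^sub>2\<close> of \<open>\<phi> \<xi>\<close> falls on \<open>\<phi>\<close> alone.  The sets \<open>L\<close> and \<open>N\<close> localise:
  \<open>\<phi>\<close> lives on \<open>L\<close>, and \<open>\<xi>\<close> has to be regular only on the neighbourhood \<open>N\<close>.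
\<close>

lemma green_holomorphic:
  assumes \<sigma>: "\<sigma> = 1 \<or> \<sigma> = - 1" and \<rho>: "\<rho> > 0" and \<phi>: "test_function \<phi>"
    and L: "closed L" "L \<subseteq> N" "\<And>x. x \<notin> L \<Longrightarrow> \<phi> x = 0" and N: "open N"
    and hol: "\<xi> holomorphic_on (side \<sigma> p \<rho> \<inter> N)" and c: "continuous_on (closed_side \<sigma> p \<rho> \<inter> N) \<xi>"
  shows "(\<integral>x. indicator (side \<sigma> p \<rho>) x *\<^sub>R (\<xi> x * cgrad \<phi> x) \<partial>lborel)
      = \<sigma> * (2 * disk_area * circle_mean (\<lambda>x. complex_of_real (\<phi> x) * (\<xi> x * (x - p))) p \<rho>)"
    and "integrable lborel (\<lambda>x. indicator (side \<sigma> p \<rho>) x *\<^sub>R (\<xi> x * cgrad \<phi> x))"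
proof -
  let ?S = "side \<sigma> p \<rho>" and ?C = "closed_side \<sigma> p \<rho>"
  have S: "open ?S" unfolding side_def by (intro open_Collect_less continuous_intros)
  have C: "closed ?C" unfolding closed_side_def by (intro closed_Collect_le continuous_intros)
  have SC: "?S \<subseteq> ?C" by (auto simp: side_def closed_side_def)
  define \<Psi> where "\<Psi> x = complex_of_real (\<phi> x) * \<xi> x" for x
  define D where "D x h = (if x \<in> N then complex_of_real (\<phi> x) * (deriv \<xi> x * h)
      + complex_of_real (Re h * partial1 \<phi> x + Im h * partial2 \<phi> x) * \<xi> x else 0)" for x h
  note z = cgrad_zero_outside[OF \<phi> L(1) L(3)]
  have SN: "open (?S \<inter> N)" using S N by auto
  have cov: "?S = (?S \<inter> N) \<union> (?S \<inter> - L)" "?C = (?C \<inter> N) \<union> (?C \<inter> - L)" using L(2) by auto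
  have Df: "D x 1 + \<i> * D x \<i> = \<xi> x * cgrad \<phi> x" for x
  proof (cases "x \<in> N")
    case True
    have "cgrad \<phi> x = complex_of_real (partial1 \<phi> x) + \<i> * complex_of_real (partial2 \<phi> x)"
      by (simp add: cgrad_def Complex_eq)
    then show ?thesis using True by (simp add: D_def algebra_simps)
  next
    case False
    then have "x \<notin> L" using L by auto
    then show ?thesis using False z by (simp add: D_def cgrad_def Complex_eq)
  qed
  have contC: "continuous_on ?C g" if "continuous_on (?C \<inter> N) g" "\<And>x. x \<notin> L \<Longrightarrow> g x = 0" for g :: "complex \<Rightarrow> complex"
  proof -
    have "continuous_on ?C (\<lambda>x. if x \<in> L then g x else 0)"
    proof -
      have "continuous_on ((?C \<inter> N) \<union> (?C \<inter> - L)) g"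
      proof (rule continuous_on_Un_local_open[OF _ _ that(1)])
        show "openin (top_of_set ((?C \<inter> N) \<union> (?C \<inter> - L))) (?C \<inter> N)"
          unfolding cov(2)[symmetric] using N by (auto simp: openin_open)
        show "openin (top_of_set ((?C \<inter> N) \<union> (?C \<inter> - L))) (?C \<inter> - L)"
          unfolding cov(2)[symmetric] using L(1) by (auto simp: openin_open)
        have "continuous_on (?C \<inter> - L) (\<lambda>x. 0 :: complex)" by simp
        then show "continuous_on (?C \<inter> - L) g" by (rule continuous_on_eq) (use that in auto)
      qed
      then have "continuous_on ?C g" unfolding cov(2)[symmetric] .
      then show ?thesis by (rule continuous_on_eq) (use that(2) in auto)
    qed
    then show ?thesis by (rule continuous_on_eq) (use that(2) in auto)
  qed
  note cont\<phi> = test_functionD(2-4)[OF \<phi>]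
  obtain r where r: "r > 0" "\<And>x. r \<le> cmod x \<Longrightarrow> \<phi> x = 0" "\<And>x. r \<le> cmod x \<Longrightarrow> partial1 \<phi> x = 0"
      "\<And>x. r \<le> cmod x \<Longrightarrow> partial2 \<phi> x = 0"
    using test_functionD(5)[OF \<phi>] by metis
  have c\<Psi>: "continuous_on ?C \<Psi>"
    unfolding \<Psi>_def by (rule contC) (use L(3) in \<open>auto intro!: continuous_intros cont\<phi> c\<close>)
  have supp: "\<Psi> x = 0" if "r + cmod p \<le> cmod (x - p)" for x
    using that r(2)[of x] norm_triangle_ineq4[of x p] by (simp add: \<Psi>_def)
  have dS: "(\<Psi> has_derivative D x) (at x)" if x: "x \<in> ?S" for x
  proof (cases "x \<in> N")
    case True
    have "(\<xi> has_field_derivative deriv \<xi> x) (at x)"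
      using hol SN x True holomorphic_derivI by blast
    then have "(\<xi> has_derivative (\<lambda>h. deriv \<xi> x * h)) (at x)" by (simp add: has_field_derivative_def)
    then have "(\<Psi> has_derivative (\<lambda>h. complex_of_real (\<phi> x) * (deriv \<xi> x * h)
      + complex_of_real (Re h * partial1 \<phi> x + Im h * partial2 \<phi> x) * \<xi> x)) (at x)"
      unfolding \<Psi>_def by (rule has_derivative_mult[OF has_derivative_of_real[OF test_functionD(1)[OF \<phi>]]])
    then show ?thesis using True by (simp add: D_def[abs_def])
  next
    case False
    then have xL: "x \<in> - L" using L by auto
    have "((\<lambda>_. 0) has_derivative (\<lambda>_. 0)) (at x)" by simp
    then have "(\<Psi> has_derivative (\<lambda>_. 0)) (at x)"
      by (rule has_derivative_transform_within_open[OF _ _ xL]) (use L in \<open>auto simp: \<Psi>_def\<close>)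
    then show ?thesis using False by (simp add: D_def[abs_def])
  qed
  have cD: "continuous_on ?S (\<lambda>x. D x h)" for h
  proof -
    have "continuous_on ((?S \<inter> N) \<union> (?S \<inter> - L)) (\<lambda>x. D x h)"
    proof (rule continuous_on_open_Un[OF SN])
      show "open (?S \<inter> - L)" using S L by auto
      have "continuous_on (?S \<inter> N) (deriv \<xi>)"
        using holomorphic_on_imp_continuous_on[OF holomorphic_deriv[OF hol SN]] .
      then have "continuous_on (?S \<inter> N) (\<lambda>x. complex_of_real (\<phi> x) * (deriv \<xi> x * h)
        + complex_of_real (Re h * partial1 \<phi> x + Im h * partial2 \<phi> x) * \<xi> x)"
        by (intro continuous_intros cont\<phi> holomorphic_on_imp_continuous_on[OF hol])
      then show "continuous_on (?S \<inter> N) (\<lambda>x. D x h)" by (rule continuous_on_eq) (simp add: D_def)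
      have "continuous_on (?S \<inter> - L) (\<lambda>x. 0 :: complex)" by simp
      then show "continuous_on (?S \<inter> - L) (\<lambda>x. D x h)" by (rule continuous_on_eq) (auto simp: D_def L(3) z)
    qed
    then show ?thesis using cov(1) by simp
  qed
  have cX: "continuous_on ?C (\<lambda>x. \<xi> x * cgrad \<phi> x)"
  proof (rule contC)
    have "continuous_on (?C \<inter> N) (\<lambda>x. \<xi> x * (complex_of_real (partial1 \<phi> x) + \<i> * complex_of_real (partial2 \<phi> x)))"
      by (intro continuous_intros c cont\<phi>)
    then show "continuous_on (?C \<inter> N) (\<lambda>x. \<xi> x * cgrad \<phi> x)" by (simp add: cgrad_def Complex_eq)
  qed (simp add: cgrad_def Complex_eq z)
  have "compact (?C \<inter> cball 0 r)" using C by (simp add: closed_Int_compact)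
  then have "bounded ((\<lambda>x. \<xi> x * cgrad \<phi> x) ` (?C \<inter> cball 0 r))"
    by (intro compact_imp_bounded compact_continuous_image continuous_on_subset[OF cX]) auto
  then obtain B where B: "\<forall>y\<in>(\<lambda>x. \<xi> x * cgrad \<phi> x) ` (?C \<inter> cball 0 r). norm y \<le> B" unfolding bounded_iff by blast
  have bd: "cmod (D x 1 + \<i> * D x \<i>) \<le> \<bar>B\<bar>" if "x \<in> ?S" for x
  proof (cases "cmod x \<le> r")
    case True
    then have "x \<in> ?C \<inter> cball 0 r" using that SC by auto
    then have "cmod (\<xi> x * cgrad \<phi> x) \<le> B" using B by blast
    then show ?thesis unfolding Df by linarith
  next
    case False
    then have "cgrad \<phi> x = 0" using r by (simp add: cgrad_def Complex_eq)
    then show ?thesis unfolding Df by simp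
  qed
  note G = green_formula[OF \<sigma> \<rho> c\<Psi> supp dS cD cD bd, unfolded Df]
  show "integrable lborel (\<lambda>x. indicator ?S x *\<^sub>R (\<xi> x * cgrad \<phi> x))" using G(2) .
  show "(\<integral>x. indicator ?S x *\<^sub>R (\<xi> x * cgrad \<phi> x) \<partial>lborel)
      = \<sigma> * (2 * disk_area * circle_mean (\<lambda>x. complex_of_real (\<phi> x) * (\<xi> x * (x - p))) p \<rho>)"
    using G(1) by (simp add: \<Psi>_def mult.assoc)
qed

lemma circle_mean_cong:
  assumes "\<And>x. cmod (x - p) = \<rho> \<Longrightarrow> f x = g x" "\<rho> > 0"
  shows "circle_mean f p \<rho> = circle_mean g p \<rho>"
  using assms by (simp add: circle_mean_def norm_mult)

lemma circle_mean_mult: "circle_mean (\<lambda>x. a * f x) p \<rho> = a * circle_mean f p \<rho>"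
  by (simp add: circle_mean_def set_lebesgue_integral_def flip: integral_mult_right_zero)

lemma two_sided_green:
  assumes \<rho>: "\<rho> > 0" and \<phi>: "test_function \<phi>"
    and L: "closed L" "L \<subseteq> N" "\<And>x. x \<notin> L \<Longrightarrow> \<phi> x = 0" and N: "open N"
    and i: "\<xi>i holomorphic_on (side 1 p \<rho> \<inter> N)" "continuous_on (closed_side 1 p \<rho> \<inter> N) \<xi>i"
    and o: "\<xi>o holomorphic_on (side (- 1) p \<rho> \<inter> N)" "continuous_on (closed_side (- 1) p \<rho> \<inter> N) \<xi>o"
    and \<zeta>: "\<And>x. x \<in> L \<Longrightarrow> cmod (x - p) < \<rho> \<Longrightarrow> \<zeta> x = complex_of_real a * \<xi>i x"
      "\<And>x. x \<in> L \<Longrightarrow> cmod (x - p) > \<rho> \<Longrightarrow> \<zeta> x = complex_of_real b * \<xi>o x"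
    and \<zeta>m: "(\<lambda>x. \<zeta> x * cgrad \<phi> x) \<in> borel_measurable borel"
  shows "(\<integral>x. \<zeta> x * cgrad \<phi> x \<partial>lborel) = 2 * disk_area *
      (complex_of_real a * circle_mean (\<lambda>x. complex_of_real (\<phi> x) * (\<xi>i x * (x - p))) p \<rho>
       - complex_of_real b * circle_mean (\<lambda>x. complex_of_real (\<phi> x) * (\<xi>o x * (x - p))) p \<rho>)"
    and "integrable lborel (\<lambda>x. \<zeta> x * cgrad \<phi> x)"
proof -
  note gi = green_holomorphic[OF _ \<rho> \<phi> L N i, simplified]
  note go = green_holomorphic[OF _ \<rho> \<phi> L N o, simplified]
  note z = cgrad_zero_outside[OF \<phi> L(1) L(3)]
  define X where "X x = complex_of_real a * (indicator (side 1 p \<rho>) x *\<^sub>R (\<xi>i x * cgrad \<phi> x))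
    + complex_of_real b * (indicator (side (- 1) p \<rho>) x *\<^sub>R (\<xi>o x * cgrad \<phi> x))" for x
  have iab: "integrable lborel (\<lambda>x. complex_of_real a * (indicator (side 1 p \<rho>) x *\<^sub>R (\<xi>i x * cgrad \<phi> x)))"
    "integrable lborel (\<lambda>x. complex_of_real b * (indicator (side (- 1) p \<rho>) x *\<^sub>R (\<xi>o x * cgrad \<phi> x)))"
    by (intro integrable_mult_right gi(2) go(2))+
  have iX: "integrable lborel X" unfolding X_def[abs_def] by (intro Bochner_Integration.integrable_add iab)
  have "sphere p \<rho> \<in> null_sets lborel"
    using negligible_sphere[of p \<rho>] by (simp add: negligible_iff_null_sets null_sets_completion_iff)
  then have "AE x in lborel. x \<notin> sphere p \<rho>" by (rule AE_not_in)
  then have ae: "AE x in lborel. X x = \<zeta> x * cgrad \<phi> x"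
  proof eventually_elim
    fix x assume x: "x \<notin> sphere p \<rho>"
    show "X x = \<zeta> x * cgrad \<phi> x"
    proof (cases "x \<in> L")
      case False
      then have "cgrad \<phi> x = 0" by (simp add: cgrad_def Complex_eq z)
      then show ?thesis by (simp add: X_def)
    next
      case xL: True
      have "cmod (x - p) \<noteq> \<rho>" using x by (simp add: dist_norm norm_minus_commute)
      then consider "cmod (x - p) < \<rho>" | "cmod (x - p) > \<rho>" by linarith
      then show ?thesis
      proof cases
        case 1
        then have "(cmod (x - p))\<^sup>2 < \<rho>\<^sup>2" by (intro power_strict_mono) auto
        then show ?thesis using \<zeta>(1)[OF xL 1] by (simp add: X_def side_def)
      next
        case 2
        then have "\<rho>\<^sup>2 < (cmod (x - p))\<^sup>2" using \<rho> by (intro power_strict_mono) auto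
        then show ?thesis using \<zeta>(2)[OF xL 2] by (simp add: X_def side_def)
      qed
    qed
  qed
  have m: "X \<in> borel_measurable lborel" "(\<lambda>x. \<zeta> x * cgrad \<phi> x) \<in> borel_measurable lborel"
    using iX \<zeta>m by auto
  show "integrable lborel (\<lambda>x. \<zeta> x * cgrad \<phi> x)"
    using integrable_cong_AE[OF m ae] iX by simp
  have "(\<integral>x. \<zeta> x * cgrad \<phi> x \<partial>lborel) = (\<integral>x. X x \<partial>lborel)"
    using integral_cong_AE[OF m ae] by simp
  also have "\<dots> = complex_of_real a * (\<integral>x. indicator (side 1 p \<rho>) x *\<^sub>R (\<xi>i x * cgrad \<phi> x) \<partial>lborel)
      + complex_of_real b * (\<integral>x. indicator (side (- 1) p \<rho>) x *\<^sub>R (\<xi>o x * cgrad \<phi> x) \<partial>lborel)"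
    unfolding X_def Bochner_Integration.integral_add[OF iab] integral_mult_right_zero ..
  finally show "(\<integral>x. \<zeta> x * cgrad \<phi> x \<partial>lborel) = 2 * disk_area *
      (complex_of_real a * circle_mean (\<lambda>x. complex_of_real (\<phi> x) * (\<xi>i x * (x - p))) p \<rho>
       - complex_of_real b * circle_mean (\<lambda>x. complex_of_real (\<phi> x) * (\<xi>o x * (x - p))) p \<rho>)"
    unfolding gi(1) go(1) by (simp add: algebra_simps)
qed

lemma circle_mean_cnj: "circle_mean (\<lambda>x. cnj (f x)) p \<rho> = cnj (circle_mean f p \<rho>)"
proof -
  have "(\<integral>t. indicator {0..2 * pi} t *\<^sub>R cnj (f (p + complex_of_real \<rho> * cis t)) \<partial>lborel)
      = cnj (\<integral>t. indicator {0..2 * pi} t *\<^sub>R f (p + complex_of_real \<rho> * cis t) \<partial>lborel)"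
    by (subst Bochner_Integration.integral_cnj[symmetric]) (simp only: complex_cnj_scaleR)
  then show ?thesis by (simp add: circle_mean_def set_lebesgue_integral_def)
qed

text \<open>
  The contributions of the two sides of a circle when the fields there are reflections of each other.  For equal weights \<open>a = b\<close> the result
  is real, and for opposite weights \<open>a = - b\<close> it is imaginary: the reflected field is curl-free across the circle, and
  divergence-free across it after the change of sign.
\<close>

lemma reflection_green:
  assumes \<rho>: "\<rho> > 0" and \<phi>: "test_function \<phi>"
    and L: "closed L" "L \<subseteq> N" "\<And>x. x \<notin> L \<Longrightarrow> \<phi> x = 0" and N: "open N"
    and i: "\<xi>i holomorphic_on (side 1 p \<rho> \<inter> N)" "continuous_on (closed_side 1 p \<rho> \<inter> N) \<xi>i"
    and o: "\<xi>o holomorphic_on (side (- 1) p \<rho> \<inter> N)" "continuous_on (closed_side (- 1) p \<rho> \<inter> N) \<xi>o"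
    and \<zeta>: "\<And>x. x \<in> L \<Longrightarrow> cmod (x - p) < \<rho> \<Longrightarrow> \<zeta> x = complex_of_real a * \<xi>i x"
      "\<And>x. x \<in> L \<Longrightarrow> cmod (x - p) > \<rho> \<Longrightarrow> \<zeta> x = complex_of_real b * \<xi>o x"
    and \<zeta>m: "(\<lambda>x. \<zeta> x * cgrad \<phi> x) \<in> borel_measurable borel"
    and refl: "\<And>x. x \<in> L \<Longrightarrow> cmod (x - p) = \<rho> \<Longrightarrow> \<xi>i x * (x - p) = - cnj (\<xi>o x * (x - p))"
    and G: "G = circle_mean (\<lambda>x. complex_of_real (\<phi> x) * (\<xi>o x * (x - p))) p \<rho>"
  shows "(\<integral>x. \<zeta> x * cgrad \<phi> x \<partial>lborel) = - (2 * disk_area * (complex_of_real a * cnj G + complex_of_real b * G))"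
    and "integrable lborel (\<lambda>x. \<zeta> x * cgrad \<phi> x)"
proof -
  have "circle_mean (\<lambda>x. complex_of_real (\<phi> x) * (\<xi>i x * (x - p))) p \<rho>
      = circle_mean (\<lambda>x. - 1 * cnj (complex_of_real (\<phi> x) * (\<xi>o x * (x - p)))) p \<rho>"
  proof (rule circle_mean_cong[OF _ \<rho>])
    fix x assume x: "cmod (x - p) = \<rho>"
    show "complex_of_real (\<phi> x) * (\<xi>i x * (x - p)) = - 1 * cnj (complex_of_real (\<phi> x) * (\<xi>o x * (x - p)))"
      using refl[OF _ x] L(3)[of x] by (cases "x \<in> L") auto
  qed
  also have "\<dots> = - cnj G" unfolding circle_mean_mult circle_mean_cnj G by simp
  finally have *: "circle_mean (\<lambda>x. complex_of_real (\<phi> x) * (\<xi>i x * (x - p))) p \<rho> = - cnj G" .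
  have T: "(\<integral>x. \<zeta> x * cgrad \<phi> x \<partial>lborel) = 2 * disk_area *
      (complex_of_real a * circle_mean (\<lambda>x. complex_of_real (\<phi> x) * (\<xi>i x * (x - p))) p \<rho>
       - complex_of_real b * circle_mean (\<lambda>x. complex_of_real (\<phi> x) * (\<xi>o x * (x - p))) p \<rho>)"
    "integrable lborel (\<lambda>x. \<zeta> x * cgrad \<phi> x)"
    by (rule two_sided_green[OF \<rho> \<phi> L N i o \<zeta> \<zeta>m]; assumption)+
  show "integrable lborel (\<lambda>x. \<zeta> x * cgrad \<phi> x)" using T(2) .
  show "(\<integral>x. \<zeta> x * cgrad \<phi> x \<partial>lborel) = - (2 * disk_area * (complex_of_real a * cnj G + complex_of_real b * G))"
    using T(1) unfolding * G[symmetric] by algebra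
qed

section \<open>The field obtained by reflections\<close>

text \<open>
  \<open>P\<close> plays the role of \<open>\<partial>\<^sub>1 U - \<i> \<partial>\<^sub>2 U\<close> inside \<open>B_q\<close>.  The assumption \<open>gap\<close> says that the reflections of the shell and of the core stay
  inside \<open>B_q\<close>.
\<close>

locale superlens =
  fixes R q \<rho> :: real and z0 :: complex and P :: "complex \<Rightarrow> complex"
  assumes R: "R > 1" and q: "R < q" and \<rho>: "\<rho> > 0"
    and unit: "ball z0 \<rho> \<subseteq> ball 0 1"
    and gap: "R\<^sup>2 / q < \<rho> - cmod z0"
    and Pm[measurable]: "P \<in> borel_measurable borel"
    and Pc: "continuous_on (cball 0 q) P" and Ph: "P holomorphic_on ball 0 q"
begin

text \<open>
  The derivative of \<open>H (m x)\<close> if \<open>P = H'\<close>, where \<open>m\<close> is the inversion in the boundary of the core followed by the one in \<open>\<partial>B_R\<close>.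
\<close>

definition core_field :: "complex \<Rightarrow> complex"
  where "core_field x = P (R\<^sup>2 * (x - z0) / (cnj z0 * (x - z0) + \<rho>\<^sup>2)) * (R\<^sup>2 * \<rho>\<^sup>2 / (cnj z0 * (x - z0) + \<rho>\<^sup>2)\<^sup>2)"

text \<open>
  The complex gradient of \<open>U (s\<^sup>2 / cnj x)\<close>, the composition with the inversion in the circle of radius \<open>s\<close>.
\<close>

definition reflected :: "real \<Rightarrow> complex \<Rightarrow> complex"
  where "reflected s x = - (s\<^sup>2 / x\<^sup>2) * cnj (P (cnj (s\<^sup>2 / x)))"

definition field :: "complex \<Rightarrow> complex"
  where "field x = (if x \<in> ball z0 \<rho> then core_field x else if cmod x < R then reflected R x
    else if cmod x < q then P x else reflected q x)"

lemma q0: "q > 0" using R q by simp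

lemma side_ball: "s > 0 \<Longrightarrow> side 1 p s = ball p s" "s > 0 \<Longrightarrow> closed_side 1 p s = cball p s"
  "s > 0 \<Longrightarrow> side (- 1) p s = - cball p s" "s > 0 \<Longrightarrow> closed_side (- 1) p s = - ball p s"
proof -
  assume s: "s > 0"
  have le: "s\<^sup>2 \<le> (cmod (x - p))\<^sup>2 \<longleftrightarrow> s \<le> cmod (x - p)"
    "(cmod (x - p))\<^sup>2 \<le> s\<^sup>2 \<longleftrightarrow> cmod (x - p) \<le> s" for x
    using s by simp_all
  have lt: "s\<^sup>2 < (cmod (x - p))\<^sup>2 \<longleftrightarrow> s < cmod (x - p)"
    "(cmod (x - p))\<^sup>2 < s\<^sup>2 \<longleftrightarrow> cmod (x - p) < s" for x
    using le[of x] by linarith+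
  have d: "dist p x = cmod (x - p)" for x by (simp add: dist_norm norm_minus_commute)
  show "side 1 p s = ball p s" by (simp add: side_def set_eq_iff d lt)
  show "closed_side 1 p s = cball p s" by (simp add: closed_side_def set_eq_iff d le)
  show "side (- 1) p s = - cball p s" by (simp add: side_def set_eq_iff d lt not_le)
  show "closed_side (- 1) p s = - ball p s" by (simp add: closed_side_def set_eq_iff d le not_less)
qed

lemma reflected_holomorphic: "s > 0 \<Longrightarrow> reflected s holomorphic_on {x. s\<^sup>2 / q < cmod x}"
proof -
  assume s: "s > 0"
  have sq: "s\<^sup>2 / q > 0" using s q0 by simp
  have sub: "(\<lambda>x. complex_of_real (s\<^sup>2) / x) ` {x. s\<^sup>2 / q < cmod x} \<subseteq> ball 0 q"
  proof safe
    fix x :: complex assume x: "s\<^sup>2 / q < cmod x"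
    then have "cmod x > 0" using sq by linarith
    then show "complex_of_real (s\<^sup>2) / x \<in> ball 0 q"
      using x q0 by (simp add: norm_divide norm_power field_simps)
  qed
  have "cnj \<circ> P \<circ> cnj holomorphic_on ball 0 q"
    by (rule holomorphic_on_compose_cnj_cnj) (use Ph in \<open>auto intro: holomorphic_on_subset\<close>)
  then have "(cnj \<circ> P \<circ> cnj) \<circ> (\<lambda>x. complex_of_real (s\<^sup>2) / x) holomorphic_on {x. s\<^sup>2 / q < cmod x}"
    by (rule holomorphic_on_compose_gen[rotated, OF _ sub])
      (use sq in \<open>auto intro!: holomorphic_intros\<close>)
  then have "(\<lambda>x. cnj (P (cnj (s\<^sup>2 / x)))) holomorphic_on {x. s\<^sup>2 / q < cmod x}"
    by (simp add: o_def)
  then show ?thesis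
    unfolding reflected_def[abs_def] by (intro holomorphic_intros) (use sq in auto)
qed

lemma far_continuous: "continuous_on (- ball 0 q) (reflected q)"
proof -
  have "continuous_on (- ball 0 q) (\<lambda>x. P (cnj (complex_of_real (q\<^sup>2) / x)))"
  proof (rule continuous_on_compose2[OF Pc])
    show "continuous_on (- ball 0 q) (\<lambda>x. cnj (complex_of_real (q\<^sup>2) / x))"
      by (intro continuous_intros) (use q0 in auto)
    show "(\<lambda>x. cnj (complex_of_real (q\<^sup>2) / x)) ` (- ball 0 q) \<subseteq> cball 0 q"
    proof safe
      fix x :: complex assume "x \<notin> ball 0 q"
      then have x: "q \<le> cmod x" by simp
      then have "q\<^sup>2 / cmod x \<le> q" using q0 by (simp add: divide_le_eq power2_eq_square)
      then show "cnj (complex_of_real (q\<^sup>2) / x) \<in> cball 0 q"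
        by (simp add: norm_divide norm_power)
    qed
  qed
  then show ?thesis unfolding reflected_def[abs_def]
    by (intro continuous_intros) (use q0 in auto)
qed

text \<open>
  The Moebius map of the core takes values in \<open>B_q\<close>: this is where \<open>gap\<close> enters.
\<close>

lemma core_denominator:
  assumes "cmod (x - z0) \<le> \<rho>"
  shows "cmod (cnj z0 * (x - z0) + \<rho>\<^sup>2) \<ge> \<rho> * (\<rho> - cmod z0)" "\<rho> * (\<rho> - cmod z0) > 0"
    and "cmod (R\<^sup>2 * (x - z0) / (cnj z0 * (x - z0) + \<rho>\<^sup>2)) < q"
proof -
  have "R\<^sup>2 / q > 0" using R q0 by simp
  then have g0: "\<rho> - cmod z0 > 0" using gap by linarith
  then show pos: "\<rho> * (\<rho> - cmod z0) > 0" using \<rho> by simp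
  have "cmod (cnj z0 * (x - z0)) \<le> cmod z0 * \<rho>" using assms by (simp add: norm_mult mult_left_mono)
  moreover have "cmod (complex_of_real (\<rho>\<^sup>2)) - cmod (cnj z0 * (x - z0)) \<le> cmod (cnj z0 * (x - z0) + complex_of_real (\<rho>\<^sup>2))"
    using norm_triangle_ineq2[of "complex_of_real (\<rho>\<^sup>2)" "- (cnj z0 * (x - z0))"] by (simp add: add.commute)
  moreover have "cmod (complex_of_real (\<rho>\<^sup>2)) = \<rho>\<^sup>2" by (simp only: norm_of_real abs_power2)
  ultimately have "\<rho>\<^sup>2 - cmod z0 * \<rho> \<le> cmod (cnj z0 * (x - z0) + complex_of_real (\<rho>\<^sup>2))" by linarith
  moreover have "\<rho>\<^sup>2 - cmod z0 * \<rho> = \<rho> * (\<rho> - cmod z0)" by (simp add: power2_eq_square algebra_simps)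
  ultimately show le: "cmod (cnj z0 * (x - z0) + \<rho>\<^sup>2) \<ge> \<rho> * (\<rho> - cmod z0)" by linarith
  have "cmod (R\<^sup>2 * (x - z0) / (cnj z0 * (x - z0) + \<rho>\<^sup>2)) = R\<^sup>2 * cmod (x - z0) / cmod (cnj z0 * (x - z0) + \<rho>\<^sup>2)"
    by (simp add: norm_divide norm_mult norm_power)
  also have "\<dots> \<le> R\<^sup>2 * \<rho> / (\<rho> * (\<rho> - cmod z0))"
    using le pos assms \<rho> by (intro frac_le mult_left_mono) auto
  also have "\<dots> = R\<^sup>2 / (\<rho> - cmod z0)" using \<rho> by simp
  also have "\<dots> < q" using gap g0 q0 by (simp add: field_simps)
  finally show "cmod (R\<^sup>2 * (x - z0) / (cnj z0 * (x - z0) + \<rho>\<^sup>2)) < q" .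
qed

lemma core_holomorphic: "core_field holomorphic_on ball z0 \<rho>"
  and core_continuous: "continuous_on (cball z0 \<rho>) core_field"
proof -
  have nz: "cnj z0 * (x - z0) + complex_of_real (\<rho>\<^sup>2) \<noteq> 0" if "cmod (x - z0) \<le> \<rho>" for x
    using core_denominator(1,2)[OF that] by auto
  have m: "(\<lambda>x. complex_of_real (R\<^sup>2) * (x - z0) / (cnj z0 * (x - z0) + complex_of_real (\<rho>\<^sup>2))) holomorphic_on ball z0 \<rho>"
    by (intro holomorphic_intros) (use nz in \<open>auto simp: dist_norm norm_minus_commute\<close>)
  have "P \<circ> (\<lambda>x. complex_of_real (R\<^sup>2) * (x - z0) / (cnj z0 * (x - z0) + complex_of_real (\<rho>\<^sup>2))) holomorphic_on ball z0 \<rho>"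
    by (rule holomorphic_on_compose_gen[OF m Ph])
      (use core_denominator(3) in \<open>auto simp: dist_norm norm_minus_commute\<close>)
  then have "(\<lambda>x. P (complex_of_real (R\<^sup>2) * (x - z0) / (cnj z0 * (x - z0) + complex_of_real (\<rho>\<^sup>2)))) holomorphic_on ball z0 \<rho>"
    by (simp add: o_def)
  then show "core_field holomorphic_on ball z0 \<rho>"
    unfolding core_field_def[abs_def] by (intro holomorphic_intros) (use nz in \<open>auto simp: dist_norm norm_minus_commute\<close>)
  have "continuous_on (cball z0 \<rho>) (\<lambda>x. P (complex_of_real (R\<^sup>2) * (x - z0) / (cnj z0 * (x - z0) + complex_of_real (\<rho>\<^sup>2))))"
  proof (rule continuous_on_compose2[OF Pc])
    show "continuous_on (cball z0 \<rho>) (\<lambda>x. complex_of_real (R\<^sup>2) * (x - z0) / (cnj z0 * (x - z0) + complex_of_real (\<rho>\<^sup>2)))"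
      by (intro continuous_intros) (use nz in \<open>auto simp: dist_norm norm_minus_commute\<close>)
    show "(\<lambda>x. complex_of_real (R\<^sup>2) * (x - z0) / (cnj z0 * (x - z0) + complex_of_real (\<rho>\<^sup>2))) ` cball z0 \<rho> \<subseteq> cball 0 q"
    proof safe
      fix x assume "x \<in> cball z0 \<rho>"
      then have "cmod (x - z0) \<le> \<rho>" by (simp add: dist_norm norm_minus_commute)
      then show "complex_of_real (R\<^sup>2) * (x - z0) / (cnj z0 * (x - z0) + complex_of_real (\<rho>\<^sup>2)) \<in> cball 0 q"
        using core_denominator(3)[of x] by (simp only: mem_cball_0 less_imp_le)
    qed
  qed
  then show "continuous_on (cball z0 \<rho>) core_field"
    unfolding core_field_def[abs_def] by (intro continuous_intros) (use nz in \<open>auto simp: dist_norm norm_minus_commute\<close>)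
qed

lemma reflected_same_circle:
  assumes "cmod x = s" "s > 0"
  shows "P x * (x - 0) = - cnj (reflected s x * (x - 0))"
    and "reflected s x * (x - 0) = - cnj (P x * (x - 0))"
proof -
  have x0: "x \<noteq> 0" using assms by auto
  have "complex_of_real (s\<^sup>2) = x * cnj x" unfolding assms(1)[symmetric] by (rule complex_norm_square)
  then have c: "complex_of_real (s\<^sup>2) / x = cnj x" using x0 by simp
  have "complex_of_real (s\<^sup>2) / x\<^sup>2 * x = cnj x" using c x0 by (simp add: power2_eq_square)
  note d = this
  have "reflected s x * (x - 0) = - (complex_of_real (s\<^sup>2) / x\<^sup>2 * x) * cnj (P (cnj (complex_of_real (s\<^sup>2) / x)))"
    by (simp add: reflected_def)
  also have "\<dots> = - cnj x * cnj (P (cnj (cnj x)))" by (simp only: c d)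
  finally show "reflected s x * (x - 0) = - cnj (P x * (x - 0))" by simp
  then show "P x * (x - 0) = - cnj (reflected s x * (x - 0))"
    by simp
qed

text \<open>
  On the boundary of the core \<open>\<rho>\<^sup>2 = (x - z0) cnj (x - z0)\<close>, which turns the denominator \<open>cnj z0 (x - z0) + \<rho>\<^sup>2\<close> into \<open>(x - z0) cnj x\<close>.
\<close>

lemma core_shell_circle:
  assumes x: "cmod (x - z0) = \<rho>" and x0: "x \<noteq> 0"
  shows "core_field x * (x - z0) = - cnj (reflected R x * (x - z0))"
proof -
  define y where "y = x - z0"
  have y0: "y \<noteq> 0" using x \<rho> by (auto simp: y_def)
  have r2: "complex_of_real (\<rho>\<^sup>2) = y * cnj y" unfolding x[symmetric] y_def by (rule complex_norm_square)
  have den: "cnj z0 * y + complex_of_real (\<rho>\<^sup>2) = y * cnj x"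
    unfolding r2 by (simp add: y_def algebra_simps)
  have c: "cnj (complex_of_real (R\<^sup>2) / x) = complex_of_real (R\<^sup>2) / cnj x" by simp
  have "core_field x * y = P (complex_of_real (R\<^sup>2) * y / (y * cnj x)) * (complex_of_real (R\<^sup>2) * (y * cnj y) / (y * cnj x)\<^sup>2) * y"
    unfolding core_field_def y_def[symmetric] den r2[symmetric] by simp
  also have "complex_of_real (R\<^sup>2) * y / (y * cnj x) = complex_of_real (R\<^sup>2) / cnj x" using y0 by simp
  also have "P (complex_of_real (R\<^sup>2) / cnj x) * (complex_of_real (R\<^sup>2) * (y * cnj y) / (y * cnj x)\<^sup>2) * y
      = P (complex_of_real (R\<^sup>2) / cnj x) * (complex_of_real (R\<^sup>2) / (cnj x)\<^sup>2) * cnj y"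
    using y0 x0 by (simp add: power2_eq_square field_simps)
  also have "\<dots> = - cnj (reflected R x * y)"
    unfolding reflected_def c by simp
  finally show ?thesis by (simp add: y_def)
qed

lemma field_measurable [measurable]: "field \<in> borel_measurable borel"
proof -
  have [measurable]: "cnj \<in> borel_measurable borel"
    by (intro borel_measurable_continuous_onI continuous_intros)
  have [measurable]: "core_field \<in> borel_measurable borel" "reflected s \<in> borel_measurable borel" for s
    unfolding core_field_def[abs_def] reflected_def[abs_def] by measurable
  have [measurable]: "ball z0 \<rho> \<in> sets borel" by simp
  show ?thesis unfolding field_def[abs_def] by measurable
qed

lemma ball_core: "x \<in> ball z0 \<rho> \<Longrightarrow> cmod x < 1"
  using unit by auto

lemma cball_core: "cmod (x - z0) \<le> \<rho> \<Longrightarrow> cmod x \<le> 1"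
proof -
  assume "cmod (x - z0) \<le> \<rho>"
  then have "x \<in> cball z0 \<rho>" by (simp add: dist_norm norm_minus_commute)
  moreover have "closure (ball z0 \<rho>) \<subseteq> closure (ball 0 1)" using unit by (rule closure_mono)
  ultimately show ?thesis using \<rho> by auto
qed

lemma outside_core: "cmod (x - z0) \<ge> \<rho> \<Longrightarrow> cmod x \<ge> \<rho> - cmod z0"
  using norm_triangle_ineq4[of x z0] by linarith

lemma field_bounds: "\<exists>C. \<forall>x. cmod (field x) \<le> C \<and> cmod (field x) * (cmod x)\<^sup>2 \<le> C"
proof -
  have "bounded (P ` cball 0 q)" using Pc by (intro compact_imp_bounded compact_continuous_image compact_cball)
  then obtain B where B: "\<forall>y\<in>P ` cball 0 q. norm y \<le> B" unfolding bounded_iff by blast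
  have B0: "cmod (P y) \<le> \<bar>B\<bar>" if "cmod y \<le> q" for y
    using B that by (force intro: order_trans[OF _ abs_ge_self])
  have "bounded (core_field ` cball z0 \<rho>)"
    using core_continuous by (intro compact_imp_bounded compact_continuous_image compact_cball)
  then obtain B1 where B1: "\<forall>y\<in>core_field ` cball z0 \<rho>. norm y \<le> B1" unfolding bounded_iff by blast
  define d where "d = \<rho> - cmod z0"
  have "R\<^sup>2 / q > 0" using R q0 by simp
  then have d: "d > 0" "R\<^sup>2 / q < d" using gap by (auto simp: d_def)
  have refl: "cmod (reflected s x) \<le> s\<^sup>2 / (cmod x)\<^sup>2 * \<bar>B\<bar>" if "s\<^sup>2 / q \<le> cmod x" "cmod x > 0" for s x
  proof -
    have "cmod (cnj (complex_of_real (s\<^sup>2) / x)) \<le> q"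
      using that q0 by (simp add: norm_divide norm_power field_simps)
    then have "cmod (P (cnj (complex_of_real (s\<^sup>2) / x))) \<le> \<bar>B\<bar>" by (rule B0)
    then show ?thesis
      by (simp add: reflected_def norm_mult norm_divide norm_power divide_right_mono mult_left_mono)
  qed
  define C0 where "C0 = \<bar>B1\<bar> + R\<^sup>2 / d\<^sup>2 * \<bar>B\<bar> + \<bar>B\<bar>"
  have C0: "C0 \<ge> 0" by (simp add: C0_def)
  have C0': "\<bar>B1\<bar> \<le> C0" "R\<^sup>2 / d\<^sup>2 * \<bar>B\<bar> \<le> C0" "\<bar>B\<bar> \<le> C0" by (simp_all add: C0_def)
  have near: "cmod (field x) \<le> C0" if "cmod x < q" for x
  proof -
    consider "x \<in> ball z0 \<rho>" | "x \<notin> ball z0 \<rho>" "cmod x < R" | "x \<notin> ball z0 \<rho>" "\<not> cmod x < R" by blast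
    then show ?thesis
    proof cases
      case 1
      then have "cmod (core_field x) \<le> B1" using B1 by auto
      then show ?thesis using 1 C0' by (simp add: field_def)
    next
      case 2
      then have dx: "d \<le> cmod x" using outside_core[of x] by (simp add: d_def dist_norm norm_minus_commute)
      have "cmod (reflected R x) \<le> R\<^sup>2 / (cmod x)\<^sup>2 * \<bar>B\<bar>" by (rule refl) (use dx d in auto)
      also have "\<dots> \<le> R\<^sup>2 / d\<^sup>2 * \<bar>B\<bar>"
        using dx d by (intro mult_right_mono divide_left_mono power_mono mult_pos_pos zero_less_power) auto
      finally show ?thesis using 2 C0' by (simp add: field_def)
    next
      case 3
      then show ?thesis using B0[of x] that C0' by (simp add: field_def)
    qed
  qed
  have far: "cmod (field x) \<le> q\<^sup>2 / (cmod x)\<^sup>2 * \<bar>B\<bar>" if x: "cmod x \<ge> q" for x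
  proof -
    have "x \<notin> ball z0 \<rho>" using ball_core[of x] x R q by auto
    then have "field x = reflected q x" using x R q by (simp add: field_def)
    moreover have "cmod x > 0" "q\<^sup>2 / q = q" using x q0 by (auto simp: power2_eq_square)
    ultimately show ?thesis using refl[of q x] x by simp
  qed
  have "cmod (field x) \<le> C0 * (1 + q\<^sup>2) \<and> cmod (field x) * (cmod x)\<^sup>2 \<le> C0 * (1 + q\<^sup>2)" for x
  proof (cases "cmod x < q")
    case True
    have "cmod (field x) * (cmod x)\<^sup>2 \<le> C0 * q\<^sup>2"
      using near[OF True] True C0 by (intro mult_mono power_mono) auto
    moreover have "0 \<le> C0 * q\<^sup>2" using C0 by simp
    moreover have "C0 * (1 + q\<^sup>2) = C0 + C0 * q\<^sup>2" by (simp add: distrib_left)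
    ultimately show ?thesis using near[OF True] C0 by linarith
  next
    case False
    then have x: "cmod x \<ge> q" "cmod x > 0" using q0 by auto
    have "q\<^sup>2 / (cmod x)\<^sup>2 \<le> 1" using x q0 by (simp add: divide_le_eq power_mono)
    then have "q\<^sup>2 / (cmod x)\<^sup>2 * \<bar>B\<bar> \<le> 1 * \<bar>B\<bar>" by (intro mult_right_mono) auto
    then have 1: "cmod (field x) \<le> C0" using far[OF x(1)] C0' by linarith
    have "cmod (field x) * (cmod x)\<^sup>2 \<le> q\<^sup>2 / (cmod x)\<^sup>2 * \<bar>B\<bar> * (cmod x)\<^sup>2"
      using far[OF x(1)] by (intro mult_right_mono) auto
    also have "\<dots> = q\<^sup>2 * \<bar>B\<bar>" using x by simp
    also have "\<dots> \<le> q\<^sup>2 * C0" using C0' by (intro mult_left_mono) auto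
    finally have 2: "cmod (field x) * (cmod x)\<^sup>2 \<le> q\<^sup>2 * C0" .
    moreover have "0 \<le> q\<^sup>2 * C0" using C0 by simp
    moreover have "C0 * (1 + q\<^sup>2) = C0 + q\<^sup>2 * C0" by (simp add: algebra_simps)
    ultimately show ?thesis using 1 C0 by linarith
  qed
  then show ?thesis by blast
qed

end

text \<open>
  Decay like \<open>|x|\<^sup>-\<^sup>2\<close> suffices in the plane, by summation over dyadic disks: on the annulus of outer radius \<open>2\<^sup>k\<close> the square of
  \<open>f\<close> is at most \<open>16 C\<^sup>2 / 16\<^sup>k\<close>, and the area is at most a multiple of \<open>4\<^sup>k\<close>.
\<close>

lemma square_integrable_decay:
  assumes m[measurable]: "f \<in> borel_measurable borel"
    and b: "\<And>x. cmod (f x) \<le> C" "\<And>x. cmod (f x) * (cmod x)\<^sup>2 \<le> C"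
  shows "square_integrable f"
proof -
  have C: "C \<ge> 0" using b(1) norm_ge_zero order_trans by blast
  define v where "v = emeasure lborel (ball (0::complex) 1)"
  define g where "g k x = ennreal (16 * C\<^sup>2 * (1 / 16) ^ k) * indicator (ball (0::complex) (2 ^ k)) x" for k :: nat and x
  have gm[measurable]: "g k \<in> borel_measurable borel" for k
    unfolding g_def[abs_def] by (intro borel_measurable_times_ennreal borel_measurable_indicator) auto
  have dom: "ennreal ((cmod (f x))\<^sup>2) \<le> (\<Sum>k. g k x)" for x
  proof -
    define k where "k = (LEAST k. cmod x < 2 ^ k)"
    obtain n where "cmod x < 2 ^ n" using real_arch_pow[of 2 "cmod x"] by auto
    then have k: "cmod x < 2 ^ k" unfolding k_def by (rule LeastI)
    have "(cmod (f x))\<^sup>2 \<le> 16 * C\<^sup>2 * (1 / 16) ^ k"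
    proof (cases k)
      case 0
      have "(cmod (f x))\<^sup>2 \<le> C\<^sup>2" using b(1) by (intro power_mono) auto
      also have "C\<^sup>2 \<le> 16 * C\<^sup>2 * (1 / 16) ^ k" using 0 zero_le_power2[of C] by simp
      finally show ?thesis .
    next
      case (Suc j)
      have "\<not> cmod x < 2 ^ j" using not_less_Least[of j "\<lambda>k. cmod x < 2 ^ k"] Suc by (simp add: k_def)
      then have "2 ^ j \<le> cmod x" by simp
      then have "(2 ^ j)\<^sup>2 \<le> (cmod x)\<^sup>2" by (intro power_mono) auto
      then have "cmod (f x) * (2 ^ j)\<^sup>2 \<le> cmod (f x) * (cmod x)\<^sup>2" by (intro mult_left_mono) auto
      also have "\<dots> \<le> C" by (rule b(2))
      finally have "(cmod (f x) * (2 ^ j)\<^sup>2)\<^sup>2 \<le> C\<^sup>2" by (intro power_mono) auto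
      moreover have "(cmod (f x) * (2 ^ j)\<^sup>2)\<^sup>2 = (cmod (f x))\<^sup>2 * 16 ^ j"
      proof -
        have "((2 :: real) ^ j)\<^sup>2 = (2\<^sup>2) ^ j" "((4 :: real) ^ j)\<^sup>2 = (4\<^sup>2) ^ j"
          by (simp_all only: mult.commute flip: power_mult)
        then have e: "((2 :: real) ^ j)\<^sup>2 = 4 ^ j" "((4 :: real) ^ j)\<^sup>2 = 16 ^ j" by simp_all
        show ?thesis by (simp only: power_mult_distrib e)
      qed
      ultimately have "(cmod (f x))\<^sup>2 * 16 ^ j \<le> C\<^sup>2" by (simp only:)
      then have "(cmod (f x))\<^sup>2 \<le> C\<^sup>2 * (1 / 16) ^ j" by (simp add: power_divide field_simps)
      then show ?thesis using Suc by simp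
    qed
    then have "ennreal ((cmod (f x))\<^sup>2) \<le> g k x" using k by (simp add: g_def ennreal_leI)
    also have "\<dots> \<le> (\<Sum>k. g k x)"
      using sum_le_suminf[of "\<lambda>k. g k x" "{k}"] by simp
    finally show ?thesis .
  qed
  have "(\<integral>\<^sup>+x. ennreal ((cmod (f x))\<^sup>2) \<partial>lborel) \<le> (\<integral>\<^sup>+x. (\<Sum>k. g k x) \<partial>lborel)"
    by (intro nn_integral_mono dom)
  also have "\<dots> = (\<Sum>k. \<integral>\<^sup>+x. g k x \<partial>lborel)" by (rule nn_integral_suminf) simp
  also have "\<dots> = (\<Sum>k. ennreal (16 * C\<^sup>2 * disk_area * (1 / 4) ^ k))"
  proof (rule suminf_cong)
    fix k
    have em: "emeasure lborel (ball (0::complex) (2 ^ k)) = ennreal (disk_area * 4 ^ k)"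
    proof -
      have "emeasure lborel (ball (0::complex) (2 ^ k)) = ennreal (measure lborel (ball (0::complex) (2 ^ k)))"
        using emeasure_lborel_ball_finite[of "0::complex" "2 ^ k"] by (intro emeasure_eq_ennreal_measure) auto
      also have "measure lborel (ball (0::complex) (2 ^ k)) = disk_area * 4 ^ k"
      proof -
        have "((2 :: real) ^ k)\<^sup>2 = (2\<^sup>2) ^ k" by (simp only: mult.commute flip: power_mult)
        then show ?thesis
          using content_ball_conv_unit_ball[of "2 ^ k" "0::complex"] by (simp add: disk_area_def)
      qed
      finally show ?thesis .
    qed
    have "(\<integral>\<^sup>+x. g k x \<partial>lborel) = ennreal (16 * C\<^sup>2 * (1 / 16) ^ k) * emeasure lborel (ball (0::complex) (2 ^ k))"
      unfolding g_def by (rule nn_integral_cmult_indicator) simp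
    also have "\<dots> = ennreal (16 * C\<^sup>2 * (1 / 16) ^ k * (disk_area * 4 ^ k))"
      unfolding em using disk_area_pos by (intro ennreal_mult[symmetric]) auto
    also have "16 * C\<^sup>2 * (1 / 16) ^ k * (disk_area * 4 ^ k) = 16 * C\<^sup>2 * disk_area * ((1 / 16) ^ k * 4 ^ k)"
      by simp
    also have "(1 / 16) ^ k * 4 ^ k = (1 / 4 :: real) ^ k" by (simp flip: power_mult_distrib)
    finally show "(\<integral>\<^sup>+x. g k x \<partial>lborel) = ennreal (16 * C\<^sup>2 * disk_area * (1 / 4) ^ k)" .
  qed
  also have "\<dots> < \<infinity>"
  proof -
    have "summable (\<lambda>k. 16 * C\<^sup>2 * disk_area * (1 / 4) ^ k)"
      by (intro summable_mult summable_geometric) simp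
    then have "(\<Sum>k. ennreal (16 * C\<^sup>2 * disk_area * (1 / 4) ^ k)) = ennreal (\<Sum>k. 16 * C\<^sup>2 * disk_area * (1 / 4) ^ k)"
      using disk_area_pos by (intro suminf_ennreal2) auto
    then show ?thesis by simp
  qed
  finally have "integrable lborel (\<lambda>x. (cmod (f x))\<^sup>2)"
    by (intro integrableI_bounded) auto
  then show ?thesis by (simp add: square_integrable_def)
qed

definition smooth_ramp :: "real \<Rightarrow> real \<Rightarrow> real \<Rightarrow> real"
  where "smooth_ramp u v s = smooth_step (1 / (v - u) * s + (1 - u / (v - u)))"

lemma smooth_ramp_smooth: "smooth_real (smooth_ramp u v)"
  unfolding smooth_ramp_def[abs_def] by (rule smooth_real_affine[OF smooth_step_smooth])

lemma smooth_ramp_eq: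
  assumes "u < v"
  shows "s \<le> u \<Longrightarrow> smooth_ramp u v s = 0" "s \<ge> v \<Longrightarrow> smooth_ramp u v s = 1"
proof -
  have e: "1 / (v - u) * s + (1 - u / (v - u)) = 1 + (s - u) / (v - u)"
    by (simp add: diff_divide_distrib)
  show "smooth_ramp u v s = 0" if "s \<le> u"
  proof -
    have "(s - u) / (v - u) \<le> 0" using that assms by (simp add: divide_le_0_iff)
    then show ?thesis unfolding smooth_ramp_def e by (simp add: smooth_step_eq)
  qed
  show "smooth_ramp u v s = 1" if "s \<ge> v"
  proof -
    have "(s - u) / (v - u) \<ge> 1" using that assms by (simp add: le_divide_eq)
    then show ?thesis unfolding smooth_ramp_def e by (simp add: smooth_step_eq)
  qed
qed

lemma cgrad_add:
  assumes "test_function \<phi>" "test_function \<psi>"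
  shows "cgrad (\<lambda>x. \<phi> x + \<psi> x) x = cgrad \<phi> x + cgrad \<psi> x"
proof -
  note d = has_derivative_add[OF test_functionD(1)[OF assms(1)] test_functionD(1)[OF assms(2)], of x]
  show ?thesis using partial_has_derivative[OF d] by (simp add: cgrad_def complex_eq_iff)
qed

lemma cgrad_measurable:
  assumes "test_function \<phi>"
  shows "cgrad \<phi> \<in> borel_measurable borel"
proof -
  have "continuous_on UNIV (\<lambda>x. complex_of_real (partial1 \<phi> x) + \<i> * complex_of_real (partial2 \<phi> x))"
    by (intro continuous_intros test_functionD(3,4)[OF assms])
  then show ?thesis unfolding cgrad_def[abs_def] Complex_eq by (rule borel_measurable_continuous_onI)
qed

lemma test_function_add:
  assumes "test_function \<phi>" "test_function \<psi>"
  shows "test_function (\<lambda>x. \<phi> x + \<psi> x)"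
proof -
  have "bounded {x. \<phi> x + \<psi> x \<noteq> 0}"
  proof (rule bounded_subset)
    show "bounded (closure {x. \<phi> x \<noteq> 0} \<union> closure {x. \<psi> x \<noteq> 0})"
      using assms by (simp add: test_function_def compact_imp_bounded)
    show "{x. \<phi> x + \<psi> x \<noteq> 0} \<subseteq> closure {x. \<phi> x \<noteq> 0} \<union> closure {x. \<psi> x \<noteq> 0}"
    proof
      fix x assume "x \<in> {x. \<phi> x + \<psi> x \<noteq> 0}"
      then have "x \<in> {x. \<phi> x \<noteq> 0} \<union> {x. \<psi> x \<noteq> 0}" by auto
      then show "x \<in> closure {x. \<phi> x \<noteq> 0} \<union> closure {x. \<psi> x \<noteq> 0}"
        using subsetD[OF closure_subset] by (metis UnE UnI1 UnI2)
    qed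
  qed
  then show ?thesis using assms by (simp add: test_function_def times_cont_diff_add)
qed

context superlens
begin

text \<open>
  The flux \<open>s = - 1\<close> and the field itself, \<open>s = 1\<close>, treated together.
\<close>

definition weighted_field :: "real \<Rightarrow> complex \<Rightarrow> complex"
  where "weighted_field s x = complex_of_real (if x \<in> ball z0 \<rho> then 1 else if cmod x < R then s else 1) * field x"

lemma weighted_field_measurable [measurable]: "weighted_field s \<in> borel_measurable borel"
proof -
  have [measurable]: "ball z0 \<rho> \<in> sets borel" by simp
  show ?thesis unfolding weighted_field_def[abs_def] by measurable
qed

lemma gap_pos: "R\<^sup>2 / q > 0" "\<rho> - cmod z0 > 0" "\<rho> - cmod z0 \<le> 1" "R\<^sup>2 / q < 1"
proof -
  show 1: "R\<^sup>2 / q > 0" using R q0 by simp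
  then show "\<rho> - cmod z0 > 0" using gap by linarith
  show "\<rho> - cmod z0 \<le> 1"
  proof -
    have "cmod (z0 + \<rho>) \<le> 1" by (rule cball_core) (use \<rho> in simp)
    then have "\<rho> \<le> 1 + cmod z0" using norm_triangle_ineq4[of "z0 + complex_of_real \<rho>" z0] \<rho> by simp
    then show ?thesis by simp
  qed
  then show "R\<^sup>2 / q < 1" using gap by linarith
qed

text \<open>
  A radial partition of unity splits \<open>\<phi>\<close> into three test functions, each of which meets only one of the circles \<open>\<partial>\<Sigma>\<close>, \<open>\<partial>B_R\<close>, \<open>\<partial>B_q\<close>.  The
  first transition takes place between the unit circle, which encloses the core, and \<open>\<partial>B_R\<close>.  The coefficient is continuous across \<open>\<partial>B_q\<close>, and there the
  flux of the even reflection jumps by twice its inner value: this is the source.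
\<close>

lemma weighted_field_green:
  assumes \<phi>: "test_function \<phi>"
  shows "integrable lborel (\<lambda>x. weighted_field s x * cgrad \<phi> x)"
    and "\<exists>G1 G2. (\<integral>x. weighted_field s x * cgrad \<phi> x \<partial>lborel) = - (2 * disk_area *
      (cnj G1 + complex_of_real s * G1 + (complex_of_real s * cnj G2 + G2)
        - 2 * complex_of_real (Re (circle_mean (\<lambda>x. complex_of_real (\<phi> x) * (P x * x)) 0 q))))"
proof -
  define u1 v1 u2 v2 where "u1 = 1 + (R\<^sup>2 - 1) / 3" and "v1 = 1 + 2 * (R\<^sup>2 - 1) / 3"
    and "u2 = R\<^sup>2 + (q\<^sup>2 - R\<^sup>2) / 3" and "v2 = R\<^sup>2 + 2 * (q\<^sup>2 - R\<^sup>2) / 3"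
  have "1\<^sup>2 < R\<^sup>2" using R by (intro power_strict_mono) auto
  moreover have "R\<^sup>2 < q\<^sup>2" using R q by (intro power_strict_mono) auto
  ultimately have uv: "1 < u1" "u1 < v1" "v1 < R\<^sup>2" "R\<^sup>2 < u2" "u2 < v2" "v2 < q\<^sup>2"
    by (simp_all add: u1_def v1_def u2_def v2_def field_simps)
  define t1 t2 where "t1 = smooth_ramp u1 v1" and "t2 = smooth_ramp u2 v2"
  have t1: "r \<le> u1 \<Longrightarrow> t1 r = 0" "r \<ge> v1 \<Longrightarrow> t1 r = 1" and t2: "r \<le> u2 \<Longrightarrow> t2 r = 0" "r \<ge> v2 \<Longrightarrow> t2 r = 1" for r
    using smooth_ramp_eq uv by (auto simp: t1_def t2_def)
  have sm: "smooth_real t1" "smooth_real t2" unfolding t1_def t2_def by (rule smooth_ramp_smooth)+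
  define f1 where "f1 = (\<lambda>r. 1 + (- 1) * t1 r)"
  define f2 where "f2 = (\<lambda>r. t1 r + (- 1) * t2 r)"
  have smf: "smooth_real f1" "smooth_real f2"
    unfolding f1_def f2_def by (intro smooth_real_add smooth_real_mult smooth_real_const sm)+
  define \<phi>1 where "\<phi>1 = (\<lambda>x. \<phi> x * f1 ((cmod x)\<^sup>2))"
  define \<phi>2 where "\<phi>2 = (\<lambda>x. \<phi> x * f2 ((cmod x)\<^sup>2))"
  define \<phi>3 where "\<phi>3 = (\<lambda>x. \<phi> x * t2 ((cmod x)\<^sup>2))"
  have T: "test_function \<phi>1" "test_function \<phi>2" "test_function \<phi>3"
    unfolding \<phi>1_def \<phi>2_def \<phi>3_def by (intro test_function_mult_radial \<phi> smf sm)+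
  have sum: "cgrad \<phi> x = cgrad \<phi>1 x + (cgrad \<phi>2 x + cgrad \<phi>3 x)" for x
  proof -
    have "\<phi> = (\<lambda>x. \<phi>1 x + (\<phi>2 x + \<phi>3 x))"
      by (rule ext) (simp add: \<phi>1_def \<phi>2_def \<phi>3_def f1_def f2_def algebra_simps)
    then have "cgrad \<phi> x = cgrad (\<lambda>x. \<phi>1 x + (\<phi>2 x + \<phi>3 x)) x" by (rule arg_cong[where f="\<lambda>f. cgrad f x"])
    also have "\<dots> = cgrad \<phi>1 x + (cgrad \<phi>2 x + cgrad \<phi>3 x)"
      by (simp only: cgrad_add[OF T(1) test_function_add[OF T(2) T(3)]] cgrad_add[OF T(2) T(3)])
    finally show ?thesis .
  qed
  have meas: "(\<lambda>x. weighted_field s x * cgrad \<psi> x) \<in> borel_measurable borel" if "test_function \<psi>" for \<psi>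
    using cgrad_measurable[OF that] by measurable
  have R0: "R > 0" using R by simp
  have sq_less: "cmod x < c" if "(cmod x)\<^sup>2 < c\<^sup>2" "c > 0" for x c
    using that by (simp add: power2_less_imp_less)
  have sq_gt: "c < cmod x" if "c\<^sup>2 < (cmod x)\<^sup>2" for x c
    using that by (rule power2_less_imp_less) simp
  have cl: "closed {x::complex. (cmod x)\<^sup>2 \<le> c}" "closed {x::complex. c \<le> (cmod x)\<^sup>2}" for c
    by (intro closed_Collect_le continuous_intros)+
  define L1 N1 where "L1 = {x::complex. (cmod x)\<^sup>2 \<le> v1}" and "N1 = ball (0::complex) R"
  define L2 N2 where "L2 = {x::complex. (cmod x)\<^sup>2 \<le> v2} \<inter> {x. u1 \<le> (cmod x)\<^sup>2}" and "N2 = ball (0::complex) q \<inter> - cball 0 1"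
  define L3 N3 where "L3 = {x::complex. u2 \<le> (cmod x)\<^sup>2}" and "N3 = - cball (0::complex) R"
  have LN: "closed L1" "L1 \<subseteq> N1" "closed L2" "L2 \<subseteq> N2" "closed L3" "L3 \<subseteq> N3" "open N1" "open N2" "open N3"
  proof -
    show "closed L1" "closed L2" "closed L3" unfolding L1_def L2_def L3_def by (intro closed_Int cl)+
    show "open N1" "open N2" "open N3" unfolding N1_def N2_def N3_def by auto
    show "L1 \<subseteq> N1"
    proof
      fix x assume "x \<in> L1"
      then have "(cmod x)\<^sup>2 < R\<^sup>2" using uv by (simp add: L1_def)
      then show "x \<in> N1" using sq_less R0 by (simp add: N1_def)
    qed
    show "L2 \<subseteq> N2"
    proof
      fix x assume "x \<in> L2"
      then have "(cmod x)\<^sup>2 < q\<^sup>2" "1\<^sup>2 < (cmod x)\<^sup>2" using uv by (simp_all add: L2_def)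
      then show "x \<in> N2" using sq_less[of x q] q0 sq_gt[of 1 x] by (simp add: N2_def not_le)
    qed
    show "L3 \<subseteq> N3"
    proof
      fix x assume "x \<in> L3"
      then have "R\<^sup>2 < (cmod x)\<^sup>2" using uv by (simp add: L3_def)
      then show "x \<in> N3" using sq_gt[of R x] by (simp add: N3_def not_le)
    qed
  qed
  have z: "x \<notin> L1 \<Longrightarrow> \<phi>1 x = 0" "x \<notin> L2 \<Longrightarrow> \<phi>2 x = 0" "x \<notin> L3 \<Longrightarrow> \<phi>3 x = 0" for x
  proof -
    show "x \<notin> L1 \<Longrightarrow> \<phi>1 x = 0" using t1(2)[of "(cmod x)\<^sup>2"] by (simp add: L1_def \<phi>1_def f1_def)
    show "x \<notin> L3 \<Longrightarrow> \<phi>3 x = 0" using t2(1)[of "(cmod x)\<^sup>2"] by (simp add: L3_def \<phi>3_def)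
    assume "x \<notin> L2"
    then consider "v2 < (cmod x)\<^sup>2" | "(cmod x)\<^sup>2 < u1" by (auto simp: L2_def)
    then show "\<phi>2 x = 0"
    proof cases
      case 1 then show ?thesis using t1(2)[of "(cmod x)\<^sup>2"] t2(2)[of "(cmod x)\<^sup>2"] uv by (simp add: \<phi>2_def f2_def)
    next
      case 2 then show ?thesis using t1(1)[of "(cmod x)\<^sup>2"] t2(1)[of "(cmod x)\<^sup>2"] uv by (simp add: \<phi>2_def f2_def)
    qed
  qed
  have gx: "R\<^sup>2 / q < cmod x" if "\<rho> \<le> cmod (x - z0)" for x
    using outside_core[OF that] gap by linarith
  have shell: "reflected R holomorphic_on A" if "\<And>x. x \<in> A \<Longrightarrow> R\<^sup>2 / q < cmod x" for A
    using reflected_holomorphic[OF R0] by (rule holomorphic_on_subset) (use that in auto)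
  note shellc = holomorphic_on_imp_continuous_on[OF shell]
  have nocore: "x \<notin> ball z0 \<rho>" if "1 \<le> cmod x" for x using ball_core[of x] that by linarith
  define G1 where "G1 = circle_mean (\<lambda>x. complex_of_real (\<phi>1 x) * (reflected R x * (x - z0))) z0 \<rho>"
  define G2 where "G2 = circle_mean (\<lambda>x. complex_of_real (\<phi>2 x) * (P x * (x - 0))) 0 R"
  define G3 where "G3 = circle_mean (\<lambda>x. complex_of_real (\<phi>3 x) * (reflected q x * (x - 0))) 0 q"
  have I1: "(\<integral>x. weighted_field s x * cgrad \<phi>1 x \<partial>lborel)
      = - (2 * disk_area * (complex_of_real 1 * cnj G1 + complex_of_real s * G1))"
    "integrable lborel (\<lambda>x. weighted_field s x * cgrad \<phi>1 x)"
  proof -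
    have 1: "core_field holomorphic_on side 1 z0 \<rho> \<inter> N1"
      by (rule holomorphic_on_subset[OF core_holomorphic]) (simp add: side_ball(1)[OF \<rho>])
    have 2: "continuous_on (closed_side 1 z0 \<rho> \<inter> N1) core_field"
      by (rule continuous_on_subset[OF core_continuous]) (simp add: side_ball(2)[OF \<rho>])
    have 3: "reflected R holomorphic_on side (- 1) z0 \<rho> \<inter> N1"
      by (rule shell) (auto intro!: gx simp: side_ball(3)[OF \<rho>] dist_norm norm_minus_commute)
    have 4: "continuous_on (closed_side (- 1) z0 \<rho> \<inter> N1) (reflected R)"
      by (rule shellc) (auto intro!: gx simp: side_ball(4)[OF \<rho>] dist_norm norm_minus_commute)
    have 5: "weighted_field s x = complex_of_real 1 * core_field x" if "x \<in> L1" "cmod (x - z0) < \<rho>" for x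
      using that by (simp add: weighted_field_def field_def dist_norm norm_minus_commute)
    have 6: "weighted_field s x = complex_of_real s * reflected R x" if "x \<in> L1" "\<rho> < cmod (x - z0)" for x
    proof -
      have "x \<in> N1" using that(1) LN(2) by blast
      then show ?thesis using that(2) by (simp add: weighted_field_def field_def dist_norm norm_minus_commute N1_def)
    qed
    have 7: "core_field x * (x - z0) = - cnj (reflected R x * (x - z0))" if "cmod (x - z0) = \<rho>" for x
    proof (rule core_shell_circle[OF that])
      have "R\<^sup>2 / q < cmod x" using gx that by simp
      then show "x \<noteq> 0" using gap_pos(1) by auto
    qed
    show "(\<integral>x. weighted_field s x * cgrad \<phi>1 x \<partial>lborel)
        = - (2 * disk_area * (complex_of_real 1 * cnj G1 + complex_of_real s * G1))"
      by (rule reflection_green(1)[OF \<rho> T(1) LN(1,2) z(1) LN(7) 1 2 3 4 5 6 meas[OF T(1)] 7 G1_def])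
    show "integrable lborel (\<lambda>x. weighted_field s x * cgrad \<phi>1 x)"
      by (rule reflection_green(2)[OF \<rho> T(1) LN(1,2) z(1) LN(7) 1 2 3 4 5 6 meas[OF T(1)] 7 G1_def])
  qed
  have I2: "(\<integral>x. weighted_field s x * cgrad \<phi>2 x \<partial>lborel)
      = - (2 * disk_area * (complex_of_real s * cnj G2 + complex_of_real 1 * G2))"
    "integrable lborel (\<lambda>x. weighted_field s x * cgrad \<phi>2 x)"
  proof -
    have out: "R\<^sup>2 / q < cmod x" if "x \<in> N2" for x
    proof -
      have "1 < cmod x" using that by (simp add: N2_def not_le)
      then show ?thesis using gap_pos(4) by linarith
    qed
    have 1: "reflected R holomorphic_on side 1 0 R \<inter> N2" by (rule shell) (use out in auto)
    have 2: "continuous_on (closed_side 1 0 R \<inter> N2) (reflected R)" by (rule shellc) (use out in auto)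
    have 3: "P holomorphic_on side (- 1) 0 R \<inter> N2"
      by (rule holomorphic_on_subset[OF Ph]) (auto simp: N2_def)
    have 4: "continuous_on (closed_side (- 1) 0 R \<inter> N2) P"
      by (rule continuous_on_subset[OF Pc]) (auto simp: N2_def)
    have 5: "weighted_field s x = complex_of_real s * reflected R x" if "x \<in> L2" "cmod (x - 0) < R" for x
    proof -
      have "x \<in> N2" using that(1) LN(4) by blast
      then show ?thesis using that(2) nocore[of x] by (simp add: weighted_field_def field_def N2_def)
    qed
    have 6: "weighted_field s x = complex_of_real 1 * P x" if "x \<in> L2" "R < cmod (x - 0)" for x
    proof -
      have "x \<in> N2" using that(1) LN(4) by blast
      then show ?thesis using that(2) nocore[of x] by (simp add: weighted_field_def field_def N2_def)
    qed
    have 7: "reflected R x * (x - 0) = - cnj (P x * (x - 0))" if "cmod (x - 0) = R" for x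
      by (rule reflected_same_circle(2)) (use that R0 in auto)
    show "(\<integral>x. weighted_field s x * cgrad \<phi>2 x \<partial>lborel)
        = - (2 * disk_area * (complex_of_real s * cnj G2 + complex_of_real 1 * G2))"
      by (rule reflection_green(1)[OF R0 T(2) LN(3,4) z(2) LN(8) 1 2 3 4 5 6 meas[OF T(2)] 7 G2_def])
    show "integrable lborel (\<lambda>x. weighted_field s x * cgrad \<phi>2 x)"
      by (rule reflection_green(2)[OF R0 T(2) LN(3,4) z(2) LN(8) 1 2 3 4 5 6 meas[OF T(2)] 7 G2_def])
  qed
  have I3: "(\<integral>x. weighted_field s x * cgrad \<phi>3 x \<partial>lborel)
      = - (2 * disk_area * (complex_of_real 1 * cnj G3 + complex_of_real 1 * G3))"
    "integrable lborel (\<lambda>x. weighted_field s x * cgrad \<phi>3 x)"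
  proof -
    have 1: "P holomorphic_on side 1 0 q \<inter> N3"
      by (rule holomorphic_on_subset[OF Ph]) (simp add: side_ball(1)[OF q0])
    have 2: "continuous_on (closed_side 1 0 q \<inter> N3) P"
      by (rule continuous_on_subset[OF Pc]) (simp add: side_ball(2)[OF q0])
    have 3: "reflected q holomorphic_on side (- 1) 0 q \<inter> N3"
      by (rule holomorphic_on_subset[OF reflected_holomorphic[OF q0]])
        (use q0 in \<open>auto simp: side_ball(3)[OF q0] power2_eq_square\<close>)
    have 4: "continuous_on (closed_side (- 1) 0 q \<inter> N3) (reflected q)"
      by (rule continuous_on_subset[OF far_continuous]) (simp add: side_ball(4)[OF q0])
    have 5: "weighted_field s x = complex_of_real 1 * P x" if "x \<in> L3" "cmod (x - 0) < q" for x
    proof -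
      have "x \<in> N3" using that(1) LN(6) by blast
      then show ?thesis using that(2) nocore[of x] R by (simp add: weighted_field_def field_def N3_def)
    qed
    have 6: "weighted_field s x = complex_of_real 1 * reflected q x" if "x \<in> L3" "q < cmod (x - 0)" for x
    proof -
      have "x \<in> N3" using that(1) LN(6) by blast
      then show ?thesis using that(2) nocore[of x] R by (simp add: weighted_field_def field_def N3_def)
    qed
    have 7: "P x * (x - 0) = - cnj (reflected q x * (x - 0))" if "cmod (x - 0) = q" for x
      by (rule reflected_same_circle(1)) (use that q0 in auto)
    show "(\<integral>x. weighted_field s x * cgrad \<phi>3 x \<partial>lborel)
        = - (2 * disk_area * (complex_of_real 1 * cnj G3 + complex_of_real 1 * G3))"
      by (rule reflection_green(1)[OF q0 T(3) LN(5,6) z(3) LN(9) 1 2 3 4 5 6 meas[OF T(3)] 7 G3_def])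
    show "integrable lborel (\<lambda>x. weighted_field s x * cgrad \<phi>3 x)"
      by (rule reflection_green(2)[OF q0 T(3) LN(5,6) z(3) LN(9) 1 2 3 4 5 6 meas[OF T(3)] 7 G3_def])
  qed
  have G3: "G3 = - cnj (circle_mean (\<lambda>x. complex_of_real (\<phi> x) * (P x * x)) 0 q)"
  proof -
    have "G3 = circle_mean (\<lambda>x. - 1 * cnj (complex_of_real (\<phi> x) * (P x * x))) 0 q"
      unfolding G3_def
    proof (rule circle_mean_cong[OF _ q0])
      fix x :: complex assume "cmod (x - 0) = q"
      then have x: "cmod x = q" by simp
      have "\<phi>3 x = \<phi> x" using t2(2)[of "q\<^sup>2"] uv x by (simp add: \<phi>3_def)
      then show "complex_of_real (\<phi>3 x) * (reflected q x * (x - 0)) = - 1 * cnj (complex_of_real (\<phi> x) * (P x * x))"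
        using reflected_same_circle(2)[OF x q0] by simp
    qed
    then show ?thesis unfolding circle_mean_mult circle_mean_cnj by simp
  qed
  have eq: "weighted_field s x * cgrad \<phi> x = weighted_field s x * cgrad \<phi>1 x
      + (weighted_field s x * cgrad \<phi>2 x + weighted_field s x * cgrad \<phi>3 x)" for x
    unfolding sum by (simp add: distrib_left)
  show "integrable lborel (\<lambda>x. weighted_field s x * cgrad \<phi> x)"
    unfolding eq by (intro Bochner_Integration.integrable_add I1 I2 I3)
  have "(\<integral>x. weighted_field s x * cgrad \<phi> x \<partial>lborel) = (\<integral>x. weighted_field s x * cgrad \<phi>1 x \<partial>lborel)
      + ((\<integral>x. weighted_field s x * cgrad \<phi>2 x \<partial>lborel) + (\<integral>x. weighted_field s x * cgrad \<phi>3 x \<partial>lborel))"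
    unfolding eq using I1(2) I2(2) I3(2) by simp
  note split = this
  define r where "r = complex_of_real (Re (circle_mean (\<lambda>x. complex_of_real (\<phi> x) * (P x * x)) 0 q))"
  have "cnj G3 + G3 = - 2 * r"
    unfolding G3 r_def by (simp add: complex_eq_iff)
  then have I3': "(\<integral>x. weighted_field s x * cgrad \<phi>3 x \<partial>lborel) = - (2 * disk_area * (- 2 * r))"
    using I3(1) by (simp only: of_real_1 mult_1)
  have "(\<integral>x. weighted_field s x * cgrad \<phi> x \<partial>lborel) = - (2 * disk_area *
      (cnj G1 + complex_of_real s * G1 + (complex_of_real s * cnj G2 + G2) - 2 * r))"
    unfolding split I1(1) I2(1) I3' by (simp add: algebra_simps)
  then show "\<exists>G1 G2. (\<integral>x. weighted_field s x * cgrad \<phi> x \<partial>lborel) = - (2 * disk_area *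
      (cnj G1 + complex_of_real s * G1 + (complex_of_real s * cnj G2 + G2)
        - 2 * complex_of_real (Re (circle_mean (\<lambda>x. complex_of_real (\<phi> x) * (P x * x)) 0 q))))"
    unfolding r_def by blast
qed

lemma field_curl_free:
  assumes \<phi>: "test_function \<phi>"
  shows "Im (\<integral>x. field x * cgrad \<phi> x \<partial>lborel) = 0"
proof -
  have w: "weighted_field 1 = field" by (auto simp: weighted_field_def)
  obtain G1 G2 where "(\<integral>x. field x * cgrad \<phi> x \<partial>lborel) = - (2 * disk_area *
      (cnj G1 + complex_of_real 1 * G1 + (complex_of_real 1 * cnj G2 + G2)
        - 2 * complex_of_real (Re (circle_mean (\<lambda>x. complex_of_real (\<phi> x) * (P x * x)) 0 q))))"
    using weighted_field_green(2)[OF \<phi>, of 1] unfolding w by blast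
  then show ?thesis by simp
qed

lemma field_divergence:
  assumes \<phi>: "test_function \<phi>"
  shows "Re (\<integral>x. weighted_field (- 1) x * cgrad \<phi> x \<partial>lborel)
    = 4 * disk_area * Re (circle_mean (\<lambda>x. complex_of_real (\<phi> x) * (P x * x)) 0 q)"
proof -
  obtain G1 G2 where "(\<integral>x. weighted_field (- 1) x * cgrad \<phi> x \<partial>lborel) = - (2 * disk_area *
      (cnj G1 + complex_of_real (- 1) * G1 + (complex_of_real (- 1) * cnj G2 + G2)
        - 2 * complex_of_real (Re (circle_mean (\<lambda>x. complex_of_real (\<phi> x) * (P x * x)) 0 q))))"
    using weighted_field_green(2)[OF \<phi>, of "- 1"] by blast
  then show ?thesis by simp
qed

end

section \<open>Energy of weak solutions\<close>

text \<open>
  The mixed second difference, evaluated by the mean value theorem in either order of the variables.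
\<close>

lemma test_function_mixed_difference:
  assumes \<phi>: "test_function \<phi>" and h: "h > 0"
  shows "\<exists>y. cmod (y - x) < 2 * h \<and>
      \<phi> (x + Complex h h) - \<phi> (x + Complex h 0) - \<phi> (x + Complex 0 h) + \<phi> x = h\<^sup>2 * partial2 (partial1 \<phi>) y"
    and "\<exists>y. cmod (y - x) < 2 * h \<and>
      \<phi> (x + Complex h h) - \<phi> (x + Complex h 0) - \<phi> (x + Complex 0 h) + \<phi> x = h\<^sup>2 * partial1 (partial2 \<phi>) y"
proof -
  have line1: "((\<lambda>s. \<psi> (x + Complex s t)) has_real_derivative partial1 \<psi> (x + Complex s t)) (at s)"
    and line2: "((\<lambda>t. \<psi> (x + Complex s t)) has_real_derivative partial2 \<psi> (x + Complex s t)) (at t)"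
    if "test_function \<psi>" for \<psi> s t
  proof -
    have C: "Complex s t = complex_of_real s + \<i> * complex_of_real t" for s t by (simp add: Complex_eq)
    have d1: "((\<lambda>s. x + Complex s t) has_derivative (\<lambda>h. complex_of_real h)) (at s)"
      and d2: "((\<lambda>t. x + Complex s t) has_derivative (\<lambda>h. \<i> * complex_of_real h)) (at t)"
      unfolding C by (auto intro!: derivative_eq_intros)
    show "((\<lambda>s. \<psi> (x + Complex s t)) has_real_derivative partial1 \<psi> (x + Complex s t)) (at s)"
      using has_derivative_compose[OF d1 test_functionD(1)[OF that]]
      by (simp add: has_field_derivative_def mult_commute_abs)
    show "((\<lambda>t. \<psi> (x + Complex s t)) has_real_derivative partial2 \<psi> (x + Complex s t)) (at t)"
      using has_derivative_compose[OF d2 test_functionD(1)[OF that]]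
      by (simp add: has_field_derivative_def mult_commute_abs)
  qed
  have near: "cmod (x + Complex s t - x) < 2 * h" if "0 < s" "s < h" "0 < t" "t < h" for s t
    using cmod_le[of "Complex s t"] that by simp
  note p = test_function_partial[OF \<phi>]
  have x0: "x + Complex 0 0 = x" by (simp add: complex_eq_iff)
  obtain s where s: "0 < s" "s < h" and es: "(\<phi> (x + Complex h h) - \<phi> (x + Complex h 0)) - (\<phi> (x + Complex 0 h) - \<phi> (x + Complex 0 0))
      = (h - 0) * (partial1 \<phi> (x + Complex s h) - partial1 \<phi> (x + Complex s 0))"
    using MVT2[OF h, of "\<lambda>s. \<phi> (x + Complex s h) - \<phi> (x + Complex s 0)"
        "\<lambda>s. partial1 \<phi> (x + Complex s h) - partial1 \<phi> (x + Complex s 0)",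
        OF DERIV_diff[OF line1[OF \<phi>] line1[OF \<phi>]]]
    by auto
  obtain t where t: "0 < t" "t < h" and et: "partial1 \<phi> (x + Complex s h) - partial1 \<phi> (x + Complex s 0)
      = (h - 0) * partial2 (partial1 \<phi>) (x + Complex s t)"
    using MVT2[OF h, of "\<lambda>t. partial1 \<phi> (x + Complex s t)" "\<lambda>t. partial2 (partial1 \<phi>) (x + Complex s t)", OF line2[OF p(1)]]
    by auto
  show "\<exists>y. cmod (y - x) < 2 * h \<and>
      \<phi> (x + Complex h h) - \<phi> (x + Complex h 0) - \<phi> (x + Complex 0 h) + \<phi> x = h\<^sup>2 * partial2 (partial1 \<phi>) y"
    using near[OF s t] es et x0 by (intro exI[of _ "x + Complex s t"]) (simp add: power2_eq_square)
  obtain t where t: "0 < t" "t < h" and et: "(\<phi> (x + Complex h h) - \<phi> (x + Complex 0 h)) - (\<phi> (x + Complex h 0) - \<phi> (x + Complex 0 0))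
      = (h - 0) * (partial2 \<phi> (x + Complex h t) - partial2 \<phi> (x + Complex 0 t))"
    using MVT2[OF h, of "\<lambda>t. \<phi> (x + Complex h t) - \<phi> (x + Complex 0 t)"
        "\<lambda>t. partial2 \<phi> (x + Complex h t) - partial2 \<phi> (x + Complex 0 t)",
        OF DERIV_diff[OF line2[OF \<phi>] line2[OF \<phi>]]]
    by auto
  obtain s where s: "0 < s" "s < h" and es: "partial2 \<phi> (x + Complex h t) - partial2 \<phi> (x + Complex 0 t)
      = (h - 0) * partial1 (partial2 \<phi>) (x + Complex s t)"
    using MVT2[OF h, of "\<lambda>s. partial2 \<phi> (x + Complex s t)" "\<lambda>s. partial1 (partial2 \<phi>) (x + Complex s t)", OF line1[OF p(2)]]
    by auto
  show "\<exists>y. cmod (y - x) < 2 * h \<and>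
      \<phi> (x + Complex h h) - \<phi> (x + Complex h 0) - \<phi> (x + Complex 0 h) + \<phi> x = h\<^sup>2 * partial1 (partial2 \<phi>) y"
    using near[OF s t] es et x0 by (intro exI[of _ "x + Complex s t"]) (simp add: power2_eq_square)
qed

lemma mixed_partials_commute:
  assumes \<phi>: "test_function \<phi>"
  shows "partial1 (partial2 \<phi>) x = partial2 (partial1 \<phi>) x"
proof (rule ccontr)
  assume ne: "partial1 (partial2 \<phi>) x \<noteq> partial2 (partial1 \<phi>) x"
  define e where "e = \<bar>partial1 (partial2 \<phi>) x - partial2 (partial1 \<phi>) x\<bar> / 2"
  have e: "e > 0" using ne by (simp add: e_def)
  note p = test_function_partial[OF \<phi>]
  have c: "continuous_on UNIV (partial1 (partial2 \<phi>))" "continuous_on UNIV (partial2 (partial1 \<phi>))"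
    using test_functionD(3)[OF p(2)] test_functionD(4)[OF p(1)] by blast+
  obtain d1 where d1: "d1 > 0" "\<And>y. dist y x < d1 \<Longrightarrow> dist (partial1 (partial2 \<phi>) y) (partial1 (partial2 \<phi>) x) < e"
    using c(1) e unfolding continuous_on_iff by (metis UNIV_I)
  obtain d2 where d2: "d2 > 0" "\<And>y. dist y x < d2 \<Longrightarrow> dist (partial2 (partial1 \<phi>) y) (partial2 (partial1 \<phi>) x) < e"
    using c(2) e unfolding continuous_on_iff by (metis UNIV_I)
  define h where "h = min d1 d2 / 2"
  have h: "h > 0" "2 * h \<le> d1" "2 * h \<le> d2" using d1 d2 by (auto simp: h_def)
  obtain y where y: "cmod (y - x) < 2 * h"
    "\<phi> (x + Complex h h) - \<phi> (x + Complex h 0) - \<phi> (x + Complex 0 h) + \<phi> x = h\<^sup>2 * partial2 (partial1 \<phi>) y"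
    using test_function_mixed_difference(1)[OF \<phi> h(1)] by blast
  obtain y' where y': "cmod (y' - x) < 2 * h"
    "\<phi> (x + Complex h h) - \<phi> (x + Complex h 0) - \<phi> (x + Complex 0 h) + \<phi> x = h\<^sup>2 * partial1 (partial2 \<phi>) y'"
    using test_function_mixed_difference(2)[OF \<phi> h(1)] by blast
  have "h\<^sup>2 * partial2 (partial1 \<phi>) y = h\<^sup>2 * partial1 (partial2 \<phi>) y'"
    by (rule trans[OF y(2)[symmetric] y'(2)])
  then have "partial2 (partial1 \<phi>) y = partial1 (partial2 \<phi>) y'" using h by simp
  moreover have "\<bar>partial1 (partial2 \<phi>) y' - partial1 (partial2 \<phi>) x\<bar> < e"
    using d1(2)[of y'] y'(1) h by (simp add: dist_norm)
  moreover have "\<bar>partial2 (partial1 \<phi>) y - partial2 (partial1 \<phi>) x\<bar> < e"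
    using d2(2)[of y] y(1) h by (simp add: dist_norm)
  moreover have "\<bar>a - b\<bar> \<le> \<bar>c - a\<bar> + \<bar>c - b\<bar>" for a b c :: real by linarith
  from this[of "partial1 (partial2 \<phi>) x" "partial2 (partial1 \<phi>) x" "partial2 (partial1 \<phi>) y"]
  have "2 * e \<le> \<bar>partial2 (partial1 \<phi>) y - partial1 (partial2 \<phi>) x\<bar>
      + \<bar>partial2 (partial1 \<phi>) y - partial2 (partial1 \<phi>) x\<bar>" by (simp add: e_def)
  ultimately show False by simp
qed

text \<open>
  By \<open>(a + b)\<^sup>2 \<le> 2 a\<^sup>2 + 2 b\<^sup>2\<close>.
\<close>

lemma square_integrable_add:
  assumes "square_integrable f" "square_integrable g"
  shows "square_integrable (\<lambda>z. f z + g z)"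
proof -
  have [measurable]: "f \<in> borel_measurable borel" "g \<in> borel_measurable borel" using assms by measurable
  have "integrable lborel (\<lambda>z. 2 * (cmod (f z))\<^sup>2 + 2 * (cmod (g z))\<^sup>2)"
    using assms by (simp add: square_integrable_def)
  then have "integrable lborel (\<lambda>z. (cmod (f z + g z))\<^sup>2)"
  proof (rule Bochner_Integration.integrable_bound)
    show "AE z in lborel. norm ((cmod (f z + g z))\<^sup>2) \<le> norm (2 * (cmod (f z))\<^sup>2 + 2 * (cmod (g z))\<^sup>2)"
    proof (rule AE_I2)
      fix z
      have "(cmod (f z + g z))\<^sup>2 \<le> (cmod (f z) + cmod (g z))\<^sup>2" by (intro power_mono norm_triangle_ineq) simp
      also have "\<dots> \<le> 2 * (cmod (f z))\<^sup>2 + 2 * (cmod (g z))\<^sup>2"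
        using zero_le_power2[of "cmod (f z) - cmod (g z)"] by (simp add: power2_eq_square algebra_simps)
      finally show "norm ((cmod (f z + g z))\<^sup>2) \<le> norm (2 * (cmod (f z))\<^sup>2 + 2 * (cmod (g z))\<^sup>2)" by simp
    qed
  qed measurable
  then show ?thesis by (simp add: square_integrable_def)
qed

lemma square_integrable_bounded_mult:
  assumes f: "square_integrable f" and b[measurable]: "b \<in> borel_measurable borel" and B: "\<And>z. cmod (b z) \<le> B"
  shows "square_integrable (\<lambda>z. b z * f z)"
proof -
  have [measurable]: "f \<in> borel_measurable borel" using f by measurable
  have "integrable lborel (\<lambda>z. B\<^sup>2 * (cmod (f z))\<^sup>2)" using f by (simp add: square_integrable_def)
  then have "integrable lborel (\<lambda>z. (cmod (b z * f z))\<^sup>2)"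
  proof (rule Bochner_Integration.integrable_bound)
    show "AE z in lborel. norm ((cmod (b z * f z))\<^sup>2) \<le> norm (B\<^sup>2 * (cmod (f z))\<^sup>2)"
    proof (rule AE_I2)
      fix z
      have "(cmod (b z))\<^sup>2 \<le> B\<^sup>2" using B by (intro power_mono) auto
      then have "(cmod (b z))\<^sup>2 * (cmod (f z))\<^sup>2 \<le> B\<^sup>2 * (cmod (f z))\<^sup>2" by (intro mult_right_mono) auto
      then show "norm ((cmod (b z * f z))\<^sup>2) \<le> norm (B\<^sup>2 * (cmod (f z))\<^sup>2)"
        by (simp add: norm_mult power_mult_distrib)
    qed
  qed measurable
  then show ?thesis by (simp add: square_integrable_def)
qed

lemma borel_measurable_cnj [measurable (raw)]:
  "f \<in> borel_measurable M \<Longrightarrow> (\<lambda>x. cnj (f x)) \<in> borel_measurable M"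
  by (rule borel_measurable_continuous_on[of cnj, OF _ , unfolded o_def]) (auto intro!: continuous_intros)

lemma square_integrable_cnj: "square_integrable f \<Longrightarrow> square_integrable (\<lambda>z. cnj (f z))"
  unfolding square_integrable_def by (simp add: borel_measurable_cnj)

lemma square_integrable_product:
  "square_integrable f \<Longrightarrow> square_integrable g \<Longrightarrow> integrable lborel (\<lambda>z. f z * g z)"
  using square_integrable_mult(1)[of f g 0] by simp

lemma square_integrable_test:
  assumes "test_function \<phi>"
  shows "square_integrable (\<lambda>z. complex_of_real (\<phi> z))"
proof -
  obtain r where "\<And>x. r \<le> cmod x \<Longrightarrow> \<phi> x = 0" using test_functionD(5)[OF assms] by blast
  from continuous_compact_support_integrable[OF test_functionD(2)[OF assms] this]
  show ?thesis by (auto simp: square_integrable_def)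
qed

lemma lebesgue_ex_borel_complex:
  assumes "g \<in> borel_measurable lebesgue"
  obtains g' :: "complex \<Rightarrow> complex" where "g' \<in> borel_measurable borel" "AE x in lborel. g x = g' x"
proof -
  have "(\<lambda>x. Re (g x)) \<in> borel_measurable lebesgue" "(\<lambda>x. Im (g x)) \<in> borel_measurable lebesgue"
    using assms by measurable
  from this[THEN completion_ex_borel_measurable_real]
  obtain a b where ab: "a \<in> borel_measurable lborel" "AE x in lborel. Re (g x) = a x"
    "b \<in> borel_measurable lborel" "AE x in lborel. Im (g x) = b x"
    by auto
  have "(\<lambda>x. Complex (a x) (b x)) \<in> borel_measurable borel"
    unfolding Complex_eq using ab(1,3) by measurable
  moreover have "AE x in lborel. g x = Complex (a x) (b x)"
    using ab(2,4) by eventually_elim (simp add: complex_eq_iff)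
  ultimately show ?thesis by (rule that)
qed

lemma lebesgue_integral_borel:
  fixes f g :: "complex \<Rightarrow> 'b::{banach, second_countable_topology}"
  assumes ae: "AE x in lborel. f x = g x" and g: "g \<in> borel_measurable borel"
    and fL: "f \<in> borel_measurable lebesgue"
  shows "(\<integral>x. f x \<partial>lebesgue) = (\<integral>x. g x \<partial>lborel)" "integrable lebesgue f \<longleftrightarrow> integrable lborel g"
proof -
  have ae': "AE x in lebesgue. g x = f x"
    using AE_completion[OF ae] by eventually_elim simp
  have gl: "g \<in> borel_measurable lborel" using g by simp
  then have gL: "g \<in> borel_measurable lebesgue" by (rule measurable_completion)
  show "(\<integral>x. f x \<partial>lebesgue) = (\<integral>x. g x \<partial>lborel)"
    using integral_cong_AE[OF gL fL ae'] integral_completion[OF gl] by simp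
  show "integrable lebesgue f \<longleftrightarrow> integrable lborel g"
    using integrable_cong_AE[OF gL fL ae'] integrable_completion[OF gl] by simp
qed

lemma weak_gradient_curl_free:
  assumes g: "has_weak_gradient U G" and \<phi>: "test_function \<phi>"
  shows "(\<integral>x. partial2 \<phi> x *\<^sub>R fst (G x) \<partial>lebesgue) = (\<integral>x. partial1 \<phi> x *\<^sub>R snd (G x) \<partial>lebesgue)"
proof -
  note p = test_function_partial[OF \<phi>]
  have "(\<integral>x. partial1 (partial2 \<phi>) x *\<^sub>R U x \<partial>lebesgue) = - (\<integral>x. partial2 \<phi> x *\<^sub>R fst (G x) \<partial>lebesgue)"
    "(\<integral>x. partial2 (partial1 \<phi>) x *\<^sub>R U x \<partial>lebesgue) = - (\<integral>x. partial1 \<phi> x *\<^sub>R snd (G x) \<partial>lebesgue)"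
    using g p unfolding has_weak_gradient_def by blast+
  then show ?thesis by (simp add: mixed_partials_commute[OF \<phi>])
qed

text \<open>
  The comparison of a weak solution with a square integrable, curl-free \<open>v\<close> whose flux \<open>A v\<close> has divergence \<open>f\<close>.  The bound does not involve \<open>\<eta>\<close>.
\<close>

lemma weak_solution_gradient_le:
  fixes v1 v2 A :: "complex \<Rightarrow> real"
  assumes A[measurable]: "A \<in> borel_measurable borel" and A1: "\<And>x. \<bar>A x\<bar> \<le> 1" and \<eta>: "\<eta> > 0"
    and v: "square_integrable (\<lambda>x. complex_of_real (v1 x))" "square_integrable (\<lambda>x. complex_of_real (v2 x))"
    and v_curl: "\<And>\<phi>. test_function \<phi> \<Longrightarrow> (\<integral>x. v1 x * partial2 \<phi> x \<partial>lborel) = (\<integral>x. v2 x * partial1 \<phi> x \<partial>lborel)"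
    and v_div: "\<And>\<phi>. test_function \<phi> \<Longrightarrow> - (\<integral>x. A x * (v1 x * partial1 \<phi> x + v2 x * partial2 \<phi> x) \<partial>lborel) = f \<phi>"
    and u: "weak_solution A f \<eta> u"
  shows "(\<integral>x. (norm (weak_grad u x))\<^sup>2 \<partial>lebesgue) \<le> (\<integral>x. (v1 x)\<^sup>2 + (v2 x)\<^sup>2 \<partial>lborel)"
proof -
  define G where "G = weak_grad u"
  have uH: "u \<in> H1_dot" using u by (simp add: weak_solution_def)
  then have "\<exists>G. has_weak_gradient u G" by (simp add: H1_dot_def)
  then have hG: "has_weak_gradient u G" unfolding G_def weak_grad_def by (rule someI_ex)
  have "G \<in> L2" using uH by (simp add: H1_dot_def G_def)
  then have Gm[measurable]: "G \<in> borel_measurable lebesgue" and Gi: "integrable lebesgue (\<lambda>x. (norm (G x))\<^sup>2)"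
    by (auto simp: L2_def)
  have f1m[measurable]: "(\<lambda>x. fst (G x)) \<in> borel_measurable lebesgue"
    and f2m[measurable]: "(\<lambda>x. snd (G x)) \<in> borel_measurable lebesgue"
    using borel_measurable_continuous_on[OF continuous_on_fst[OF continuous_on_id] Gm]
      borel_measurable_continuous_on[OF continuous_on_snd[OF continuous_on_id] Gm] by simp_all
  obtain g1 where g1[measurable]: "g1 \<in> borel_measurable borel" and ae1: "AE x in lborel. fst (G x) = g1 x"
    using lebesgue_ex_borel_complex[OF f1m] by blast
  obtain g2 where g2[measurable]: "g2 \<in> borel_measurable borel" and ae2: "AE x in lborel. snd (G x) = g2 x"
    using lebesgue_ex_borel_complex[OF f2m] by blast
  have aeN: "AE x in lborel. (norm (G x))\<^sup>2 = (cmod (g1 x))\<^sup>2 + (cmod (g2 x))\<^sup>2"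
    using ae1 ae2
  proof eventually_elim
    fix x assume "fst (G x) = g1 x" "snd (G x) = g2 x"
    then show "(norm (G x))\<^sup>2 = (cmod (g1 x))\<^sup>2 + (cmod (g2 x))\<^sup>2"
      by (cases "G x") (simp add: norm_Pair)
  qed
  note N = lebesgue_integral_borel[OF aeN]
  have Ni: "integrable lborel (\<lambda>x. (cmod (g1 x))\<^sup>2 + (cmod (g2 x))\<^sup>2)"
    and NI: "(\<integral>x. (norm (G x))\<^sup>2 \<partial>lebesgue) = (\<integral>x. (cmod (g1 x))\<^sup>2 + (cmod (g2 x))\<^sup>2 \<partial>lborel)"
    using N Gi by auto
  have sg: "square_integrable g1" "square_integrable g2"
    unfolding square_integrable_def
    by (auto intro!: Bochner_Integration.integrable_bound[OF Ni])
  define a where "a x = complex_of_real (A x) + \<i> * complex_of_real \<eta>" for x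
  have am[measurable]: "a \<in> borel_measurable borel" unfolding a_def[abs_def] by measurable
  have aB: "cmod (a x) \<le> 1 + \<eta>" for x
    using norm_triangle_ineq[of "complex_of_real (A x)" "\<i> * complex_of_real \<eta>"] A1[of x] \<eta>
    by (simp add: a_def norm_mult)
  have AB: "cmod (complex_of_real (A x)) \<le> 1" for x using A1 by simp
  have Am: "(\<lambda>x. complex_of_real (A x)) \<in> borel_measurable borel" by measurable
  define w1 w2 where "w1 x = complex_of_real (v1 x)" and "w2 x = complex_of_real (v2 x)" for x
  have sw: "square_integrable w1" "square_integrable w2" using v by (simp_all add: w1_def[abs_def] w2_def[abs_def])
  have neg: "square_integrable (\<lambda>x. - 1 * h x)" if "square_integrable h" for h
    by (rule square_integrable_bounded_mult[OF that, of _ 1]) auto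
  \<comment> \<open>The right hand sides \<open>f\<close> cancel, so this field is divergence-free.\<close>
  define D1 D2 where "D1 x = a x * g1 x + - 1 * (complex_of_real (A x) * w1 x)"
    and "D2 x = a x * g2 x + - 1 * (complex_of_real (A x) * w2 x)" for x
  \<comment> \<open>Conjugation makes the bilinear orthogonality a hermitian one.\<close>
  define C1 C2 where "C1 x = cnj (g1 x + - 1 * w1 x)" and "C2 x = cnj (g2 x + - 1 * w2 x)" for x
  have sag: "square_integrable (\<lambda>x. a x * g1 x)" "square_integrable (\<lambda>x. a x * g2 x)"
    by (rule square_integrable_bounded_mult[OF _ am aB], rule sg)+
  have sAw: "square_integrable (\<lambda>x. complex_of_real (A x) * w1 x)" "square_integrable (\<lambda>x. complex_of_real (A x) * w2 x)"
    by (rule square_integrable_bounded_mult[OF _ Am AB], rule sw)+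
  have sD: "square_integrable D1" "square_integrable D2"
    unfolding D1_def[abs_def] D2_def[abs_def] by (intro square_integrable_add neg sag sAw)+
  have sC: "square_integrable C1" "square_integrable C2"
    unfolding C1_def[abs_def] C2_def[abs_def] by (intro square_integrable_cnj square_integrable_add neg sg sw)+
  have orth: "(\<integral>z. D1 z * C1 z + D2 z * C2 z \<partial>lborel) = 0"
  proof (rule divergence_free_curl_free_orthogonal[OF sD sC])
    fix \<phi> :: "complex \<Rightarrow> real" assume \<phi>: "test_function \<phi>"
    note p = square_integrable_test[OF test_function_partial(1)[OF \<phi>]] square_integrable_test[OF test_function_partial(2)[OF \<phi>]]
    have pm[measurable]: "partial1 \<phi> \<in> borel_measurable borel" "partial2 \<phi> \<in> borel_measurable borel"
      using test_functionD(3,4)[OF \<phi>] by (auto intro: borel_measurable_continuous_onI)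
    have pL[measurable]: "partial1 \<phi> \<in> borel_measurable lebesgue" "partial2 \<phi> \<in> borel_measurable lebesgue"
      using pm by (auto intro!: measurable_completion)
    have AL[measurable]: "A \<in> borel_measurable lebesgue" by (rule measurable_completion) simp
    have i: "integrable lborel (\<lambda>x. a x * g1 x * complex_of_real (partial1 \<phi> x))"
      "integrable lborel (\<lambda>x. a x * g2 x * complex_of_real (partial2 \<phi> x))"
      "integrable lborel (\<lambda>x. complex_of_real (A x) * w1 x * complex_of_real (partial1 \<phi> x))"
      "integrable lborel (\<lambda>x. complex_of_real (A x) * w2 x * complex_of_real (partial2 \<phi> x))"
      by (rule square_integrable_product[OF sag(1) p(1)] square_integrable_product[OF sag(2) p(2)]
          square_integrable_product[OF sAw(1) p(1)] square_integrable_product[OF sAw(2) p(2)])+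
    have "(\<integral>x. a x * (fst (G x) * complex_of_real (partial1 \<phi> x) + snd (G x) * complex_of_real (partial2 \<phi> x)) \<partial>lebesgue)
        = (\<integral>x. a x * (g1 x * complex_of_real (partial1 \<phi> x) + g2 x * complex_of_real (partial2 \<phi> x)) \<partial>lborel)"
    proof (rule lebesgue_integral_borel(1))
      show "AE x in lborel. a x * (fst (G x) * complex_of_real (partial1 \<phi> x) + snd (G x) * complex_of_real (partial2 \<phi> x))
         = a x * (g1 x * complex_of_real (partial1 \<phi> x) + g2 x * complex_of_real (partial2 \<phi> x))"
        using ae1 ae2 by eventually_elim simp
      show "(\<lambda>x. a x * (fst (G x) * complex_of_real (partial1 \<phi> x) + snd (G x) * complex_of_real (partial2 \<phi> x))) \<in> borel_measurable lebesgue"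
        unfolding a_def by measurable
    qed measurable
    note eq = this
    have e: "- (\<integral>x. a x * (fst (G x) * complex_of_real (partial1 \<phi> x) + snd (G x) * complex_of_real (partial2 \<phi> x)) \<partial>lebesgue)
        = complex_of_real (f \<phi>)"
      using u \<phi> unfolding weak_solution_def G_def a_def by blast
    have 1: "(\<integral>x. a x * (g1 x * complex_of_real (partial1 \<phi> x) + g2 x * complex_of_real (partial2 \<phi> x)) \<partial>lborel) = - complex_of_real (f \<phi>)"
      unfolding eq[symmetric] e[symmetric] by simp
    have 2: "(\<integral>x. complex_of_real (A x) * (w1 x * complex_of_real (partial1 \<phi> x) + w2 x * complex_of_real (partial2 \<phi> x)) \<partial>lborel) = - complex_of_real (f \<phi>)"
    proof -
      have "(\<integral>x. complex_of_real (A x) * (w1 x * complex_of_real (partial1 \<phi> x) + w2 x * complex_of_real (partial2 \<phi> x)) \<partial>lborel)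
          = (\<integral>x. complex_of_real (A x * (v1 x * partial1 \<phi> x + v2 x * partial2 \<phi> x)) \<partial>lborel)"
        by (simp add: w1_def w2_def)
      also have "\<dots> = complex_of_real (\<integral>x. A x * (v1 x * partial1 \<phi> x + v2 x * partial2 \<phi> x) \<partial>lborel)"
        by (rule integral_complex_of_real)
      finally show ?thesis unfolding v_div[OF \<phi>, symmetric] by simp
    qed
    have "(\<integral>z. D1 z * complex_of_real (partial1 \<phi> z) + D2 z * complex_of_real (partial2 \<phi> z) \<partial>lborel)
        = (\<integral>x. a x * (g1 x * complex_of_real (partial1 \<phi> x) + g2 x * complex_of_real (partial2 \<phi> x))
            - complex_of_real (A x) * (w1 x * complex_of_real (partial1 \<phi> x) + w2 x * complex_of_real (partial2 \<phi> x)) \<partial>lborel)"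
      by (rule Bochner_Integration.integral_cong) (simp_all add: D1_def D2_def algebra_simps)
    also have "\<dots> = (\<integral>x. a x * (g1 x * complex_of_real (partial1 \<phi> x) + g2 x * complex_of_real (partial2 \<phi> x)) \<partial>lborel)
       - (\<integral>x. complex_of_real (A x) * (w1 x * complex_of_real (partial1 \<phi> x) + w2 x * complex_of_real (partial2 \<phi> x)) \<partial>lborel)"
      using i by (intro Bochner_Integration.integral_diff) (simp_all add: distrib_left mult.assoc)
    finally show "(\<integral>z. D1 z * complex_of_real (partial1 \<phi> z) + D2 z * complex_of_real (partial2 \<phi> z) \<partial>lborel) = 0"
      using 1 2 by simp
    have gp: "integrable lborel (\<lambda>x. g1 x * complex_of_real (partial2 \<phi> x))" "integrable lborel (\<lambda>x. g2 x * complex_of_real (partial1 \<phi> x))"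
      "integrable lborel (\<lambda>x. w1 x * complex_of_real (partial2 \<phi> x))" "integrable lborel (\<lambda>x. w2 x * complex_of_real (partial1 \<phi> x))"
      by (rule square_integrable_product[OF sg(1) p(2)] square_integrable_product[OF sg(2) p(1)]
          square_integrable_product[OF sw(1) p(2)] square_integrable_product[OF sw(2) p(1)])+
    have c1: "(\<integral>x. g1 x * complex_of_real (partial2 \<phi> x) \<partial>lborel) = (\<integral>x. g2 x * complex_of_real (partial1 \<phi> x) \<partial>lborel)"
    proof -
      have "(\<integral>x. partial2 \<phi> x *\<^sub>R fst (G x) \<partial>lebesgue) = (\<integral>x. g1 x * complex_of_real (partial2 \<phi> x) \<partial>lborel)"
      proof (rule lebesgue_integral_borel(1))
        show "AE x in lborel. partial2 \<phi> x *\<^sub>R fst (G x) = g1 x * complex_of_real (partial2 \<phi> x)"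
          using ae1 by eventually_elim (simp add: scaleR_conv_of_real mult.commute)
      qed measurable
      moreover have "(\<integral>x. partial1 \<phi> x *\<^sub>R snd (G x) \<partial>lebesgue) = (\<integral>x. g2 x * complex_of_real (partial1 \<phi> x) \<partial>lborel)"
      proof (rule lebesgue_integral_borel(1))
        show "AE x in lborel. partial1 \<phi> x *\<^sub>R snd (G x) = g2 x * complex_of_real (partial1 \<phi> x)"
          using ae2 by eventually_elim (simp add: scaleR_conv_of_real mult.commute)
      qed measurable
      ultimately show ?thesis using weak_gradient_curl_free[OF hG \<phi>] by simp
    qed
    have c2: "(\<integral>x. w1 x * complex_of_real (partial2 \<phi> x) \<partial>lborel) = (\<integral>x. w2 x * complex_of_real (partial1 \<phi> x) \<partial>lborel)"
    proof -
      have "(\<integral>x. w1 x * complex_of_real (partial2 \<phi> x) \<partial>lborel) = complex_of_real (\<integral>x. v1 x * partial2 \<phi> x \<partial>lborel)"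
        unfolding integral_complex_of_real[symmetric] by (simp add: w1_def)
      moreover have "(\<integral>x. w2 x * complex_of_real (partial1 \<phi> x) \<partial>lborel) = complex_of_real (\<integral>x. v2 x * partial1 \<phi> x \<partial>lborel)"
        unfolding integral_complex_of_real[symmetric] by (simp add: w2_def)
      ultimately show ?thesis using v_curl[OF \<phi>] by simp
    qed
    have "(\<integral>z. C1 z * complex_of_real (partial2 \<phi> z) \<partial>lborel)
        = (\<integral>z. cnj (g1 z * complex_of_real (partial2 \<phi> z) - w1 z * complex_of_real (partial2 \<phi> z)) \<partial>lborel)"
      by (rule Bochner_Integration.integral_cong) (simp_all add: C1_def algebra_simps)
    also have "\<dots> = cnj ((\<integral>x. g1 x * complex_of_real (partial2 \<phi> x) \<partial>lborel) - (\<integral>x. w1 x * complex_of_real (partial2 \<phi> x) \<partial>lborel))"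
      unfolding Bochner_Integration.integral_cnj using gp by simp
    also have "\<dots> = cnj ((\<integral>x. g2 x * complex_of_real (partial1 \<phi> x) \<partial>lborel) - (\<integral>x. w2 x * complex_of_real (partial1 \<phi> x) \<partial>lborel))"
      unfolding c1 c2 ..
    also have "\<dots> = (\<integral>z. cnj (g2 z * complex_of_real (partial1 \<phi> z) - w2 z * complex_of_real (partial1 \<phi> z)) \<partial>lborel)"
      unfolding Bochner_Integration.integral_cnj using gp by simp
    also have "\<dots> = (\<integral>z. C2 z * complex_of_real (partial1 \<phi> z) \<partial>lborel)"
      by (rule Bochner_Integration.integral_cong) (simp_all add: C2_def algebra_simps)
    finally show "(\<integral>z. C1 z * complex_of_real (partial2 \<phi> z) \<partial>lborel) = (\<integral>z. C2 z * complex_of_real (partial1 \<phi> z) \<partial>lborel)" .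
  qed
  have iDC: "integrable lborel (\<lambda>z. D1 z * C1 z + D2 z * C2 z)"
    by (intro Bochner_Integration.integrable_add square_integrable_product sD sC)
  \<comment> \<open>The real part of \<open>g\<cdot>cnj (g - v)\<close>; the term \<open>A |g - v|\<^sup>2\<close> is real and drops out of the imaginary part.\<close>
  define Y where "Y x = (cmod (g1 x))\<^sup>2 + (cmod (g2 x))\<^sup>2 - (Re (g1 x) * v1 x + Re (g2 x) * v2 x)" for x
  have ImDC: "Im (D1 x * C1 x + D2 x * C2 x) = \<eta> * Y x" for x
  proof -
    have "Im ((a x * g + - 1 * (complex_of_real (A x) * complex_of_real r)) * cnj (g + - 1 * complex_of_real r))
        = \<eta> * ((cmod g)\<^sup>2 - Re g * r)" for g r
      unfolding cmod_power2 by (simp add: a_def power2_eq_square algebra_simps)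
    then show ?thesis by (simp only: D1_def D2_def C1_def C2_def w1_def w2_def Y_def plus_complex.sel) (simp add: algebra_simps)
  qed
  have iY: "integrable lborel (\<lambda>x. \<eta> * Y x)" "(\<integral>x. \<eta> * Y x \<partial>lborel) = 0"
    using integrable_Im[OF iDC] integral_Im[OF iDC] orth unfolding ImDC by auto
  then have Y0: "integrable lborel Y" "(\<integral>x. Y x \<partial>lborel) = 0" using \<eta> by auto
  have iv: "integrable lborel (\<lambda>x. (v1 x)\<^sup>2 + (v2 x)\<^sup>2)"
    using v by (simp add: square_integrable_def)
  have "(\<integral>x. (cmod (g1 x))\<^sup>2 + (cmod (g2 x))\<^sup>2 \<partial>lborel) \<le> (\<integral>x. 2 * Y x + ((v1 x)\<^sup>2 + (v2 x)\<^sup>2) \<partial>lborel)"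
  proof (rule integral_mono[OF Ni])
    show "integrable lborel (\<lambda>x. 2 * Y x + ((v1 x)\<^sup>2 + (v2 x)\<^sup>2))" using Y0 iv by simp
    fix x
    have "2 * (Re g * r) \<le> (cmod g)\<^sup>2 + r\<^sup>2" for g :: complex and r :: real
      using zero_le_power2[of "Re g - r"] zero_le_power2[of "Im g"]
      unfolding cmod_power2 power2_diff by linarith
    from this[of "g1 x" "v1 x"] this[of "g2 x" "v2 x"]
    show "(cmod (g1 x))\<^sup>2 + (cmod (g2 x))\<^sup>2 \<le> 2 * Y x + ((v1 x)\<^sup>2 + (v2 x)\<^sup>2)"
      unfolding Y_def by (simp add: algebra_simps)
  qed
  also have "\<dots> = (\<integral>x. (v1 x)\<^sup>2 + (v2 x)\<^sup>2 \<partial>lborel)" using Y0 iv by simp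
  finally show ?thesis using NI by (simp add: G_def)
qed

section \<open>Fourier series of the source\<close>

lemma power_series_disk:
  fixes a :: "nat \<Rightarrow> complex"
  assumes a: "summable (\<lambda>k. cmod (a k))"
  shows "continuous_on (cball 0 1) (\<lambda>w. \<Sum>k. a k * w ^ k)"
    and "(\<lambda>w. \<Sum>k. a k * w ^ k) holomorphic_on ball 0 1"
proof -
  have u: "uniform_limit (cball 0 1) (\<lambda>n w. \<Sum>k<n. a k * w ^ k) (\<lambda>w. \<Sum>k. a k * w ^ k) sequentially"
    by (rule Weierstrass_m_test[OF _ a]) (simp add: norm_mult norm_power mult_left_le power_le_one)
  show "continuous_on (cball 0 1) (\<lambda>w. \<Sum>k. a k * w ^ k)"
    by (rule uniform_limit_theorem[OF _ u]) (auto intro!: always_eventually continuous_intros)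
  show "(\<lambda>w. \<Sum>k. a k * w ^ k) holomorphic_on ball 0 1"
  proof (rule holomorphic_uniform_sequence)
    fix x :: complex assume "x \<in> ball 0 1"
    then obtain d where d: "d > 0" "cball x d \<subseteq> ball 0 1"
      using open_contains_cball open_ball by metis
    then have "uniform_limit (cball x d) (\<lambda>n w. \<Sum>k<n. a k * w ^ k) (\<lambda>w. \<Sum>k. a k * w ^ k) sequentially"
      using ball_subset_cball by (intro uniform_limit_on_subset[OF u]) blast
    then show "\<exists>d>0. cball x d \<subseteq> ball 0 1 \<and>
        uniform_limit (cball x d) (\<lambda>n w. \<Sum>k<n. a k * w ^ k) (\<lambda>w. \<Sum>k. a k * w ^ k) sequentially"
      using d by blast
  qed (auto intro!: holomorphic_intros)
qed

text \<open>
  The density is the real part of the boundary values of \<open>w S(w)\<close> on the unit circle, where \<open>w = x / q\<close> and \<open>S\<close> has the coefficients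
  \<open>\<alpha>\<^sub>k - \<i> \<beta>\<^sub>k\<close>.
\<close>

lemma fourier_density_power_series:
  fixes \<alpha> \<beta> :: "nat \<Rightarrow> real"
  assumes s: "summable (\<lambda>k. \<bar>\<alpha> (Suc k)\<bar> + \<bar>\<beta> (Suc k)\<bar>)" and q: "q > 0" and x: "cmod x = q"
  shows "fourier_density \<alpha> \<beta> x
    = Re (x / q * (\<Sum>k. Complex (\<alpha> (Suc k)) (- \<beta> (Suc k)) * (x / q) ^ k))"
proof -
  define w where "w = cis (Arg x)"
  have xw: "x / q = w"
    using x q rcis_cmod_Arg[of x] by (simp add: w_def rcis_def field_simps)
  have sa: "summable (\<lambda>k. \<alpha> (Suc k) * cos (real (Suc k) * Arg x))"
    by (rule summable_comparison_test'[OF s, of 0])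
      (auto simp: abs_mult intro!: order_trans[OF mult_left_le] simp del: of_nat_Suc)
  have sb: "summable (\<lambda>k. \<beta> (Suc k) * sin (real (Suc k) * Arg x))"
    by (rule summable_comparison_test'[OF s, of 0])
      (auto simp: abs_mult intro!: order_trans[OF mult_left_le] simp del: of_nat_Suc)
  define a where "a k = Complex (\<alpha> (Suc k)) (- \<beta> (Suc k))" for k
  have an: "cmod (a k) \<le> \<bar>\<alpha> (Suc k)\<bar> + \<bar>\<beta> (Suc k)\<bar>" for k
    using cmod_le[of "a k"] by (simp add: a_def)
  have coefficient_term: "Re (w * (a k * w ^ k)) = \<alpha> (Suc k) * cos (real (Suc k) * Arg x) + \<beta> (Suc k) * sin (real (Suc k) * Arg x)" for k
  proof -
    have "w * (a k * w ^ k) = a k * cis (real (Suc k) * Arg x)"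
      by (simp only: w_def Complex.DeMoivre[symmetric] power_Suc) (simp add: mult_ac)
    then have "Re (w * (a k * w ^ k)) = Re (a k * cis (real (Suc k) * Arg x))"
      by (rule arg_cong)
    then show ?thesis by (simp only: a_def) (simp del: of_nat_Suc mult_eq_0_iff)
  qed
  have "cmod w = 1" by (simp add: w_def)
  then have sw: "summable (\<lambda>k. a k * w ^ k)"
    by (intro summable_norm_cancel[OF summable_comparison_test'[OF s, of 0]]) (use an in \<open>simp add: norm_mult norm_power\<close>)
  have "Re (w * (\<Sum>k. a k * w ^ k)) = Re (\<Sum>k. w * (a k * w ^ k))"
    by (simp add: suminf_mult[OF sw])
  also have "\<dots> = (\<Sum>k. Re (w * (a k * w ^ k)))"
    by (rule bounded_linear.suminf[OF bounded_linear_Re]) (rule summable_mult[OF sw])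
  also have "\<dots> = fourier_density \<alpha> \<beta> x"
    unfolding coefficient_term fourier_density_def by (rule suminf_add[OF sa sb, symmetric])
  finally show ?thesis by (simp add: xw a_def)
qed

lemma square_integrable_mono:
  assumes f: "square_integrable f" and g[measurable]: "g \<in> borel_measurable borel" and le: "\<And>x. cmod (g x) \<le> cmod (f x)"
  shows "square_integrable g"
proof -
  have "integrable lborel (\<lambda>x. (cmod (f x))\<^sup>2)" using f by (simp add: square_integrable_def)
  then have "integrable lborel (\<lambda>x. (cmod (g x))\<^sup>2)"
    by (rule Bochner_Integration.integrable_bound) (use le in \<open>auto intro!: power_mono\<close>)
  then show ?thesis by (simp add: square_integrable_def)
qed

lemma Re_of_real_mult: "Re (complex_of_real r * z) = r * Re z"
  by simp

lemma circle_mean_Re: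
  assumes c: "continuous_on (sphere p \<rho>) f" and \<rho>: "\<rho> > 0"
  shows "Re (circle_mean f p \<rho>) = Re (circle_mean (\<lambda>x. complex_of_real (Re (f x))) p \<rho>)"
proof -
  define g where "g t = f (p + complex_of_real \<rho> * cis t)" for t
  have "continuous_on {0..2 * pi} g"
    unfolding g_def
    by (rule continuous_on_compose2[OF c]) (use \<rho> in \<open>auto intro!: continuous_intros simp: dist_norm norm_mult\<close>)
  then have i: "set_integrable lborel {0..2 * pi} g" by (rule borel_integrable_atLeastAtMost')
  have "Re (LBINT t:{0..2 * pi}. g t) = (LBINT t:{0..2 * pi}. Re (g t))"
    unfolding set_lebesgue_integral_def
    by (subst integral_Re[symmetric]) (use i in \<open>auto simp: set_integrable_def\<close>)
  moreover have "(LBINT t:{0..2 * pi}. complex_of_real (Re (g t))) = complex_of_real (LBINT t:{0..2 * pi}. Re (g t))"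
    unfolding set_lebesgue_integral_def integral_complex_of_real[symmetric]
    by (rule Bochner_Integration.integral_cong) (auto simp: scaleR_conv_of_real)
  moreover have "Re (z / (2 * complex_of_real pi)) = Re z / (2 * pi)" for z
    using Re_divide_of_real[of z "2 * pi"] by simp
  ultimately show ?thesis by (simp add: circle_mean_def g_def)
qed

section \<open>Non-resonance\<close>

theorem theorem5p3:
  fixes R q :: real
  assumes "R > 1" and "q > R ^ 3"
  shows "\<exists>\<epsilon>\<^sub>0>0. \<exists>\<epsilon>\<^sub>1>0. \<forall>(z\<^sub>0 :: complex) (\<rho> :: real) (\<alpha> :: nat \<Rightarrow> real) (\<beta> :: nat \<Rightarrow> real).
    0 \<in> ball z\<^sub>0 \<rho> \<longrightarrow> ball z\<^sub>0 \<rho> \<subseteq> ball 0 1 \<longrightarrow> norm z\<^sub>0 < \<epsilon>\<^sub>0 \<longrightarrow> 1 - \<epsilon>\<^sub>1 < \<rho> \<longrightarrow> \<rho> < 1 \<longrightarrow>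
    summable (\<lambda>k. \<bar>\<alpha> (Suc k)\<bar> + \<bar>\<beta> (Suc k)\<bar>) \<longrightarrow>
    \<not> resonant (coefficient R (ball z\<^sub>0 \<rho>)) (circle_source q (fourier_density \<alpha> \<beta>))"
proof -
  have "R ^ 1 \<le> R ^ 3" "R\<^sup>2 \<le> R ^ 3" using assms(1) by (intro power_increasing; simp)+
  then have Rq: "R < q" "R\<^sup>2 < q" unfolding power_one_right using assms(2) by linarith+
  have q0: "q > 0" using Rq assms(1) by simp
  \<comment> \<open>Then \<open>\<rho> - |z\<^sub>0| > 1 - 2 \<epsilon> = R\<^sup>2 / q\<close>.\<close>
  define \<epsilon> where "\<epsilon> = (1 - R\<^sup>2 / q) / 2"
  have \<epsilon>: "\<epsilon> > 0" using Rq q0 by (simp add: \<epsilon>_def)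
  have "\<not> resonant (coefficient R (ball z\<^sub>0 \<rho>)) (circle_source q (fourier_density \<alpha> \<beta>))"
    if unit: "ball z\<^sub>0 \<rho> \<subseteq> ball 0 1" and z0: "norm z\<^sub>0 < \<epsilon>" and \<rho>: "1 - \<epsilon> < \<rho>"
      and s: "summable (\<lambda>k. \<bar>\<alpha> (Suc k)\<bar> + \<bar>\<beta> (Suc k)\<bar>)"
    for z\<^sub>0 :: complex and \<rho> :: real and \<alpha> \<beta> :: "nat \<Rightarrow> real"
  proof
    assume res: "resonant (coefficient R (ball z\<^sub>0 \<rho>)) (circle_source q (fourier_density \<alpha> \<beta>))"
    have gap: "R\<^sup>2 / q < \<rho> - cmod z\<^sub>0" using z0 \<rho> by (simp add: \<epsilon>_def field_simps)
    have "R\<^sup>2 / q > 0" using assms(1) q0 by simp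
    then have \<rho>0: "\<rho> > 0" using gap norm_ge_zero[of z\<^sub>0] by linarith
    define F where "F = fourier_density \<alpha> \<beta>"
    define a where "a k = Complex (\<alpha> (Suc k)) (- \<beta> (Suc k))" for k
    have "cmod (a k) \<le> \<bar>\<alpha> (Suc k)\<bar> + \<bar>\<beta> (Suc k)\<bar>" for k
      using cmod_le[of "a k"] by (simp add: a_def)
    then have a_sum: "summable (\<lambda>k. cmod (a k))"
      by (intro summable_comparison_test'[OF s, of 0]) simp
    define S where "S w = (\<Sum>k. a k * w ^ k)" for w
    note S = power_series_disk[OF a_sum, folded S_def]
    obtain \<kappa> where \<kappa>: "\<And>g. continuous_on (sphere 0 q) g \<Longrightarrow>
        complex_of_real (LINT x:sphere 0 q|hausdorff1. g x) = complex_of_real \<kappa> * circle_mean (\<lambda>x. complex_of_real (g x)) 0 q"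
      using hausdorff1_circle_integral[OF q0] by blast
    \<comment> \<open>Chosen so that the jump \<open>4 disk_area \<mu>\<close> of the flux cancels the mass \<open>\<kappa>\<close> of the source.\<close>
    define \<mu> where "\<mu> = - \<kappa> / (4 * disk_area)"
    define P where "P x = complex_of_real (\<mu> / q) * S (x / complex_of_real q)" for x
    have Sq: "continuous_on (cball 0 q) (\<lambda>x. S (x / complex_of_real q))"
      by (rule continuous_on_compose2[OF S(1)])
        (use q0 in \<open>auto intro!: continuous_intros simp: norm_divide\<close>)
    have Sh: "(\<lambda>x. S (x / complex_of_real q)) holomorphic_on ball 0 q"
    proof -
      have "S \<circ> (\<lambda>x. x / complex_of_real q) holomorphic_on ball 0 q"
        by (rule holomorphic_on_compose_gen[OF _ S(2)])
          (use q0 in \<open>auto intro!: holomorphic_intros simp: norm_divide\<close>)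
      then show ?thesis by (simp add: o_def)
    qed
    interpret superlens R q \<rho> z\<^sub>0 P
    proof
      show "P \<in> borel_measurable borel"
        unfolding P_def[abs_def] S_def by measurable
      show "continuous_on (cball 0 q) P" unfolding P_def[abs_def] by (intro continuous_intros Sq)
      show "P holomorphic_on ball 0 q" unfolding P_def[abs_def] by (intro holomorphic_intros Sh)
    qed (use assms Rq \<rho>0 unit gap in auto)
    have FP: "complex_of_real (\<mu> * F x) = complex_of_real (Re (P x * x))" if "cmod x = q" for x
    proof -
      have "P x * x = complex_of_real \<mu> * (x / complex_of_real q * S (x / complex_of_real q))"
        by (simp add: P_def)
      then have "Re (P x * x) = \<mu> * Re (x / complex_of_real q * S (x / complex_of_real q))"
        by (simp only: Re_complex_of_real Re_of_real_mult)
      also have "Re (x / complex_of_real q * S (x / complex_of_real q)) = F x"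
        unfolding F_def S_def a_def by (rule fourier_density_power_series[OF s q0 that, symmetric])
      finally show ?thesis by simp
    qed
    have Fc: "continuous_on (sphere 0 q) F"
    proof -
      have "continuous_on (sphere 0 q) (\<lambda>x. Re (x / complex_of_real q * S (x / complex_of_real q)))"
        by (intro continuous_intros continuous_on_subset[OF Sq]) (use q0 in auto)
      then show ?thesis
        by (rule continuous_on_eq) (simp add: F_def S_def a_def fourier_density_power_series[OF s q0])
    qed
    define v1 v2 where "v1 x = Re (field x)" and "v2 x = - Im (field x)" for x
    have sf: "square_integrable field"
      using field_bounds square_integrable_decay[OF field_measurable] by blast
    have m: "(\<lambda>x. complex_of_real (v1 x)) \<in> borel_measurable borel" "(\<lambda>x. complex_of_real (v2 x)) \<in> borel_measurable borel"
      unfolding v1_def v2_def by measurable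
    have sv: "square_integrable (\<lambda>x. complex_of_real (v1 x))" "square_integrable (\<lambda>x. complex_of_real (v2 x))"
      by (rule square_integrable_mono[OF sf m(1)] square_integrable_mono[OF sf m(2)];
          simp add: v1_def v2_def abs_Re_le_cmod abs_Im_le_cmod)+
    define A where "A = coefficient R (ball z\<^sub>0 \<rho>)"
    have Aeq: "A x = (if x \<in> ball z\<^sub>0 \<rho> then 1 else if cmod x < R then - 1 else 1)" for x
      by (simp add: A_def coefficient_def)
    have Am: "A \<in> borel_measurable borel"
    proof -
      have [measurable]: "ball z\<^sub>0 \<rho> \<in> sets borel" by simp
      show ?thesis unfolding Aeq[abs_def] by measurable
    qed
    have curl: "(\<integral>x. v1 x * partial2 \<phi> x \<partial>lborel) = (\<integral>x. v2 x * partial1 \<phi> x \<partial>lborel)" if \<phi>: "test_function \<phi>" for \<phi>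
    proof -
      note p = square_integrable_test[OF test_function_partial(1)[OF \<phi>]] square_integrable_test[OF test_function_partial(2)[OF \<phi>]]
      have i: "integrable lborel (\<lambda>x. v1 x * partial2 \<phi> x)" "integrable lborel (\<lambda>x. v2 x * partial1 \<phi> x)"
        using square_integrable_product[OF sv(1) p(2)] square_integrable_product[OF sv(2) p(1)]
        by (simp_all only: of_real_mult[symmetric] complex_of_real_integrable_eq)
      have w: "weighted_field 1 = field" by (auto simp: weighted_field_def)
      have "(\<integral>x. Im (field x * cgrad \<phi> x) \<partial>lborel) = 0"
        using integral_Im[OF weighted_field_green(1)[OF \<phi>, of 1]] field_curl_free[OF \<phi>] unfolding w by (rule trans)
      moreover have "Im (field x * cgrad \<phi> x) = v1 x * partial2 \<phi> x - v2 x * partial1 \<phi> x" for x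
        by (simp add: cgrad_def v1_def v2_def)
      ultimately show ?thesis using i by simp
    qed
    have div: "- (\<integral>x. A x * (v1 x * partial1 \<phi> x + v2 x * partial2 \<phi> x) \<partial>lborel) = circle_source q F \<phi>"
      if \<phi>: "test_function \<phi>" for \<phi>
    proof -
      define C where "C = Re (circle_mean (\<lambda>x. complex_of_real (F x * \<phi> x)) 0 q)"
      have "continuous_on (sphere 0 q) (\<lambda>x. F x * \<phi> x)"
        by (intro continuous_intros Fc test_functionD(2)[OF \<phi>])
      from \<kappa>[OF this] have source: "circle_source q F \<phi> = \<kappa> * C"
        unfolding circle_source_def C_def by (metis Re_complex_of_real Re_of_real_mult)
      have "Re (circle_mean (\<lambda>x. complex_of_real (\<phi> x) * (P x * x)) 0 q)
          = Re (circle_mean (\<lambda>x. complex_of_real (Re (complex_of_real (\<phi> x) * (P x * x)))) 0 q)"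
        by (intro circle_mean_Re q0 continuous_intros test_functionD(2)[OF \<phi>] continuous_on_subset[OF Pc]) auto
      also have "circle_mean (\<lambda>x. complex_of_real (Re (complex_of_real (\<phi> x) * (P x * x)))) 0 q
          = circle_mean (\<lambda>x. complex_of_real \<mu> * complex_of_real (F x * \<phi> x)) 0 q"
      proof (rule circle_mean_cong[OF _ q0])
        fix x :: complex assume "cmod (x - 0) = q"
        then have "Re (P x * x) = \<mu> * F x" using FP[of x] by (simp only: of_real_eq_iff diff_zero)
        moreover have "Re (complex_of_real (\<phi> x) * (P x * x)) = \<phi> x * Re (P x * x)"
          by (rule Re_of_real_mult)
        ultimately show "complex_of_real (Re (complex_of_real (\<phi> x) * (P x * x))) = complex_of_real \<mu> * complex_of_real (F x * \<phi> x)"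
          by (simp only: of_real_mult[symmetric] of_real_eq_iff) (simp only: mult_ac)
      qed
      also have "Re (circle_mean (\<lambda>x. complex_of_real \<mu> * complex_of_real (F x * \<phi> x)) 0 q) = \<mu> * C"
        unfolding circle_mean_mult C_def by (rule Re_of_real_mult)
      finally have "Re (\<integral>x. weighted_field (- 1) x * cgrad \<phi> x \<partial>lborel) = 4 * disk_area * (\<mu> * C)"
        using field_divergence[OF \<phi>] by simp
      also have "\<dots> = - circle_source q F \<phi>"
        using disk_area_pos unfolding source by (simp add: \<mu>_def)
      finally have "(\<integral>x. Re (weighted_field (- 1) x * cgrad \<phi> x) \<partial>lborel) = - circle_source q F \<phi>"
        using integral_Re[OF weighted_field_green(1)[OF \<phi>, of "- 1"]] by (simp only:)
      moreover have "Re (weighted_field (- 1) x * cgrad \<phi> x) = A x * (v1 x * partial1 \<phi> x + v2 x * partial2 \<phi> x)" for x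
        by (simp add: weighted_field_def cgrad_def v1_def v2_def Aeq algebra_simps)
      ultimately show ?thesis by simp
    qed
    obtain u where u: "\<And>\<eta>. \<eta> > 0 \<Longrightarrow> weak_solution A (circle_source q F) \<eta> (u \<eta>)"
      and lim: "Limsup (at_right 0) (\<lambda>\<eta>. ereal (energy \<eta> (u \<eta>))) = \<infinity>"
      using res unfolding resonant_def A_def F_def by blast
    define E where "E = (\<integral>x. (v1 x)\<^sup>2 + (v2 x)\<^sup>2 \<partial>lborel)"
    have E: "E \<ge> 0" unfolding E_def by (rule Bochner_Integration.integral_nonneg) simp
    have "energy \<eta> (u \<eta>) \<le> E" if \<eta>: "0 < \<eta>" "\<eta> < 1" for \<eta>
    proof -
      have "(\<integral>x. (norm (weak_grad (u \<eta>) x))\<^sup>2 \<partial>lebesgue) \<le> E"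
        unfolding E_def
        by (rule weak_solution_gradient_le[OF Am _ \<eta>(1) sv curl div u[OF \<eta>(1)]]) (simp add: Aeq)
      then have "energy \<eta> (u \<eta>) \<le> \<eta> / 2 * E"
        unfolding energy_def using \<eta> by (intro mult_left_mono) auto
      also have "\<dots> \<le> 1 * E" using \<eta> E by (intro mult_right_mono) auto
      finally show ?thesis by simp
    qed
    then have "\<forall>\<^sub>F \<eta> in at_right 0. ereal (energy \<eta> (u \<eta>)) \<le> ereal E"
      unfolding eventually_at_right_field by (intro exI[of _ 1]) auto
    then have "Limsup (at_right 0) (\<lambda>\<eta>. ereal (energy \<eta> (u \<eta>))) \<le> ereal E"
      by (rule Limsup_bounded)
    then show False using lim by simp
  qed
  then show ?thesis
    using \<epsilon> by (intro exI[of _ \<epsilon>] conjI allI impI) auto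
qed

end
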